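(* Let $X$ be a compact connected metric space, let $T:X\to X$ be a strictly ergodic homeomorphism, let $v\in C^{0}(X,\mathbb{C})$ and let $g>0$. Then $$\Sigma(g)=\mathcal{E}_{0}\cup\big(\Sigma(0)\cap\mathcal{E}_{+}\big),$$ where $\Sigma(g)$ and $\Sigma(0)$ denote the ($x$-independent) spectra of the operators $\mathcal{H}(g,x)$ and $\mathcal{H}(0,x)$ on $\ell^2(\mathbb{Z})$, and $\mathcal{E}_0=\{E\in\mathbb{C}:L(E)=g\}$, $\mathcal{E}_+=\{E\in\mathbb{C}:L(E)>g\}$ with $L$ the Lyapunov exponent of the Schrödinger cocycle.
   Context: $(X,T)$ is strictly ergodic if it is both minimal and uniquely ergodic; $\mu$ denotes the unique $T$-invariant Borel probability measure. For $g\ge 0$ and $x\in X$, the Hatano-Nelson operator $\mathcal{H}(g,x):\ell^2(\mathbb{Z})\to\ell^2(\mathbb{Z})$ is $$[\mathcal{H}(g,x)u]_n=-\mathrm{e}^{g}u_{n+1}-\mathrm{e}^{-g}u_{n-1}+v(T^nx)u_n,\quad n\in\mathbb{Z}.$$ Since $T$ is minimal, the spectrum of $\mathcal{H}(g,x)$ is the same set for all $x\in X$; it is denoted $\Sigma(g)\subseteq\mathbb{C}$. For $E\in\mathbb{C}$ let $$S_E(x)=\begin{pmatrix} v(x)-E&-1\\1&0\end{pmatrix},\qquad A_n(x)=S_E(T^{n-1}x)\cdots S_E(Tx)S_E(x)\quad (n\ge 1),$$ and define the Lyapunov exponent (corresponding to $g=0$) by $$L(E)=\lim_{n\to\infty}\int_X\frac1n\log\|A_n(x)\|\,\mathrm{d}\mu(x).$$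 *)

theory Defs
  imports "HOL-Probability.Probability"
begin

text \<open>The Hilbert space \<open>\<ell>\<^sup>2(\<int>)\<close> as a set of sequences, and bounded complex-linear operators on it.
  Operators are functions on all sequences of which only the values on \<open>ell2\<close> matter.\<close>

definition ell2 :: "(int \<Rightarrow> complex) set" where
  "ell2 = {u. (\<lambda>n. (cmod (u n))\<^sup>2) summable_on UNIV}"

definition ell2_norm :: "(int \<Rightarrow> complex) \<Rightarrow> real" where
  "ell2_norm u = sqrt (\<Sum>\<^sub>\<infinity>n. (cmod (u n))\<^sup>2)"

definition ell2_bounded_operator :: "((int \<Rightarrow> complex) \<Rightarrow> (int \<Rightarrow> complex)) \<Rightarrow> bool" where
  "ell2_bounded_operator A \<longleftrightarrow>
     (\<forall>u\<in>ell2. A u \<in> ell2) \<and>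
     (\<forall>u\<in>ell2. \<forall>w\<in>ell2. A (\<lambda>n. u n + w n) = (\<lambda>n. A u n + A w n)) \<and>
     (\<forall>c. \<forall>u\<in>ell2. A (\<lambda>n. c * u n) = (\<lambda>n. c * A u n)) \<and>
     (\<exists>C. \<forall>u\<in>ell2. ell2_norm (A u) \<le> C * ell2_norm u)"

definition ell2_spectrum :: "((int \<Rightarrow> complex) \<Rightarrow> (int \<Rightarrow> complex)) \<Rightarrow> complex set" where
  "ell2_spectrum A = {E. \<not> (\<exists>R. ell2_bounded_operator R \<and>
     (\<forall>u\<in>ell2. R (\<lambda>n. A u n - E * u n) = u \<and> (\<lambda>n. A (R u) n - E * R u n) = u))}"

definition int_iterate :: "('a \<Rightarrow> 'a) \<Rightarrow> int \<Rightarrow> 'a \<Rightarrow> 'a" where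
  "int_iterate T n = (if n \<ge> 0 then T ^^ nat n else inv T ^^ nat (- n))"

definition minimal_map :: "('a::topological_space \<Rightarrow> 'a) \<Rightarrow> bool" where
  "minimal_map T \<longleftrightarrow> (\<forall>x. closure (range (\<lambda>n. int_iterate T n x)) = UNIV)"

definition invariant_prob :: "('a::topological_space \<Rightarrow> 'a) \<Rightarrow> 'a measure \<Rightarrow> bool" where
  "invariant_prob T \<mu> \<longleftrightarrow> prob_space \<mu> \<and> sets \<mu> = sets borel \<and> distr \<mu> borel T = \<mu>"

definition uniquely_ergodic :: "('a::topological_space \<Rightarrow> 'a) \<Rightarrow> bool" where
  "uniquely_ergodic T \<longleftrightarrow> (\<exists>!\<mu>. invariant_prob T \<mu>)"

definition strictly_ergodic :: "('a::topological_space \<Rightarrow> 'a) \<Rightarrow> bool" where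
  "strictly_ergodic T \<longleftrightarrow> minimal_map T \<and> uniquely_ergodic T"

definition hatano_nelson ::
  "('a \<Rightarrow> 'a) \<Rightarrow> ('a \<Rightarrow> complex) \<Rightarrow> real \<Rightarrow> 'a \<Rightarrow> (int \<Rightarrow> complex) \<Rightarrow> (int \<Rightarrow> complex)" where
  "hatano_nelson T v g x u = (\<lambda>n.
     - of_real (exp g) * u (n + 1) - of_real (exp (- g)) * u (n - 1)
     + v (int_iterate T n x) * u n)"

definition schroedinger_matrix :: "('a \<Rightarrow> complex) \<Rightarrow> complex \<Rightarrow> 'a \<Rightarrow> complex^2^2" where
  "schroedinger_matrix v E x = vector [vector [v x - E, -1], vector [1, 0]]"

primrec schroedinger_cocycle ::
  "('a \<Rightarrow> 'a) \<Rightarrow> ('a \<Rightarrow> complex) \<Rightarrow> complex \<Rightarrow> nat \<Rightarrow> 'a \<Rightarrow> complex^2^2" where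
  "schroedinger_cocycle T v E 0 x = mat 1"
| "schroedinger_cocycle T v E (Suc n) x =
     schroedinger_matrix v E ((T ^^ n) x) ** schroedinger_cocycle T v E n x"

text \<open>The matrix norm is the operator norm for the Euclidean norm; the norm of the type
  \<^typ>\<open>complex^2^2\<close> itself is the Frobenius norm. The term at \<open>n = 0\<close> is \<open>0\<close> and does not
  affect the limit.\<close>

definition lyapunov_exponent ::
  "'a measure \<Rightarrow> ('a \<Rightarrow> 'a) \<Rightarrow> ('a \<Rightarrow> complex) \<Rightarrow> complex \<Rightarrow> real" where
  "lyapunov_exponent \<mu> T v E =
     lim (\<lambda>n. LINT x|\<mu>. 1 / real n * ln (onorm (\<lambda>w. schroedinger_cocycle T v E n x *v w)))"

end

theory Submission
  imports Defs
begin

text \<open>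
  Fix the energy \<open>E\<close>. Substituting \<open>u n = exp (- g n) * w n\<close> turns the eigenvalue equation of the
  Hatano-Nelson operator into the Schroedinger equation for \<open>w\<close>, so that inverting the operator in
  \<open>\<ell>\<^sup>2(\<int>)\<close> means finding a Green function of the Schroedinger equation that stays bounded after
  multiplication by \<open>exp (- g (n - m))\<close>. The theorem is equivalent to: \<open>E\<close> is outside the spectrum
  for \<open>g\<close> if and only if \<open>L(E) < g\<close>, or \<open>L(E) > g\<close> and \<open>E\<close> is outside the spectrum for \<open>g = 0\<close>
  (\<open>invertible_iff\<close>).

  If \<open>L(E) < g\<close>, unique ergodicity makes the bound \<open>\<parallel>A\<^sub>n(x)\<parallel> \<le> C exp (l n)\<close> hold uniformly in \<open>x\<close> for
  some \<open>l < g\<close>, and the causal Green function, which vanishes for \<open>n < m\<close>, decays exponentially after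
  the substitution.

  If the operator is invertible, its Green function forces an exponential dichotomy
  (\<open>exponential_dichotomy\<close>). Let \<open>p\<close> and \<open>q\<close> be solutions which, after the substitution, are square
  summable at \<open>+\<infinity>\<close> and at \<open>-\<infinity>\<close>. A nonzero \<open>p\<close> always exists, because the determinant of the
  Schroedinger cocycle is one and \<open>g \<ge> 0\<close>. If no nonzero \<open>q\<close> exists, then all solutions grow more
  slowly than \<open>exp (g n)\<close>, uniformly along the orbit; by minimality this holds for all \<open>x\<close>, and
  \<open>L(E) < g\<close>. Otherwise the Green function is \<open>p (max n m) * q (min n m)\<close> up to a constant, the
  solution \<open>q\<close> grows faster than \<open>exp (g n)\<close>, and no solution grows faster than \<open>q\<close>. Hence
  \<open>L(E) > g\<close>. In this case the Green function decays like the inverse of the growth of \<open>q\<close>. The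
  size of \<open>q\<close> along the orbit is exactly multiplicative and comparable to the norm of the cocycle, so
  unique ergodicity also gives a lower bound: \<open>q\<close> grows at least like \<open>exp (l n)\<close> for every
  \<open>l < L(E)\<close>. A Green function that decays with rate \<open>l\<close> gives inverses for all \<open>g < l\<close>. It therefore
  serves both to pass from \<open>g\<close> to \<open>0\<close> and, when \<open>g < L(E)\<close>, from \<open>0\<close> to \<open>g\<close>. Limits of its
  translates along the dense orbit of \<open>x\<close> are Green functions for any other point \<open>y\<close>.

  Unique ergodicity enters through the uniform convergence of ergodic averages. If it failed, a weak
  limit of empirical measures would be a second invariant measure. The limit is obtained by coding the
  compact space into the real line and applying Helly's selection theorem there.
\<close>

section \<open>Uniform convergence of ergodic averages\<close>

text \<open>
  The first differing digit outweighs all later ones together, since \<open>\<Sum>i>N. 3^(- i)\<close> is only half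
  of \<open>3^(- N)\<close>.
\<close>
lemma ternary_expansion_separates:
  fixes a b :: "nat \<Rightarrow> real"
  assumes "\<And>i. a i = 0 \<or> a i = 1" "\<And>i. b i = 0 \<or> b i = 1"
    and "\<And>i. i < N \<Longrightarrow> a i = b i" and "a N \<noteq> b N"
  shows "(1/2) * (1/3)^N \<le> \<bar>(\<Sum>i. a i * (1/3)^i) - (\<Sum>i. b i * (1/3)^i)\<bar>"
proof -
  have g: "summable (\<lambda>i. (1/3::real)^i)" by (rule summable_geometric) auto
  have c: "\<bar>t\<bar> \<le> 1" if "t = 0 \<or> t = 1" for t :: real using that by auto
  have sa: "summable (\<lambda>i. a i * (1/3)^i)"
    by (rule summable_comparison_test'[OF g, of 0]) (use c[OF assms(1)] in \<open>simp add: abs_mult\<close>)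
  have sb: "summable (\<lambda>i. b i * (1/3)^i)"
    by (rule summable_comparison_test'[OF g, of 0]) (use c[OF assms(2)] in \<open>simp add: abs_mult\<close>)
  define d where "d i = (a i - b i) * (1/3)^i" for i
  have sd: "summable d" unfolding d_def using summable_diff[OF sa sb] by (simp add: left_diff_distrib)
  have d1: "\<bar>d i\<bar> \<le> (1/3)^i" for i
    using assms(1)[of i] assms(2)[of i] unfolding d_def by (auto simp: abs_mult)
  have "(\<Sum>i. a i * (1/3)^i) - (\<Sum>i. b i * (1/3)^i) = suminf d"
    using suminf_diff[OF sa sb] by (simp add: d_def[abs_def] left_diff_distrib)
  also have "\<dots> = (\<Sum>i. d (i + Suc N)) + (\<Sum>i<Suc N. d i)"
    using suminf_split_initial_segment[OF sd, of "Suc N"] by simp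
  also have "(\<Sum>i<Suc N. d i) = d N" using assms(3) by (simp add: d_def)
  finally have eq: "(\<Sum>i. a i * (1/3)^i) - (\<Sum>i. b i * (1/3)^i) = (\<Sum>i. d (i + Suc N)) + d N" .
  have s2: "(\<lambda>i. (1/3::real)^(i + Suc N)) sums ((1/2) * (1/3)^N)"
  proof -
    have "(\<lambda>i. (1/3)^Suc N * (1/3::real)^i) sums ((1/3)^Suc N * (1 / (1 - 1/3)))"
      by (intro sums_mult geometric_sums) auto
    then show ?thesis by (simp add: power_add mult.commute)
  qed
  have "norm (\<Sum>i. d (i + Suc N)) \<le> (\<Sum>i. (1/3::real)^(i + Suc N))"
    by (rule norm_suminf_le) (use d1 s2 in \<open>auto simp: sums_iff simp del: power_Suc\<close>)
  then have "\<bar>\<Sum>i. d (i + Suc N)\<bar> \<le> (1/2) * (1/3)^N" using s2 by (simp add: sums_iff)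
  moreover have "\<bar>d N\<bar> = (1/3)^N"
    using assms(1)[of N] assms(2)[of N] assms(4) unfolding d_def by (auto simp: abs_mult)
  ultimately show ?thesis unfolding eq by linarith
qed

text \<open>
  A compact metric space need not embed in the line, but it has an injective, in general discontinuous,
  coding whose inverse is uniformly continuous: record as ternary digits which members of a countable
  family of small balls contain the point. Codes that agree on enough digits put both points into a
  common small ball. This is what transports weak compactness of measures from the line to the space.
\<close>
lemma compact_metric_real_coding:
  assumes "compact (UNIV :: 'a::metric_space set)"
  obtains s :: "'a::metric_space \<Rightarrow> real" where "\<And>x. 0 \<le> s x \<and> s x \<le> 2"
    "\<And>e. e > 0 \<Longrightarrow> \<exists>d>0. \<forall>x y. \<bar>s x - s y\<bar> < d \<longrightarrow> dist x y < e"
proof -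
  have "\<exists>F::'a set. finite F \<and> UNIV \<subseteq> (\<Union>p\<in>F. ball p (1 / real (Suc k)))" for k
    using compact_eq_totally_bounded[of "UNIV::'a set"] assms by fastforce
  then obtain F :: "nat \<Rightarrow> 'a set" where F: "\<And>k. finite (F k)"
     "\<And>k. UNIV \<subseteq> (\<Union>p\<in>F k. ball p (1 / real (Suc k)))" by metis
  define BB where "BB = (\<Union>k. (\<lambda>p. ball p (1 / real (Suc k))) ` F k)"
  have cB: "countable BB" unfolding BB_def using F(1) by (intro countable_UN) (auto intro: countable_finite)
  have "F 0 \<noteq> {}" using F(2)[of 0] by auto
  then have neB: "BB \<noteq> {}" unfolding BB_def by blast
  define B where "B = from_nat_into BB"
  have rB: "range B = BB" unfolding B_def by (rule range_from_nat_into[OF neB cB])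
  define a where "a x i = (if x \<in> B i then 1 else (0::real))" for x i
  have a01: "a x i = 0 \<or> a x i = 1" for x i unfolding a_def by auto
  \<comment> \<open>digits 0 and 1 in base 3, so that differing codes are separated\<close>
  define s where "s x = (\<Sum>i. a x i * (1/3)^i)" for x
  have g: "(\<lambda>i. (1/3::real)^i) sums (3/2)" using geometric_sums[of "1/3::real"] by simp
  have sm: "summable (\<lambda>i. a x i * (1/3)^i)" for x
    by (rule summable_comparison_test'[OF sums_summable[OF g], of 0]) (auto simp: a_def)
  show thesis
  proof
    fix x
    have "s x \<le> (\<Sum>i. (1/3::real)^i)" unfolding s_def
      by (rule suminf_le) (use sm sums_summable[OF g] in \<open>auto simp: a_def\<close>)
    moreover have "0 \<le> s x" unfolding s_def by (rule suminf_nonneg[OF sm]) (auto simp: a_def)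
    ultimately show "0 \<le> s x \<and> s x \<le> 2" using g by (simp add: sums_iff)
  next
    fix e :: real assume "e > 0"
    obtain k where k: "2 / real (Suc k) < e"
      using reals_Archimedean[of "e/2"] \<open>e > 0\<close> by (auto simp: inverse_eq_divide field_simps)
    have "(\<lambda>p. ball p (1 / real (Suc k))) ` F k \<subseteq> B ` UNIV" unfolding rB BB_def by blast
    then obtain I where I: "finite I" "(\<lambda>p. ball p (1 / real (Suc k))) ` F k = B ` I"
      using finite_subset_image[OF finite_imageI[OF F(1)]] by metis
    obtain M where M: "\<And>i. i \<in> I \<Longrightarrow> i < M" using I(1) finite_nat_set_iff_bounded by auto
    show "\<exists>d>0. \<forall>x y. \<bar>s x - s y\<bar> < d \<longrightarrow> dist x y < e"
    proof (intro exI[of _ "(1/2)*(1/3)^M"] conjI allI impI)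
      fix x y assume d: "\<bar>s x - s y\<bar> < (1/2)*(1/3)^M"
      have same: "a x i = a y i" if "i < M" for i
      proof (rule ccontr)
        assume ne: "a x i \<noteq> a y i"
        define N where "N = (LEAST j. a x j \<noteq> a y j)"
        have N: "a x N \<noteq> a y N" unfolding N_def by (rule LeastI[of "\<lambda>j. a x j \<noteq> a y j", OF ne])
        have N2: "a x j = a y j" if "j < N" for j using not_less_Least[of j "\<lambda>j. a x j \<noteq> a y j"] that unfolding N_def by blast
        have "N \<le> i" unfolding N_def by (rule Least_le[of "\<lambda>j. a x j \<noteq> a y j", OF ne])
        then have "(1/3::real)^M \<le> (1/3)^N" using that by (intro power_decreasing) auto
        moreover have "(1/2) * (1/3)^N \<le> \<bar>s x - s y\<bar>" unfolding s_def
          by (rule ternary_expansion_separates[where a="a x" and b="a y"]) (fact a01 N2 N)+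
        ultimately show False using d by linarith
      qed
      obtain p where p: "p \<in> F k" "x \<in> ball p (1 / real (Suc k))" using F(2)[of k] by blast
      then have "ball p (1 / real (Suc k)) \<in> B ` I" unfolding I(2)[symmetric] by blast
      then obtain i where i: "i \<in> I" "ball p (1 / real (Suc k)) = B i" by blast
      have "x \<in> B i" using p(2) unfolding i(2) .
      then have "y \<in> B i" using same[OF M[OF i(1)]] by (simp add: a_def split: if_splits)
      then have "dist p y < 1 / real (Suc k)" unfolding i(2)[symmetric] mem_ball .
      moreover have "dist p x < 1 / real (Suc k)" using p(2) unfolding mem_ball .
      moreover have "2 / real (Suc k) = 1 / real (Suc k) + 1 / real (Suc k)" by simp
      ultimately show "dist x y < e" using k dist_triangle3[of x y p] by linarith
    qed auto
  qed
qed

text \<open>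
  The indicator of a closed set is a pointwise limit of continuous functions of the distance to it, and
  closed sets form an intersection-stable generator of the Borel sets.
\<close>
lemma borel_prob_eqI_continuous:
  fixes M N :: "'a::metric_space measure"
  assumes M: "prob_space M" "sets M = sets borel" and N: "prob_space N" "sets N = sets borel"
    and eq: "\<And>f::'a\<Rightarrow>real. continuous_on UNIV f \<Longrightarrow> (\<And>x. \<bar>f x\<bar> \<le> 1) \<Longrightarrow> integral\<^sup>L M f = integral\<^sup>L N f"
  shows "M = N"
proof (rule measure_eqI_generator_eq[where E="Collect closed" and A="\<lambda>_. UNIV" and \<Omega>=UNIV])
  interpret M: prob_space M by fact
  interpret N: prob_space N by fact
  show "Int_stable (Collect closed :: 'a set set)" by (auto simp: Int_stable_def)
  show "sets M = sigma_sets UNIV (Collect closed)" "sets N = sigma_sets UNIV (Collect closed)"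
    unfolding M(2) N(2) borel_eq_closed by (auto simp: sets_measure_of)
  show "emeasure M UNIV \<noteq> \<infinity>" by simp
  fix C :: "'a set" assume "C \<in> Collect closed"
  then have C: "closed C" by simp
  show "emeasure M C = emeasure N C"
  proof (cases "C = {}")
    case False
    define f where "f n x = max 0 (1 - real n * infdist x C)" for n x
    have fc: "continuous_on UNIV (f n)" for n unfolding f_def
      by (intro continuous_intros)
    have fb: "\<bar>f n x\<bar> \<le> 1" for n x unfolding f_def by (auto simp: infdist_nonneg)
    have lim: "(\<lambda>n. f n x) \<longlonglongrightarrow> indicator C x" for x
    proof (cases "x \<in> C")
      case True then show ?thesis by (simp add: f_def)
    next
      case False
      then have "infdist x C > 0" using in_closed_iff_infdist_zero[OF C \<open>C \<noteq> {}\<close>] infdist_nonneg[of x C] by (metis less_eq_real_def)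
      then obtain n0 where "1 < real n0 * infdist x C" using reals_Archimedean3 by blast
      then have "f n x = 0" if "n \<ge> n0" for n
      proof -
        have *: "real n0 * infdist x C \<le> real n * infdist x C"
          using that \<open>infdist x C > 0\<close> by (intro mult_right_mono) auto
        show ?thesis unfolding f_def using * \<open>1 < real n0 * infdist x C\<close> by simp
      qed
      then have "eventually (\<lambda>n. f n x = 0) sequentially" by (auto simp: eventually_sequentially)
      then show ?thesis using False by (simp add: tendsto_eventually)
    qed
    have l: "(\<lambda>n. integral\<^sup>L P (f n)) \<longlonglongrightarrow> measure P C" if P: "prob_space P" "sets P = sets borel" for P
    proof -
      interpret P: prob_space P by fact
      have "(\<lambda>n. integral\<^sup>L P (f n)) \<longlonglongrightarrow> integral\<^sup>L P (indicator C :: 'a \<Rightarrow> real)"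
      proof (rule integral_dominated_convergence[where w="\<lambda>_. 1"])
        show "f i \<in> borel_measurable P" for i
          using borel_measurable_continuous_onI[OF fc] P(2) by (simp cong: measurable_cong_sets)
        show "(indicator C :: 'a \<Rightarrow> real) \<in> borel_measurable P" using borel_measurable_indicator[OF borel_closed[OF C]] P(2) by (simp cong: measurable_cong_sets)
      qed (use lim fb in auto)
      then show ?thesis using C P(2) sets_eq_imp_space_eq[OF P(2)] by simp
    qed
    have "measure M C = measure N C"
      using l[OF M] l[OF N] eq[OF fc fb] LIMSEQ_unique by auto
    then show ?thesis using M.emeasure_eq_measure N.emeasure_eq_measure by simp
  qed simp
qed auto

text \<open>
  A uniformly continuous function on the range of the coding extends to the closure of the range; here
  the function is the inverse of the coding, and compactness supplies the values.
\<close>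
lemma coding_decoder:
  fixes s :: "'a::metric_space \<Rightarrow> real"
  assumes cpt: "compact (UNIV :: 'a set)"
    and s: "\<And>e. e > 0 \<Longrightarrow> \<exists>d>0. \<forall>x y. \<bar>s x - s y\<bar> < d \<longrightarrow> dist x y < e"
  obtains d where "continuous_on (closure (range s)) d" "\<And>x. d (s x) = x"
proof -
  let ?K = "closure (range s)"
  have ex: "\<exists>x. \<forall>e>0. \<exists>t>0. \<forall>z. \<bar>s z - y\<bar> < t \<longrightarrow> dist z x < e" if "y \<in> ?K" for y
  proof -
    obtain u where u: "\<And>n. u n \<in> range s" "u \<longlonglongrightarrow> y"
      using \<open>y \<in> ?K\<close> unfolding closure_sequential by blast
    have "\<forall>n. \<exists>a. u n = s a" using u(1) by blast
    then obtain z where z: "\<And>n. u n = s (z n)" by metis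
    \<comment> \<open>the decoded point of a limit of codes is a limit of the coded points\<close>
    obtain x r where r: "strict_mono (r::nat\<Rightarrow>nat)" "(z \<circ> r) \<longlonglongrightarrow> x"
      using seq_compactE[OF compact_imp_seq_compact[OF cpt], of z] by (metis UNIV_I)
    have ur: "(\<lambda>n. s (z (r n))) \<longlonglongrightarrow> y"
      using LIMSEQ_subseq_LIMSEQ[OF u(2) r(1)] by (simp add: z o_def)
    show ?thesis
    proof (intro exI[of _ x] allI impI)
      fix e :: real assume "e > 0"
      obtain t where t: "t > 0" "\<And>a b. \<bar>s a - s b\<bar> < t \<Longrightarrow> dist a b < e/2"
        using s[of "e/2"] \<open>e > 0\<close> by auto
      show "\<exists>t>0. \<forall>z. \<bar>s z - y\<bar> < t \<longrightarrow> dist z x < e"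
      proof (intro exI[of _ "t/2"] conjI allI impI)
        fix a assume a: "\<bar>s a - y\<bar> < t/2"
        have "eventually (\<lambda>n. \<bar>s (z (r n)) - y\<bar> < t/2) sequentially"
          using tendstoD[OF ur, of "t/2"] t(1) by (simp add: dist_real_def)
        then have "eventually (\<lambda>n. dist a ((z \<circ> r) n) \<le> e/2) sequentially"
        proof (rule eventually_mono)
          fix n assume "\<bar>s (z (r n)) - y\<bar> < t/2"
          then have "\<bar>s a - s (z (r n))\<bar> < t" using a by linarith
          then show "dist a ((z \<circ> r) n) \<le> e/2" using t(2) less_imp_le by (simp add: less_imp_le)
        qed
        moreover have "(\<lambda>n. dist a ((z \<circ> r) n)) \<longlonglongrightarrow> dist a x" by (intro tendsto_dist r(2) tendsto_const)
        ultimately have "dist a x \<le> e/2" by (intro tendsto_upperbound) auto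
        then show "dist a x < e" using \<open>e > 0\<close> by linarith
      qed (use t in auto)
    qed
  qed
  define d where "d y = (SOME x. \<forall>e>0. \<exists>t>0. \<forall>z. \<bar>s z - y\<bar> < t \<longrightarrow> dist z x < e)" for y
  have d: "\<exists>t>0. \<forall>z. \<bar>s z - y\<bar> < t \<longrightarrow> dist z (d y) < e" if "y \<in> ?K" "e > 0" for y e
    using someI_ex[OF ex[OF that(1)]] that(2) unfolding d_def by blast
  show thesis
  proof
    show "continuous_on ?K d" unfolding continuous_on_iff
    proof (intro ballI allI impI)
      fix y :: real and e :: real assume y: "y \<in> ?K" and e: "e > 0"
      obtain t where t: "t > 0" "\<And>z. \<bar>s z - y\<bar> < t \<Longrightarrow> dist z (d y) < e/2"
        using d[OF y, of "e/2"] e by auto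
      show "\<exists>t>0. \<forall>y'\<in>?K. dist y' y < t \<longrightarrow> dist (d y') (d y) < e"
      proof (intro exI[of _ "t/2"] conjI ballI impI)
        fix y' assume y': "y' \<in> ?K" "dist y' y < t/2"
        obtain t' where t': "t' > 0" "\<And>z. \<bar>s z - y'\<bar> < t' \<Longrightarrow> dist z (d y') < e/2"
          using d[OF y'(1), of "e/2"] e by auto
        obtain z where "dist (s z) y' < min t' (t/2)"
          using y'(1) t(1) t'(1) unfolding closure_approachable by (metis imageE min_less_iff_conj half_gt_zero)
        then have zt: "\<bar>s z - y'\<bar> < t'" "\<bar>s z - y'\<bar> < t/2" by (auto simp: dist_real_def)
        have "\<bar>s z - y\<bar> < t" using zt(2) y'(2) unfolding dist_real_def by linarith
        from t(2)[OF this] t'(2)[OF zt(1)] dist_triangle3[of "d y'" "d y" z]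
        show "dist (d y') (d y) < e" by linarith
      qed (use t in auto)
    qed
    show "d (s x) = x" for x
    proof (rule ccontr)
      assume "d (s x) \<noteq> x"
      then have "dist x (d (s x)) > 0" by auto
      from d[of "s x", OF _ this] show False using closure_subset[of "range s"] by force
    qed
  qed
qed

text \<open>
  Push the measures to the line by the coding, where they live on a bounded interval, so that a
  subsequence converges weakly by Helly's theorem. The limit is carried by the closure of the codes and
  is pulled back by the decoder. A continuous function composed with the decoder extends to the whole
  line by Tietze's theorem, so its averages converge.
\<close>
lemma empirical_measures_weak_limit:
  fixes y :: "nat \<Rightarrow> nat \<Rightarrow> 'a::metric_space" and N :: "nat \<Rightarrow> nat"
  assumes cpt: "compact (UNIV :: 'a set)" and N: "\<And>j. N j > 0"
  obtains r \<nu> where "strict_mono (r :: nat \<Rightarrow> nat)" "prob_space \<nu>" "sets \<nu> = sets borel"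
    "\<And>f::'a\<Rightarrow>real. continuous_on UNIV f \<Longrightarrow>
       (\<lambda>j. (\<Sum>k<N (r j). f (y (r j) k)) / real (N (r j))) \<longlonglongrightarrow> integral\<^sup>L \<nu> f"
proof -
  obtain s :: "'a \<Rightarrow> real" where s01: "\<And>x. 0 \<le> s x \<and> s x \<le> 2"
    and s: "\<And>e. e > 0 \<Longrightarrow> \<exists>d>0. \<forall>x y. \<bar>s x - s y\<bar> < d \<longrightarrow> dist x y < e"
    using compact_metric_real_coding[OF cpt] by blast
  let ?K = "closure (range s)"
  obtain d where dc: "continuous_on ?K d" and ds: "\<And>x. d (s x) = x"
    using coding_decoder[OF cpt s] by blast
  define \<mu> where "\<mu> j = distr (measure_pmf (pmf_of_set {..<N j})) borel (\<lambda>k. s (y j k))" for j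
  have ne: "{..<N j} \<noteq> {}" for j using N[of j] by auto
  have rd: "real_distribution (\<mu> j)" for j
    unfolding \<mu>_def real_distribution_def real_distribution_axioms_def
    by (auto intro!: prob_space.prob_space_distr measure_pmf.prob_space_axioms)
  have int: "integral\<^sup>L (\<mu> j) F = (\<Sum>k<N j. F (s (y j k))) / real (N j)"
    if "F \<in> borel_measurable borel" for F :: "real \<Rightarrow> real" and j
    unfolding \<mu>_def using that ne[of j] by (simp add: integral_distr integral_pmf_of_set)
  have "tight \<mu>" unfolding tight_def
  proof (intro conjI allI impI rd)
    fix e :: real assume "e > 0"
    have "measure (\<mu> j) {-1<..2} = 1" for j
    proof -
      have "-1 < s x" for x using s01[of x] by linarith
      then have "(\<lambda>k. s (y j k)) -` {-1<..2} = UNIV" using s01 by auto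
      then show ?thesis unfolding \<mu>_def by (simp add: measure_distr)
    qed
    then show "\<exists>a b::real. a < b \<and> (\<forall>n. measure (\<mu> n) {a<..b} > 1 - e)"
      using \<open>e > 0\<close> by (intro exI[of _ "-1"] exI[of _ 2]) auto
  qed
  from tight_imp_convergent_subsubsequence[OF this strict_mono_id]
  obtain r M where r: "strict_mono (r :: nat \<Rightarrow> nat)" and M: "real_distribution M"
    and wc: "weak_conv_m (\<lambda>j. \<mu> (r j)) M" by (auto simp: o_def)
  interpret M: real_distribution M by fact
  have conv: "(\<lambda>j. (\<Sum>k<N (r j). F (s (y (r j) k))) / real (N (r j))) \<longlonglongrightarrow> integral\<^sup>L M F"
    if F: "continuous_on UNIV F" "\<And>x. \<bar>F x\<bar> \<le> B" for F :: "real \<Rightarrow> real" and B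
  proof -
    have "(\<lambda>j. integral\<^sup>L (\<mu> (r j)) F) \<longlonglongrightarrow> integral\<^sup>L M F"
      by (rule weak_conv_imp_integral_bdd_continuous_conv[OF rd M wc, of F B])
         (use F in \<open>auto simp: continuous_on_eq_continuous_at\<close>)
    then show ?thesis using int[OF borel_measurable_continuous_onI[OF F(1)]] by simp
  qed
  have sK: "s x \<in> ?K" for x using closure_subset[of "range s"] by auto
  define F0 where "F0 y = min 1 (infdist y ?K)" for y
  have F0c: "continuous_on UNIV F0" unfolding F0_def by (intro continuous_intros)
  have F0b: "\<bar>F0 y\<bar> \<le> 1" "0 \<le> F0 y" for y unfolding F0_def by (auto simp: infdist_nonneg)
  have "F0 (s x) = 0" for x using sK[of x] by (simp add: F0_def)
  then have "integral\<^sup>L M F0 = 0" using conv[OF F0c F0b(1)] LIMSEQ_unique[OF _ tendsto_const] by simp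
  moreover have "integrable M F0"
    by (rule M.integrable_const_bound[of _ 1]) (use F0b borel_measurable_continuous_onI[OF F0c] in auto)
  ultimately have "AE y in M. F0 y = 0" using integral_nonneg_eq_0_iff_AE[of M F0] F0b by simp
  then have AEK: "AE y in M. y \<in> ?K"
  proof (rule AE_mp, intro AE_I2 impI)
    fix y assume "F0 y = 0"
    then have "infdist y ?K = 0" unfolding F0_def by (auto simp: min_def split: if_splits)
    then show "y \<in> ?K" using in_closed_iff_infdist_zero[of ?K y] by auto
  qed
  \<comment> \<open>any point will do outside the closure of the codes, which is a null set\<close>
  define x0 :: 'a where "x0 = undefined"
  define dd where "dd y = (if y \<in> ?K then d y else x0)" for y
  have dm: "dd \<in> borel_measurable borel" unfolding dd_def
    by (rule borel_measurable_continuous_on_if) (use dc in auto)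
  define \<nu> where "\<nu> = distr M borel dd"
  show thesis
  proof
    show "strict_mono r" by fact
    show "prob_space \<nu>" unfolding \<nu>_def using dm by (intro M.prob_space_distr) auto
    show "sets \<nu> = sets borel" unfolding \<nu>_def by simp
    fix f :: "'a \<Rightarrow> real" assume f: "continuous_on UNIV f"
    have "bounded (range f)" using compact_imp_bounded[OF compact_continuous_image[OF f cpt]] .
    then obtain B where B: "\<And>x. \<bar>f x\<bar> \<le> B" unfolding bounded_iff by auto
    then have "0 \<le> B" by (meson abs_ge_zero order_trans)
    have "continuous_on ?K (\<lambda>y. f (d y))"
      by (rule continuous_on_compose2[OF f dc]) auto
    then obtain F where F: "continuous_on UNIV F" "\<And>y. y \<in> ?K \<Longrightarrow> F y = f (d y)" "\<And>y. norm (F y) \<le> B"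
      using Tietze[of ?K "\<lambda>y. f (d y)" UNIV B] \<open>0 \<le> B\<close> B by (auto simp: closed_closedin[symmetric])
    have Fs: "F (s x) = f x" for x using F(2)[OF sK] ds by simp
    have "integral\<^sup>L \<nu> f = integral\<^sup>L M (\<lambda>y. f (dd y))"
      unfolding \<nu>_def using dm borel_measurable_continuous_onI[OF f] by (intro integral_distr) auto
    also have "\<dots> = integral\<^sup>L M F"
    proof (rule integral_cong_AE)
      show "(\<lambda>y. f (dd y)) \<in> borel_measurable M"
        using measurable_compose[OF dm borel_measurable_continuous_onI[OF f]] by simp
      show "F \<in> borel_measurable M" using borel_measurable_continuous_onI[OF F(1)] by simp
      show "AE y in M. f (dd y) = F y" using AEK by (rule AE_mp) (auto simp: dd_def F(2))
    qed
    finally show "(\<lambda>j. (\<Sum>k<N (r j). f (y (r j) k)) / real (N (r j))) \<longlonglongrightarrow> integral\<^sup>L \<nu> f"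
      using conv[OF F(1), of B] F(3) Fs by simp
  qed
qed

text \<open>
  Otherwise there are orbit segments of unbounded length along which the average of \<open>f\<close> is at least
  \<open>c\<close>. A weak limit of the corresponding empirical measures is invariant, hence equal to \<open>\<mu>\<close>, although
  it gives \<open>f\<close> an integral of at least \<open>c\<close>.
\<close>
theorem uniquely_ergodic_averages_eventually_less:
  fixes T :: "'a::metric_space \<Rightarrow> 'a" and f :: "'a \<Rightarrow> real"
  assumes cpt: "compact (UNIV :: 'a set)" and T: "continuous_on UNIV T"
    and ue: "uniquely_ergodic T" and mu: "invariant_prob T \<mu>"
    and f: "continuous_on UNIV f" and c: "integral\<^sup>L \<mu> f < c"
  shows "\<exists>n0. \<forall>n\<ge>n0. \<forall>x. (\<Sum>k<n. f ((T ^^ k) x)) < real n * c"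
proof (rule ccontr)
  assume "\<not> ?thesis"
  then have "\<forall>j. \<exists>n x. n \<ge> Suc j \<and> real n * c \<le> (\<Sum>k<n. f ((T ^^ k) x))"
    by (auto simp: not_less)
  then obtain N x where N: "\<And>j. N j \<ge> Suc j" and le: "\<And>j. real (N j) * c \<le> (\<Sum>k<N j. f ((T ^^ k) (x j)))"
    by metis
  have Npos: "N j > 0" for j using N[of j] by auto
  obtain r \<nu> where r: "strict_mono (r :: nat \<Rightarrow> nat)" and \<nu>: "prob_space \<nu>" "sets \<nu> = sets borel"
    and lim: "\<And>f::'a\<Rightarrow>real. continuous_on UNIV f \<Longrightarrow>
       (\<lambda>j. (\<Sum>k<N (r j). f ((T ^^ k) (x (r j)))) / real (N (r j))) \<longlonglongrightarrow> integral\<^sup>L \<nu> f"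
    by (rule empirical_measures_weak_limit[OF cpt Npos, of "\<lambda>j k. (T ^^ k) (x j)"]; rule that; assumption)
  have Tm: "T \<in> borel_measurable borel" by (rule borel_measurable_continuous_onI[OF T])
  have Tm': "T \<in> measurable \<nu> borel" using Tm \<nu>(2) by (simp cong: measurable_cong_sets)
  have inv: "distr \<nu> borel T = \<nu>"
  proof (rule borel_prob_eqI_continuous)
    interpret prob_space \<nu> by fact
    show "prob_space (distr \<nu> borel T)" by (rule prob_space_distr[OF Tm'])
    fix h :: "'a \<Rightarrow> real" assume h: "continuous_on UNIV h" "\<And>x. \<bar>h x\<bar> \<le> 1"
    have hT: "continuous_on UNIV (\<lambda>x. h (T x))" by (rule continuous_on_compose2[OF h(1) T]) auto
    \<comment> \<open>invariance of the limit: shifting an orbit segment changes only its two end points\<close>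
    have d: "(\<Sum>k<n. h (T ((T ^^ k) z))) - (\<Sum>k<n. h ((T ^^ k) z)) = h ((T ^^ n) z) - h z" for n z
      by (induction n) auto
    have "(\<lambda>j. (\<Sum>k<N (r j). h (T ((T ^^ k) (x (r j))))) / real (N (r j))
            - (\<Sum>k<N (r j). h ((T ^^ k) (x (r j)))) / real (N (r j))) \<longlonglongrightarrow> 0"
    proof (rule Lim_null_comparison)
      show "\<forall>\<^sub>F j in sequentially. norm ((\<Sum>k<N (r j). h (T ((T ^^ k) (x (r j))))) / real (N (r j))
            - (\<Sum>k<N (r j). h ((T ^^ k) (x (r j)))) / real (N (r j))) \<le> 2 * inverse (real (Suc j))"
      proof (intro always_eventually allI)
        fix j
        let ?n = "N (r j)" and ?z = "x (r j)"
        have "real (Suc j) \<le> real ?n" using N[of "r j"] seq_suble[OF r, of j] by linarith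
        then have i: "inverse (real ?n) \<le> inverse (real (Suc j))" by (intro le_imp_inverse_le) auto
        have "\<bar>h ((T ^^ ?n) ?z) - h ?z\<bar> \<le> 2" using h(2)[of "(T ^^ ?n) ?z"] h(2)[of ?z] by linarith
        then have "\<bar>h ((T ^^ ?n) ?z) - h ?z\<bar> * inverse (real ?n) \<le> 2 * inverse (real (Suc j))"
          using i by (intro mult_mono) auto
        then show "norm ((\<Sum>k<?n. h (T ((T ^^ k) ?z))) / real ?n - (\<Sum>k<?n. h ((T ^^ k) ?z)) / real ?n) \<le> 2 * inverse (real (Suc j))"
          unfolding diff_divide_distrib[symmetric] d by (simp add: divide_inverse abs_mult)
      qed
      show "(\<lambda>j. 2 * inverse (real (Suc j))) \<longlonglongrightarrow> 0"
        using tendsto_mult[OF tendsto_const[of 2] LIMSEQ_inverse_real_of_nat] by simp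
    qed
    moreover have "(\<lambda>j. (\<Sum>k<N (r j). h (T ((T ^^ k) (x (r j))))) / real (N (r j))
            - (\<Sum>k<N (r j). h ((T ^^ k) (x (r j)))) / real (N (r j))) \<longlonglongrightarrow> integral\<^sup>L \<nu> (\<lambda>x. h (T x)) - integral\<^sup>L \<nu> h"
      by (intro tendsto_diff lim h hT)
    ultimately have "integral\<^sup>L \<nu> (\<lambda>x. h (T x)) - integral\<^sup>L \<nu> h = 0" using LIMSEQ_unique by blast
    then show "integral\<^sup>L (distr \<nu> borel T) h = integral\<^sup>L \<nu> h"
      using integral_distr[OF Tm' borel_measurable_continuous_onI[OF h(1)]] by simp
  qed (use \<nu> in auto)
  have "\<nu> = \<mu>" using ue mu \<nu> inv unfolding uniquely_ergodic_def invariant_prob_def by blast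
  moreover have "c \<le> integral\<^sup>L \<nu> f"
    by (rule LIMSEQ_le_const[OF lim[OF f]]) (use le Npos in \<open>auto simp: field_simps\<close>)
  ultimately show False using c by simp
qed

section \<open>Inverses given by exponentially decaying kernels\<close>

text \<open>
  The operator minus the energy along a single orbit: \<open>V n\<close> stands for \<open>v (T\<^sup>n x) - E\<close>.
\<close>
definition hn_op :: "(int \<Rightarrow> complex) \<Rightarrow> real \<Rightarrow> (int \<Rightarrow> complex) \<Rightarrow> (int \<Rightarrow> complex)" where
  "hn_op V g u = (\<lambda>n. - of_real (exp g) * u (n + 1) - of_real (exp (- g)) * u (n - 1) + V n * u n)"

definition ell2_invertible :: "((int \<Rightarrow> complex) \<Rightarrow> (int \<Rightarrow> complex)) \<Rightarrow> bool" where
  "ell2_invertible A \<longleftrightarrow> (\<exists>R. ell2_bounded_operator R \<and> (\<forall>u\<in>ell2. R (A u) = u \<and> A (R u) = u))"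

lemma not_in_spectrum_iff:
  "E \<notin> ell2_spectrum (hatano_nelson T v g x) \<longleftrightarrow> ell2_invertible (hn_op (\<lambda>n. v (int_iterate T n x) - E) g)"
  unfolding ell2_spectrum_def ell2_invertible_def hatano_nelson_def hn_op_def
  by (simp add: algebra_simps)

lemma summable_on_exp_abs_int:
  assumes "d > 0"
  shows "(\<lambda>k::int. exp (- d * real_of_int \<bar>k\<bar>)) summable_on UNIV"
proof -
  have s: "(\<lambda>n::nat. exp (- d * real n)) summable_on UNIV"
  proof (rule norm_summable_imp_summable_on)
    have "summable (\<lambda>n. exp (-d) ^ n)" by (rule summable_geometric) (use assms in auto)
    then show "summable (\<lambda>n. norm (exp (- d * real n)))" by (simp add: exp_of_nat_mult[symmetric] mult.commute)
  qed
  have U: "(UNIV::int set) = range int \<union> (\<lambda>n. - int (Suc n)) ` UNIV"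
  proof -
    have "k \<in> range int \<union> (\<lambda>n. - int (Suc n)) ` UNIV" for k
      by (cases k rule: int_cases) auto
    then show ?thesis by blast
  qed
  have "(\<lambda>k::int. exp (- d * real_of_int \<bar>k\<bar>)) summable_on (range int \<union> (\<lambda>n. - int (Suc n)) ` UNIV)"
  proof (rule summable_on_Un_disjoint)
    show "(\<lambda>k::int. exp (- d * real_of_int \<bar>k\<bar>)) summable_on range int"
      using s by (subst summable_on_reindex) (auto simp: o_def)
    have "(\<lambda>n::nat. exp (- d * real (Suc n))) summable_on UNIV"
      by (rule summable_on_comparison_test[OF s]) (use assms in auto)
    then show "(\<lambda>k::int. exp (- d * real_of_int \<bar>k\<bar>)) summable_on (\<lambda>n. - int (Suc n)) ` UNIV"
      by (subst summable_on_reindex) (auto simp: o_def inj_on_def add.commute)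
  qed auto
  then show ?thesis using U by simp
qed

lemma ell2_bounded:
  assumes "u \<in> ell2" shows "cmod (u n) \<le> ell2_norm u"
proof -
  have "(\<Sum>m\<in>{n}. (cmod (u m))\<^sup>2) \<le> (\<Sum>\<^sub>\<infinity>n. (cmod (u n))\<^sup>2)"
    by (rule finite_sum_le_infsum) (use assms in \<open>auto simp: ell2_def\<close>)
  then show ?thesis unfolding ell2_norm_def by (simp add: real_le_rsqrt)
qed

lemma infsum_Cauchy_Schwarz:
  fixes a b :: "'i \<Rightarrow> real"
  assumes a: "a summable_on A" "\<And>i. i \<in> A \<Longrightarrow> a i \<ge> 0"
    and b: "(\<lambda>i. a i * (b i)\<^sup>2) summable_on A"
    and ab: "(\<lambda>i. a i * b i) summable_on A" "\<And>i. i \<in> A \<Longrightarrow> b i \<ge> 0"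
  shows "(\<Sum>\<^sub>\<infinity>i\<in>A. a i * b i)\<^sup>2 \<le> (\<Sum>\<^sub>\<infinity>i\<in>A. a i) * (\<Sum>\<^sub>\<infinity>i\<in>A. a i * (b i)\<^sup>2)"
proof -
  let ?R = "(\<Sum>\<^sub>\<infinity>i\<in>A. a i) * (\<Sum>\<^sub>\<infinity>i\<in>A. a i * (b i)\<^sup>2)"
  have R0: "0 \<le> ?R" using a b by (intro mult_nonneg_nonneg infsum_nonneg) auto
  have "(\<Sum>\<^sub>\<infinity>i\<in>A. a i * b i) \<le> sqrt ?R"
  proof (rule infsum_le_finite_sums[OF ab(1)])
    fix F assume F: "finite F" "F \<subseteq> A"
    have "(\<Sum>i\<in>F. a i * b i)\<^sup>2 = (\<Sum>i\<in>F. sqrt (a i) * (sqrt (a i) * b i))\<^sup>2"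
      using F a(2) by (intro arg_cong[of _ _ "\<lambda>z. z\<^sup>2"] sum.cong) (auto simp: mult.assoc[symmetric] subset_iff)
    also have "\<dots> \<le> (\<Sum>i\<in>F. (sqrt (a i))\<^sup>2) * (\<Sum>i\<in>F. (sqrt (a i) * b i)\<^sup>2)"
      by (rule Cauchy_Schwarz_ineq_sum)
    also have "\<dots> = (\<Sum>i\<in>F. a i) * (\<Sum>i\<in>F. a i * (b i)\<^sup>2)"
      using F a(2) by (intro arg_cong2[of _ _ _ _ "(*)"] sum.cong) (auto simp: power_mult_distrib subset_iff)
    also have "\<dots> \<le> ?R"
      by (intro mult_mono finite_sum_le_infsum sum_nonneg infsum_nonneg) (use F a b in \<open>auto simp: subset_iff\<close>)
    finally show "(\<Sum>i\<in>F. a i * b i) \<le> sqrt ?R" by (rule real_le_rsqrt)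
  qed
  moreover have "0 \<le> (\<Sum>\<^sub>\<infinity>i\<in>A. a i * b i)" using a ab by (intro infsum_nonneg) auto
  ultimately have "(\<Sum>\<^sub>\<infinity>i\<in>A. a i * b i)\<^sup>2 \<le> (sqrt ?R)\<^sup>2" by (intro power_mono)
  then show ?thesis using R0 by simp
qed

text \<open>
  In the Schur test below only finitely many rows are summed at a time, so this interchange suffices.
\<close>
lemma infsum_finite_sum_swap:
  fixes f :: "'i \<Rightarrow> 'j \<Rightarrow> real"
  assumes "finite F" "\<And>i. i \<in> F \<Longrightarrow> f i summable_on A"
  shows "(\<lambda>j. \<Sum>i\<in>F. f i j) summable_on A \<and> (\<Sum>i\<in>F. \<Sum>\<^sub>\<infinity>j\<in>A. f i j) = (\<Sum>\<^sub>\<infinity>j\<in>A. \<Sum>i\<in>F. f i j)"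
  using assms
proof (induction rule: finite_induct)
  case (insert i F)
  then show ?case using summable_on_add[of "f i" A "\<lambda>j. \<Sum>i\<in>F. f i j"] infsum_add[of "f i" A "\<lambda>j. \<Sum>i\<in>F. f i j"] by auto
qed auto

text \<open>
  Schur's test: the rows and the columns of the majorant \<open>exp (- d \<bar>n - m\<bar>)\<close> all have the same finite
  sum, and Cauchy-Schwarz with this weight gives the bound.
\<close>
lemma ell2_kernel_bounded_operator:
  fixes G :: "int \<Rightarrow> int \<Rightarrow> complex"
  assumes d: "d > 0" and G: "\<And>n m. cmod (G n m) \<le> K * exp (- d * real_of_int \<bar>n - m\<bar>)"
  shows "ell2_bounded_operator (\<lambda>u n. \<Sum>\<^sub>\<infinity>m. G n m * u m)"
    and "\<And>f B n. (\<And>m. cmod (f m) \<le> B) \<Longrightarrow> (\<lambda>m. G n m * f m) summable_on UNIV"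
proof -
  define w where "w k = exp (- d * real_of_int \<bar>k\<bar>)" for k
  have wpos: "w k > 0" for k unfolding w_def by simp
  have w0: "0 \<le> w k" for k using wpos[of k] by simp
  have [simp]: "\<bar>w k\<bar> = w k" for k using w0[of k] by simp
  have ws: "w summable_on UNIV" unfolding w_def[abs_def] by (rule summable_on_exp_abs_int[OF d])
  define S where "S = infsum w UNIV"
  have S0: "S \<ge> 0" unfolding S_def using wpos by (intro infsum_nonneg) (auto intro: less_imp_le)
  have K0: "K \<ge> 0" using G[of 0 0] norm_ge_zero[of "G 0 0"] by (simp del: norm_ge_zero)
  have hs: "((\<lambda>m. w (n - m)) has_sum S) UNIV" for n
    using has_sum_infsum[OF ws] unfolding S_def
    by (subst has_sum_reindex_bij_witness[where i="\<lambda>m. n - m" and j="\<lambda>m. n - m" and T=UNIV and h=w]) auto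
  have hss: "(\<lambda>m. w (n - m)) summable_on UNIV" for n using hs[of n] by (auto simp: summable_on_def)
  have hs': "((\<lambda>n. w (n - m)) has_sum S) UNIV" for m
    using has_sum_infsum[OF ws] unfolding S_def
    by (subst has_sum_reindex_bij_witness[where i="\<lambda>n. n + m" and j="\<lambda>n. n - m" and T=UNIV and h=w]) auto
  have G': "cmod (G n m) \<le> K * w (n - m)" for n m using G unfolding w_def .
  have as: "(\<lambda>m. norm (G n m * f m)) summable_on UNIV" if "\<And>m. cmod (f m) \<le> B" for f :: "int \<Rightarrow> complex" and B n
  proof (rule Infinite_Sum.abs_summable_on_comparison_test)
    have "(\<lambda>m. K * B * w (n - m)) summable_on UNIV"
      using hs by (intro summable_on_cmult_right) (auto simp: summable_on_def)
    moreover have "B \<ge> 0" using that[of 0] norm_ge_zero order_trans by blast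
    ultimately show "(\<lambda>m. norm (K * B * w (n - m))) summable_on UNIV"
      using K0 wpos by (simp add: abs_mult)
    show "norm (G n m * f m) \<le> norm (K * B * w (n - m))" for m
    proof -
      have "cmod (G n m) * cmod (f m) \<le> (K * w (n - m)) * B"
        by (intro mult_mono G' that) (use K0 wpos[of "n - m"] in auto)
      then show ?thesis using K0 \<open>B \<ge> 0\<close> wpos[of "n-m"] by (simp add: norm_mult abs_mult mult_ac)
    qed
  qed
  show sm: "(\<lambda>m. G n m * f m) summable_on UNIV" if "\<And>m. cmod (f m) \<le> B" for f B n
    by (rule Infinite_Sum.abs_summable_summable[OF as[OF that]])
  define R where "R u n = (\<Sum>\<^sub>\<infinity>m. G n m * u m)" for u n
  have bnd: "(\<Sum>n\<in>F. (cmod (R u n))\<^sup>2) \<le> (K * S * ell2_norm u)\<^sup>2" if u: "u \<in> ell2" and F: "finite F" for u F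
  proof -
    have us: "(\<lambda>m. (cmod (u m))\<^sup>2) summable_on UNIV" using u by (simp add: ell2_def)
    have ub: "cmod (u m) \<le> ell2_norm u" for m by (rule ell2_bounded[OF u])
    have N0: "ell2_norm u \<ge> 0" using ub[of 0] norm_ge_zero order_trans by blast
    have w1: "w k \<le> 1" for k unfolding w_def using d by simp
    have s2: "(\<lambda>m. w (n - m) * (cmod (u m))\<^sup>2) summable_on UNIV" for n
      by (rule summable_on_comparison_test[OF us]) (auto intro!: mult_left_le_one_le mult_nonneg_nonneg w0 w1)
    have s1: "(\<lambda>m. w (n - m) * cmod (u m)) summable_on UNIV" for n
    proof (rule summable_on_comparison_test)
      show "(\<lambda>m. w (n - m) * ell2_norm u) summable_on UNIV"
        using hs by (intro summable_on_cmult_left) (auto simp: summable_on_def)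
    qed (use ub wpos less_imp_le in \<open>auto intro!: mult_left_mono mult_nonneg_nonneg\<close>)
    have 1: "(cmod (R u n))\<^sup>2 \<le> K\<^sup>2 * (S * (\<Sum>\<^sub>\<infinity>m. w (n - m) * (cmod (u m))\<^sup>2))" for n
    proof -
      have "cmod (R u n) \<le> K * (\<Sum>\<^sub>\<infinity>m. w (n - m) * cmod (u m))" unfolding R_def
      proof (rule norm_infsum_le)
        show "((\<lambda>m. G n m * u m) has_sum (\<Sum>\<^sub>\<infinity>m. G n m * u m)) UNIV"
          using sm[OF ub] by simp
        show "((\<lambda>m. K * (w (n - m) * cmod (u m))) has_sum K * (\<Sum>\<^sub>\<infinity>m. w (n - m) * cmod (u m))) UNIV"
          using s1 by (intro has_sum_cmult_right) simp
        show "cmod (G n m * u m) \<le> K * (w (n - m) * cmod (u m))" for m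
          using mult_right_mono[OF G', of "cmod (u m)" n m] by (simp add: norm_mult mult_ac)
      qed
      then have "(cmod (R u n))\<^sup>2 \<le> K\<^sup>2 * (\<Sum>\<^sub>\<infinity>m. w (n - m) * cmod (u m))\<^sup>2"
        using power_mono[OF _ norm_ge_zero, of "R u n" _ 2] by (metis power_mult_distrib)
      also have "(\<Sum>\<^sub>\<infinity>m. w (n - m) * cmod (u m))\<^sup>2 \<le> (\<Sum>\<^sub>\<infinity>m. w (n - m)) * (\<Sum>\<^sub>\<infinity>m. w (n - m) * (cmod (u m))\<^sup>2)"
        by (rule infsum_Cauchy_Schwarz) (use s1 s2 w0 hss in auto)
      also have "(\<Sum>\<^sub>\<infinity>m. w (n - m)) = S" using hs by (rule infsumI)
      finally show ?thesis by (simp add: mult_left_mono)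
    qed
    have "(\<Sum>n\<in>F. (cmod (R u n))\<^sup>2) \<le> (\<Sum>n\<in>F. K\<^sup>2 * (S * (\<Sum>\<^sub>\<infinity>m. w (n - m) * (cmod (u m))\<^sup>2)))"
      by (intro sum_mono 1)
    also have "\<dots> = K\<^sup>2 * (S * (\<Sum>n\<in>F. \<Sum>\<^sub>\<infinity>m. w (n - m) * (cmod (u m))\<^sup>2))"
      by (simp add: sum_distrib_left)
    finally have first: "(\<Sum>n\<in>F. (cmod (R u n))\<^sup>2) \<le> K\<^sup>2 * (S * (\<Sum>n\<in>F. \<Sum>\<^sub>\<infinity>m. w (n - m) * (cmod (u m))\<^sup>2))" .
    have "(\<Sum>n\<in>F. \<Sum>\<^sub>\<infinity>m. w (n - m) * (cmod (u m))\<^sup>2) = (\<Sum>\<^sub>\<infinity>m. \<Sum>n\<in>F. w (n - m) * (cmod (u m))\<^sup>2)"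
      using infsum_finite_sum_swap[OF F, of "\<lambda>n m. w (n - m) * (cmod (u m))\<^sup>2" UNIV] s2 by blast
    also have "\<dots> \<le> (\<Sum>\<^sub>\<infinity>m. S * (cmod (u m))\<^sup>2)"
    proof (rule infsum_mono)
      show "(\<lambda>m. \<Sum>n\<in>F. w (n - m) * (cmod (u m))\<^sup>2) summable_on UNIV"
        using infsum_finite_sum_swap[OF F, of "\<lambda>n m. w (n - m) * (cmod (u m))\<^sup>2" UNIV] s2 by blast
      show "(\<lambda>m. S * (cmod (u m))\<^sup>2) summable_on UNIV" by (intro summable_on_cmult_right us)
      show "(\<Sum>n\<in>F. w (n - m) * (cmod (u m))\<^sup>2) \<le> S * (cmod (u m))\<^sup>2" for m
      proof -
        have "(\<Sum>n\<in>F. w (n - m)) \<le> S"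
          by (rule finite_sum_le_has_sum[OF hs']) (use F wpos in \<open>auto simp: less_imp_le\<close>)
        then show ?thesis by (simp add: sum_distrib_right[symmetric] mult_right_mono)
      qed
    qed
    also have "\<dots> = S * (\<Sum>\<^sub>\<infinity>m. (cmod (u m))\<^sup>2)" by (intro infsum_cmult_right us)
    also have "(\<Sum>\<^sub>\<infinity>m. (cmod (u m))\<^sup>2) = (ell2_norm u)\<^sup>2" unfolding ell2_norm_def by (simp add: infsum_nonneg)
    finally have X: "(\<Sum>n\<in>F. \<Sum>\<^sub>\<infinity>m. w (n - m) * (cmod (u m))\<^sup>2) \<le> S * (ell2_norm u)\<^sup>2" .
    have "K\<^sup>2 * (S * (\<Sum>n\<in>F. \<Sum>\<^sub>\<infinity>m. w (n - m) * (cmod (u m))\<^sup>2)) \<le> K\<^sup>2 * (S * (S * (ell2_norm u)\<^sup>2))"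
      by (intro mult_left_mono X S0) auto
    also have "\<dots> = (K * S * ell2_norm u)\<^sup>2" by (simp add: power2_eq_square mult_ac)
    finally show ?thesis using first by simp
  qed
  have Ru: "R u \<in> ell2" if "u \<in> ell2" for u unfolding ell2_def mem_Collect_eq
    by (rule nonneg_bdd_above_summable_on) (use bnd[OF that] in \<open>auto intro!: bdd_aboveI2\<close>)
  have "ell2_bounded_operator R" unfolding ell2_bounded_operator_def
  proof (intro conjI ballI allI exI[of _ "K * S"])
    show "R u \<in> ell2" if "u \<in> ell2" for u by (rule Ru[OF that])
    show "R (\<lambda>n. u n + w n) = (\<lambda>n. R u n + R w n)" if "u \<in> ell2" "w \<in> ell2" for u w
      unfolding R_def using sm[OF ell2_bounded[OF that(1)]] sm[OF ell2_bounded[OF that(2)]]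
      by (auto simp: ring_distribs infsum_add)
    show "R (\<lambda>n. c * u n) = (\<lambda>n. c * R u n)" if "u \<in> ell2" for c u
      unfolding R_def using sm[OF ell2_bounded[OF that]] by (auto simp: mult.left_commute[of _ c] infsum_cmult_right)
    show "ell2_norm (R u) \<le> K * S * ell2_norm u" if "u \<in> ell2" for u
    proof -
      have "(\<Sum>\<^sub>\<infinity>n. (cmod (R u n))\<^sup>2) \<le> (K * S * ell2_norm u)\<^sup>2"
        by (rule infsum_le_finite_sums) (use Ru[OF that] bnd[OF that] in \<open>auto simp: ell2_def\<close>)
      moreover have "ell2_norm u \<ge> 0" using ell2_bounded[OF that, of 0] norm_ge_zero order_trans by blast
      ultimately show ?thesis unfolding ell2_norm_def[of "R u"] using K0 S0
        by (intro real_le_lsqrt) (auto intro: infsum_nonneg)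
    qed
  qed
  then show "ell2_bounded_operator (\<lambda>u n. \<Sum>\<^sub>\<infinity>m. G n m * u m)" unfolding R_def[abs_def] .
qed

text \<open>
  A kernel that decays exponentially and inverts the operator from the right and from the left defines
  the inverse. The transpose of the operator has parameter \<open>- g\<close>, which is how the left inverse is
  expressed.
\<close>
lemma hn_op_invertible_by_kernel:
  fixes G :: "int \<Rightarrow> int \<Rightarrow> complex"
  assumes d: "d > 0" and G: "\<And>n m. cmod (G n m) \<le> K * exp (- d * real_of_int \<bar>n - m\<bar>)"
    and V: "\<And>n. cmod (V n) \<le> B"
    and right: "\<And>m. hn_op V g (\<lambda>n. G n m) = (\<lambda>n. if n = m then 1 else 0)"
    and left: "\<And>n. hn_op V (- g) (\<lambda>m. G n m) = (\<lambda>m. if m = n then 1 else 0)"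
  shows "ell2_invertible (hn_op V g)"
proof -
  define R where "R u n = (\<Sum>\<^sub>\<infinity>m. G n m * u m)" for u n
  note sm = ell2_kernel_bounded_operator(2)[where G=G, OF d G]
  have dl: "((\<lambda>m. (if m = n then 1 else 0) * u m) has_sum u n) UNIV" for u :: "int \<Rightarrow> complex" and n
    by (rule has_sum_finite_neutralI[of "{n}"]) auto
  show ?thesis unfolding ell2_invertible_def
  proof (intro exI[of _ R] conjI ballI)
    show "ell2_bounded_operator R" unfolding R_def[abs_def] by (rule ell2_kernel_bounded_operator(1)[where G=G, OF d G])
    fix u :: "int \<Rightarrow> complex" assume u: "u \<in> ell2"
    note ub = ell2_bounded[OF u]
    show "R (hn_op V g u) = u"
    proof
      fix n
      have a: "((\<lambda>m. G n m * u (m + 1)) has_sum (\<Sum>\<^sub>\<infinity>m. G n m * u (m + 1))) UNIV" by (rule has_sum_infsum[OF sm]) (rule ub)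
      have b: "((\<lambda>m. G n m * u (m - 1)) has_sum (\<Sum>\<^sub>\<infinity>m. G n m * u (m - 1))) UNIV" by (rule has_sum_infsum[OF sm]) (rule ub)
      have c: "((\<lambda>m. G n m * (V m * u m)) has_sum (\<Sum>\<^sub>\<infinity>m. G n m * (V m * u m))) UNIV"
      proof (rule has_sum_infsum[OF sm])
        show "cmod (V m * u m) \<le> B * ell2_norm u" for m unfolding norm_mult
          by (intro mult_mono V ub) (use V[of 0] norm_ge_zero order_trans in blast)+
      qed
      have a': "((\<lambda>m. G n (m - 1) * u m) has_sum (\<Sum>\<^sub>\<infinity>m. G n m * u (m + 1))) UNIV"
        using a by (subst has_sum_reindex_bij_witness[where i="\<lambda>m. m + 1" and j="\<lambda>m. m - 1" and T=UNIV and h="\<lambda>m. G n m * u (m + 1)"]) auto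
      have b': "((\<lambda>m. G n (m + 1) * u m) has_sum (\<Sum>\<^sub>\<infinity>m. G n m * u (m - 1))) UNIV"
        using b by (subst has_sum_reindex_bij_witness[where i="\<lambda>m. m - 1" and j="\<lambda>m. m + 1" and T=UNIV and h="\<lambda>m. G n m * u (m - 1)"]) auto
      have 1: "((\<lambda>m. - of_real (exp g) * (G n m * u (m + 1)) + - of_real (exp (- g)) * (G n m * u (m - 1)) + G n m * (V m * u m))
        has_sum (- of_real (exp g) * (\<Sum>\<^sub>\<infinity>m. G n m * u (m + 1)) + - of_real (exp (- g)) * (\<Sum>\<^sub>\<infinity>m. G n m * u (m - 1)) + (\<Sum>\<^sub>\<infinity>m. G n m * (V m * u m)))) UNIV"
        by (intro has_sum_add has_sum_cmult_right a b c)
      have 2: "((\<lambda>m. - of_real (exp g) * (G n (m - 1) * u m) + - of_real (exp (- g)) * (G n (m + 1) * u m) + G n m * (V m * u m))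
        has_sum (- of_real (exp g) * (\<Sum>\<^sub>\<infinity>m. G n m * u (m + 1)) + - of_real (exp (- g)) * (\<Sum>\<^sub>\<infinity>m. G n m * u (m - 1)) + (\<Sum>\<^sub>\<infinity>m. G n m * (V m * u m)))) UNIV"
        by (intro has_sum_add has_sum_cmult_right a' b' c)
      have "- of_real (exp g) * (G n (m - 1) * u m) + - of_real (exp (- g)) * (G n (m + 1) * u m) + G n m * (V m * u m)
         = hn_op V (- g) (\<lambda>m. G n m) m * u m" for m
        unfolding hn_op_def by (simp add: algebra_simps)
      then have 3: "- of_real (exp g) * (\<Sum>\<^sub>\<infinity>m. G n m * u (m + 1)) + - of_real (exp (- g)) * (\<Sum>\<^sub>\<infinity>m. G n m * u (m - 1)) + (\<Sum>\<^sub>\<infinity>m. G n m * (V m * u m)) = u n"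
        using 2 dl[of n u] by (intro has_sum_unique[OF 2]) (simp add: left)
      have "R (hn_op V g u) n = (\<Sum>\<^sub>\<infinity>m. - of_real (exp g) * (G n m * u (m + 1)) + - of_real (exp (- g)) * (G n m * u (m - 1)) + G n m * (V m * u m))"
        unfolding R_def hn_op_def by (simp add: algebra_simps)
      also have "\<dots> = u n" using infsumI[OF 1] 3 by simp
      finally show "R (hn_op V g u) n = u n" .
    qed
    show "hn_op V g (R u) = u"
    proof
      fix n
      have a: "((\<lambda>m. G n m * u m) has_sum R u n) UNIV" for n unfolding R_def by (rule has_sum_infsum[OF sm]) (rule ub)
      have "((\<lambda>m. - of_real (exp g) * (G (n + 1) m * u m) + - of_real (exp (- g)) * (G (n - 1) m * u m) + V n * (G n m * u m))
         has_sum (- of_real (exp g) * R u (n + 1) + - of_real (exp (- g)) * R u (n - 1) + V n * R u n)) UNIV"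
        by (intro has_sum_add has_sum_cmult_right a)
      moreover have "- of_real (exp g) * (G (n + 1) m * u m) + - of_real (exp (- g)) * (G (n - 1) m * u m) + V n * (G n m * u m) = (if m = n then 1 else 0) * u m" for m
      proof -
        have "- of_real (exp g) * (G (n + 1) m * u m) + - of_real (exp (- g)) * (G (n - 1) m * u m) + V n * (G n m * u m)
          = hn_op V g (\<lambda>n. G n m) n * u m" by (simp add: hn_op_def algebra_simps)
        then show ?thesis by (simp add: right eq_commute[of n m])
      qed
      ultimately have "((\<lambda>m. (if m = n then 1 else 0) * u m) has_sum hn_op V g (R u) n) UNIV"
        by (simp add: hn_op_def)
      then show "hn_op V g (R u) n = u n" using dl has_sum_unique by blast
    qed
  qed
qed

section \<open>Solutions, Wronskians and Green columns\<close>

definition schroedinger_solution :: "(int \<Rightarrow> complex) \<Rightarrow> (int \<Rightarrow> complex) \<Rightarrow> bool" where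
  "schroedinger_solution V w \<longleftrightarrow> (\<forall>n. w (n + 1) = V n * w n - w (n - 1))"

text \<open>
  The Euclidean norm of the vector on which the transfer matrices act.
\<close>
definition phase_norm :: "(int \<Rightarrow> complex) \<Rightarrow> int \<Rightarrow> real" where
  "phase_norm w n = sqrt ((cmod (w n))\<^sup>2 + (cmod (w (n - 1)))\<^sup>2)"

definition wronskian :: "(int \<Rightarrow> complex) \<Rightarrow> (int \<Rightarrow> complex) \<Rightarrow> int \<Rightarrow> complex" where
  "wronskian p q n = p n * q (n - 1) - p (n - 1) * q n"

lemma solution_step: "schroedinger_solution V w \<Longrightarrow> w (n + 1) = V n * w n - w (n - 1)"
  unfolding schroedinger_solution_def by blast

lemma solution_step_back: "schroedinger_solution V w \<Longrightarrow> w (n - 1) = V n * w n - w (n + 1)"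
  using solution_step[of V w n] by simp

lemma phase_norm_nonneg [simp]: "0 \<le> phase_norm w n"
  unfolding phase_norm_def by simp

lemma phase_norm_sq: "(phase_norm w n)\<^sup>2 = (cmod (w n))\<^sup>2 + (cmod (w (n - 1)))\<^sup>2"
  unfolding phase_norm_def by simp

lemma norm_le_phase_norm: "cmod (w n) \<le> phase_norm w n" "cmod (w (n - 1)) \<le> phase_norm w n"
  unfolding phase_norm_def by (auto intro: real_le_rsqrt)

lemma phase_norm_triangle: "phase_norm (\<lambda>n. a * p n + b * q n) n \<le> cmod a * phase_norm p n + cmod b * phase_norm q n"
proof -
  have "phase_norm (\<lambda>n. a * p n + b * q n) n \<le> sqrt ((cmod (a * p n) + cmod (b * q n))\<^sup>2 + (cmod (a * p (n - 1)) + cmod (b * q (n - 1)))\<^sup>2)"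
    unfolding phase_norm_def by (intro real_sqrt_le_mono add_mono power_mono norm_triangle_ineq) auto
  also have "\<dots> \<le> sqrt ((cmod (a * p n))\<^sup>2 + (cmod (a * p (n - 1)))\<^sup>2) + sqrt ((cmod (b * q n))\<^sup>2 + (cmod (b * q (n - 1)))\<^sup>2)"
    by (rule real_sqrt_sum_squares_triangle_ineq)
  also have "\<dots> = cmod a * phase_norm p n + cmod b * phase_norm q n"
    unfolding phase_norm_def norm_mult power_mult_distrib distrib_left[symmetric] real_sqrt_mult by simp
  finally show ?thesis .
qed

lemma wronskian_le: "cmod (wronskian p q n) \<le> phase_norm p n * phase_norm q n"
proof -
  have "cmod (wronskian p q n) \<le> cmod (p n) * cmod (q (n - 1)) + cmod (p (n - 1)) * cmod (q n)"
    unfolding wronskian_def by (metis norm_mult norm_triangle_ineq4)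
  also have "\<dots> \<le> phase_norm p n * phase_norm q n"
  proof (rule power2_le_imp_le)
    have "(a * d + b * c)\<^sup>2 \<le> (a\<^sup>2 + b\<^sup>2) * (c\<^sup>2 + d\<^sup>2)" for a b c d :: real
    proof -
      have "(a\<^sup>2 + b\<^sup>2) * (c\<^sup>2 + d\<^sup>2) - (a * d + b * c)\<^sup>2 = (a * c - b * d)\<^sup>2" by algebra
      then show ?thesis using zero_le_power2[of "a * c - b * d"] by linarith
    qed
    then show "(cmod (p n) * cmod (q (n - 1)) + cmod (p (n - 1)) * cmod (q n))\<^sup>2 \<le> (phase_norm p n * phase_norm q n)\<^sup>2"
      by (simp add: power_mult_distrib phase_norm_sq)
  qed simp
  finally show ?thesis .
qed

lemma int_bi_induct [case_names base up down]:
  fixes P :: "int \<Rightarrow> bool"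
  assumes "P k" "\<And>n. n \<ge> k \<Longrightarrow> P n \<Longrightarrow> P (n + 1)" "\<And>n. n \<le> k \<Longrightarrow> P n \<Longrightarrow> P (n - 1)"
  shows "P n"
  using int_induct[of P k n] assms by blast

lemma wronskian_const:
  assumes "schroedinger_solution V p" "schroedinger_solution V q"
  shows "wronskian p q n = wronskian p q k"
proof -
  have s: "wronskian p q (n + 1) = wronskian p q n" for n
    unfolding wronskian_def solution_step[OF assms(1), of n] solution_step[OF assms(2), of n]
    by (simp add: algebra_simps)
  show ?thesis
  proof (induction n rule: int_bi_induct[where k=k])
    case (up n) then show ?case using s[of n] by simp
  next
    case (down n) then show ?case using s[of "n - 1"] by simp
  qed simp
qed

lemma solution_agrees_forward:
  assumes p: "schroedinger_solution V p" and w: "\<And>n. n > m \<Longrightarrow> w (n + 1) = V n * w n - w (n - 1)"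
    and "p m = w m" "p (m + 1) = w (m + 1)" and "n \<ge> m"
  shows "p n = w n"
proof -
  have "p n = w n \<and> p (n + 1) = w (n + 1)"
    using \<open>n \<ge> m\<close>
  proof (induction n rule: int_ge_induct)
    case (step i)
    then show ?case using solution_step[OF p, of "i + 1"] w[of "i + 1"] by simp
  qed (use assms in auto)
  then show ?thesis by simp
qed

lemma solution_agrees_backward:
  assumes p: "schroedinger_solution V p" and w: "\<And>n. n < m \<Longrightarrow> w (n + 1) = V n * w n - w (n - 1)"
    and "p m = w m" "p (m - 1) = w (m - 1)" and "n \<le> m"
  shows "p n = w n"
proof -
  have "p n = w n \<and> p (n - 1) = w (n - 1)"
    using \<open>n \<le> m\<close>
  proof (induction n rule: int_le_induct)
    case (step i)
    then show ?case using solution_step_back[OF p, of "i - 1"] w[of "i - 1"] by simp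
  qed (use assms in auto)
  then show ?thesis by simp
qed

lemma solution_unique:
  assumes "schroedinger_solution V p" "schroedinger_solution V w" "p k = w k" "p (k - 1) = w (k - 1)"
  shows "p = w"
proof
  fix n
  have "p (k + 1) = w (k + 1)" using assms solution_step by metis
  then show "p n = w n"
    using solution_agrees_forward[OF assms(1), of k w n] solution_agrees_backward[OF assms(1), of k w n]
      solution_step[OF assms(2)] assms(3,4) by (cases "n \<ge> k") auto
qed

text \<open>
  The recursion can be run in both directions from the data at two neighbouring sites.
\<close>
lemma solution_exists:
  obtains w where "schroedinger_solution V w" "w k = a" "w (k - 1) = b"
proof -
  define P where "P = rec_nat (a, b) (\<lambda>j xy. (V (k + int j) * fst xy - snd xy, fst xy))"
  define Q where "Q = rec_nat (a, b) (\<lambda>j xy. (snd xy, V (k - 1 - int j) * snd xy - fst xy))"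
  have P: "P 0 = (a, b)" "\<And>j. P (Suc j) = (V (k + int j) * fst (P j) - snd (P j), fst (P j))" unfolding P_def by auto
  have Q: "Q 0 = (a, b)" "\<And>j. Q (Suc j) = (snd (Q j), V (k - 1 - int j) * snd (Q j) - fst (Q j))" unfolding Q_def by auto
  define w where "w n = (if n \<ge> k then fst (P (nat (n - k))) else fst (Q (nat (k - n))))" for n
  have wk: "w k = a" "w (k - 1) = b" unfolding w_def using P(1) Q by (auto simp: nat_1)
  have wP: "w (k + int j) = fst (P j)" "w (k + int j - 1) = snd (P j)" for j
  proof -
    show "w (k + int j) = fst (P j)" unfolding w_def by simp
    show "w (k + int j - 1) = snd (P j)" using wk P by (cases j) (auto simp: w_def)
  qed
  have wQ: "w (k - int j) = fst (Q j)" "w (k - int j - 1) = snd (Q j)" for j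
  proof -
    show 1: "w (k - int j) = fst (Q j)" for j using Q(1) unfolding w_def by (cases "j = 0") (auto simp: P(1))
    show "w (k - int j - 1) = snd (Q j)" using 1[of "Suc j"] Q(2)[of j] by (simp add: algebra_simps)
  qed
  have "w (n + 1) = V n * w n - w (n - 1)" for n
  proof (cases "n \<ge> k")
    case True
    then obtain j where j: "n = k + int j" using zle_iff_zadd by blast
    show ?thesis using wP[of j] wP(1)[of "Suc j"] P(2)[of j] unfolding j by (simp add: algebra_simps)
  next
    case False
    then obtain j where j: "k - 1 = n + int j" using zle_iff_zadd[of n "k - 1"] by auto
    then have n: "n = k - 1 - int j" by simp
    show ?thesis using wQ[of j] wQ(2)[of "Suc j"] Q(2)[of j] unfolding n by (simp add: algebra_simps)
  qed
  then show thesis using that[of w] wk unfolding schroedinger_solution_def by blast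
qed

lemma solution_lincomb:
  assumes "schroedinger_solution V p" "schroedinger_solution V q"
  shows "schroedinger_solution V (\<lambda>n. a * p n + b * q n)"
  unfolding schroedinger_solution_def
proof
  fix n
  show "a * p (n + 1) + b * q (n + 1) = V n * (a * p n + b * q n) - (a * p (n - 1) + b * q (n - 1))"
    unfolding solution_step[OF assms(1), of n] solution_step[OF assms(2), of n] by (simp add: algebra_simps)
qed

lemma phase_norm_pos:
  assumes "schroedinger_solution V p" "p \<noteq> (\<lambda>_. 0)"
  shows "phase_norm p n > 0"
proof (rule ccontr)
  assume "\<not> ?thesis"
  then have "phase_norm p n = 0" using phase_norm_nonneg[of p n] by linarith
  then have "p n = 0" "p (n - 1) = 0" using norm_le_phase_norm[of p n] by auto
  moreover have "schroedinger_solution V (\<lambda>_. 0)" by (simp add: schroedinger_solution_def)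
  ultimately show False using solution_unique[OF assms(1), of "\<lambda>_. 0" n] assms(2) by simp
qed

text \<open>
  Membership of \<open>exp (- g n) * w n\<close> in \<open>\<ell>\<^sup>2(A)\<close>; the half-lines are needed to speak of
  square summability at one end only.
\<close>
definition weighted_ell2 :: "real \<Rightarrow> (int \<Rightarrow> complex) \<Rightarrow> int set \<Rightarrow> bool" where
  "weighted_ell2 g w A \<longleftrightarrow> (\<lambda>n. exp (- 2 * g * real_of_int n) * (cmod (w n))\<^sup>2) summable_on A"

text \<open>
  A solution of the inhomogeneous Schroedinger equation with a source of strength \<open>c\<close> at site \<open>m\<close>;
  for \<open>c = 1\<close> a column of a Green function.
\<close>
definition green_column :: "(int \<Rightarrow> complex) \<Rightarrow> int \<Rightarrow> complex \<Rightarrow> (int \<Rightarrow> complex) \<Rightarrow> bool" where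
  "green_column V m c w \<longleftrightarrow> (\<forall>n. - w (n + 1) - w (n - 1) + V n * w n = (if n = m then c else 0))"

text \<open>
  The gauge transformation that removes the imaginary vector potential \<open>g\<close>.
\<close>
lemma hn_op_conjugation:
  "hn_op V g (\<lambda>n. of_real (exp (- g * real_of_int n)) * w n) n
     = of_real (exp (- g * real_of_int n)) * (- w (n + 1) - w (n - 1) + V n * w n)"
proof -
  have 1: "exp g * exp (- g * real_of_int (n + 1)) = exp (- g * real_of_int n)"
    by (simp add: exp_add[symmetric] algebra_simps)
  have 2: "exp (- g) * exp (- g * real_of_int (n - 1)) = exp (- g * real_of_int n)"
    by (simp add: exp_add[symmetric] algebra_simps)
  have "hn_op V g (\<lambda>n. of_real (exp (- g * real_of_int n)) * w n) n =
    - (of_real (exp g * exp (- g * real_of_int (n + 1))) * w (n + 1)) - of_real (exp (- g) * exp (- g * real_of_int (n - 1))) * w (n - 1)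
    + V n * (of_real (exp (- g * real_of_int n)) * w n)"
    unfolding hn_op_def of_real_mult by (simp add: mult.assoc)
  then show ?thesis unfolding 1 2 by (simp add: algebra_simps)
qed

lemma exp_weight_square: "(cmod (of_real (exp (- g * real_of_int n)) * w n))\<^sup>2 = exp (- 2 * g * real_of_int n) * (cmod (w n))\<^sup>2"
  unfolding norm_mult power_mult_distrib by (simp add: exp_double[symmetric])

lemma weighted_ell2_iff: "weighted_ell2 g w UNIV \<longleftrightarrow> (\<lambda>n. of_real (exp (- g * real_of_int n)) * w n) \<in> ell2"
  unfolding weighted_ell2_def ell2_def mem_Collect_eq exp_weight_square ..

text \<open>
  All that the dichotomy uses about the inverse: it produces one weighted square summable column for
  each site, and it bounds every such column, which in particular makes the column unique.
\<close>
lemma invertible_imp_green_columns: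
  assumes "ell2_invertible (hn_op V g)"
  obtains C where "C \<ge> 0" "\<And>m. \<exists>w. weighted_ell2 g w UNIV \<and> green_column V m 1 w"
    "\<And>m c w F. weighted_ell2 g w UNIV \<Longrightarrow> green_column V m c w \<Longrightarrow> finite F \<Longrightarrow>
       (\<Sum>n\<in>F. exp (- 2 * g * real_of_int n) * (cmod (w n))\<^sup>2) \<le> C\<^sup>2 * (cmod c)\<^sup>2 * exp (- 2 * g * real_of_int m)"
proof -
  obtain R where bo: "ell2_bounded_operator R" and R: "\<And>u. u \<in> ell2 \<Longrightarrow> R (hn_op V g u) = u"
     "\<And>u. u \<in> ell2 \<Longrightarrow> hn_op V g (R u) = u"
    using assms unfolding ell2_invertible_def by blast
  obtain C0 where C0: "\<And>u. u \<in> ell2 \<Longrightarrow> ell2_norm (R u) \<le> C0 * ell2_norm u"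
    using bo unfolding ell2_bounded_operator_def by blast
  have Rl: "R u \<in> ell2" if "u \<in> ell2" for u using bo that unfolding ell2_bounded_operator_def by blast
  define e where "e m c = (\<lambda>n::int. if n = m then c else (0::complex))" for m c
  have e: "((\<lambda>n. (cmod (e m c n))\<^sup>2) has_sum (cmod c)\<^sup>2) UNIV" for m c
    by (rule has_sum_finite_neutralI[of "{m}"]) (auto simp: e_def)
  have el: "e m c \<in> ell2" for m c using e[of m c] unfolding ell2_def by (auto simp: summable_on_def)
  have en: "ell2_norm (e m c) = cmod c" for m c unfolding ell2_norm_def using infsumI[OF e[of m c]] by simp
  have n0: "0 \<le> ell2_norm u" for u unfolding ell2_norm_def by (simp add: infsum_nonneg)
  have C00: "0 \<le> C0" using C0[OF el[of 0 1]] n0[of "R (e 0 1)"] en[of 0 1] by simp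
  show thesis
  proof (rule that[OF C00])
    fix m :: int
    define z where "z = R (e m (of_real (exp (- g * real_of_int m))))"
    define w where "w n = of_real (exp (g * real_of_int n)) * z n" for n
    have zw: "z = (\<lambda>n. of_real (exp (- g * real_of_int n)) * w n)"
      unfolding w_def by (auto simp: mult.assoc[symmetric] of_real_mult[symmetric] exp_add[symmetric] simp del: of_real_mult)
    have "weighted_ell2 g w UNIV" unfolding weighted_ell2_iff zw[symmetric] unfolding z_def by (rule Rl[OF el])
    moreover have "green_column V m 1 w" unfolding green_column_def
    proof
      fix n
      have "hn_op V g z n = e m (of_real (exp (- g * real_of_int m))) n" unfolding z_def using R(2)[OF el] by simp
      then show "- w (n + 1) - w (n - 1) + V n * w n = (if n = m then 1 else 0)"
        unfolding zw hn_op_conjugation by (auto simp: e_def split: if_splits)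
    qed
    ultimately show "\<exists>w. weighted_ell2 g w UNIV \<and> green_column V m 1 w" by blast
  next
    fix m c w and F :: "int set" assume w: "weighted_ell2 g w UNIV" "green_column V m c w" and F: "finite F"
    define z where "z = (\<lambda>n. of_real (exp (- g * real_of_int n)) * w n)"
    have zl: "z \<in> ell2" using w(1) unfolding weighted_ell2_iff z_def .
    have "hn_op V g z = e m (of_real (exp (- g * real_of_int m)) * c)"
      unfolding z_def hn_op_conjugation using w(2) by (auto simp: e_def green_column_def)
    then have "z = R (e m (of_real (exp (- g * real_of_int m)) * c))" using R(1)[OF zl] by simp
    then have nz: "ell2_norm z \<le> C0 * (exp (- g * real_of_int m) * cmod c)"
      using C0[OF el, of m "of_real (exp (- g * real_of_int m)) * c"] en by (simp add: norm_mult)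
    have "(\<Sum>n\<in>F. exp (- 2 * g * real_of_int n) * (cmod (w n))\<^sup>2) = (\<Sum>n\<in>F. (cmod (z n))\<^sup>2)"
      unfolding z_def exp_weight_square ..
    also have "\<dots> \<le> (\<Sum>\<^sub>\<infinity>n. (cmod (z n))\<^sup>2)"
      by (rule finite_sum_le_infsum) (use zl F in \<open>auto simp: ell2_def\<close>)
    also have "\<dots> = (ell2_norm z)\<^sup>2" unfolding ell2_norm_def by (simp add: infsum_nonneg)
    also have "\<dots> \<le> (C0 * (exp (- g * real_of_int m) * cmod c))\<^sup>2" by (rule power_mono[OF nz n0])
    also have "\<dots> = C0\<^sup>2 * (cmod c)\<^sup>2 * exp (- 2 * g * real_of_int m)"
      by (simp add: power_mult_distrib exp_double[symmetric] mult_ac)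
    finally show "(\<Sum>n\<in>F. exp (- 2 * g * real_of_int n) * (cmod (w n))\<^sup>2) \<le> C0\<^sup>2 * (cmod c)\<^sup>2 * exp (- 2 * g * real_of_int m)" .
  qed
qed

text \<open>
  The hypothesis gives \<open>a n \<le> A * a j\<close> for \<open>j \<le> n\<close>. Summing this over \<open>j\<close> gains a factor that is
  linear in the length of the interval; a long enough interval beats the constants.
\<close>
lemma summable_tail_imp_decay:
  fixes a :: "int \<Rightarrow> real"
  assumes nn: "\<And>n. a n \<ge> 0" and "A \<ge> 0"
    and sum: "\<And>m n. m \<le> n \<Longrightarrow> (\<Sum>j\<in>{m..n}. a j) \<le> A * a m" and N: "4 * A\<^sup>2 \<le> real N"
  shows "a (m + int N) \<le> a m / 4"
proof -
  let ?n = "m + int N"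
  have 1: "a ?n \<le> A * a j" if "j \<in> {m..?n}" for j
  proof -
    have "a ?n \<le> (\<Sum>i\<in>{j..?n}. a i)" by (rule member_le_sum) (use that nn in auto)
    also have "\<dots> \<le> A * a j" using sum that by simp
    finally show ?thesis .
  qed
  have "real (N + 1) * a ?n = (\<Sum>j\<in>{m..?n}. a ?n)" by simp
  also have "\<dots> \<le> (\<Sum>j\<in>{m..?n}. A * a j)" by (rule sum_mono[OF 1])
  also have "\<dots> = A * (\<Sum>j\<in>{m..?n}. a j)" by (simp add: sum_distrib_left)
  also have "\<dots> \<le> A * (A * a m)" by (rule mult_left_mono) (use sum[of m ?n] \<open>A \<ge> 0\<close> in auto)
  finally have 2: "real (N + 1) * a ?n \<le> A\<^sup>2 * a m" by (simp add: power2_eq_square mult_ac)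
  show ?thesis
  proof (cases "A = 0")
    case True
    then have "a ?n \<le> 0" using 1[of m] by simp
    then show ?thesis using nn[of m] by simp
  next
    case False
    have "4 * A\<^sup>2 * a ?n \<le> real (N + 1) * a ?n" by (rule mult_right_mono) (use N nn in auto)
    then have "A\<^sup>2 * (4 * a ?n) \<le> A\<^sup>2 * a m" using 2 by (simp add: mult_ac)
    then have "4 * a ?n \<le> a m" using False by simp
    then show ?thesis by simp
  qed
qed

text \<open>
  The preceding lemma read from right to left.
\<close>
lemma summable_tail_imp_growth:
  fixes a :: "int \<Rightarrow> real"
  assumes nn: "\<And>n. a n \<ge> 0" and A: "A \<ge> 0"
    and sum: "\<And>m n. m \<le> n \<Longrightarrow> (\<Sum>j\<in>{m..n}. a j) \<le> A * a n" and N: "4 * A\<^sup>2 \<le> real N"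
  shows "a m \<le> a (m + int N) / 4"
proof -
  have "(\<Sum>j\<in>{m..n}. a (- j)) \<le> A * a (- m)" if "m \<le> n" for m n
  proof -
    have "(\<Sum>j\<in>{m..n}. a (- j)) = (\<Sum>j\<in>{-n..-m}. a j)"
      by (rule sum.reindex_bij_witness[of _ uminus uminus]) auto
    then show ?thesis using sum[of "-n" "-m"] that by simp
  qed
  from summable_tail_imp_decay[of "\<lambda>n. a (- n)", OF nn A this N, of "- (m + int N)"]
  show ?thesis by (simp add: add.commute)
qed

text \<open>
  For \<open>g \<ge> 0\<close> the weight at \<open>j\<close> is at most the weight at \<open>j - 1\<close>, so every value of \<open>w\<close> is counted at
  most twice.
\<close>
lemma sum_phase_norm_le:
  assumes g: "g \<ge> 0"
  shows "(\<Sum>j\<in>{a..b}. exp (- 2 * g * real_of_int j) * (phase_norm w j)\<^sup>2)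
    \<le> 2 * (\<Sum>j\<in>{a-1..b}. exp (- 2 * g * real_of_int j) * (cmod (w j))\<^sup>2)"
proof -
  define f where "f j = exp (- 2 * g * real_of_int j) * (cmod (w j))\<^sup>2" for j
  have f0: "f j \<ge> 0" for j unfolding f_def by simp
  have 1: "exp (- 2 * g * real_of_int j) * (phase_norm w j)\<^sup>2 \<le> f j + f (j - 1)" for j
  proof -
    have "exp (- 2 * g * real_of_int j) \<le> exp (- 2 * g * real_of_int (j - 1))" using g by (simp add: algebra_simps)
    then have "exp (- 2 * g * real_of_int j) * (cmod (w (j - 1)))\<^sup>2 \<le> f (j - 1)"
      unfolding f_def by (intro mult_right_mono) auto
    then show ?thesis unfolding phase_norm_sq distrib_left f_def by simp
  qed
  have "(\<Sum>j\<in>{a..b}. exp (- 2 * g * real_of_int j) * (phase_norm w j)\<^sup>2) \<le> (\<Sum>j\<in>{a..b}. f j + f (j - 1))"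
    by (rule sum_mono[OF 1])
  also have "\<dots> = (\<Sum>j\<in>{a..b}. f j) + (\<Sum>j\<in>{a..b}. f (j - 1))" by (rule sum.distrib)
  also have "(\<Sum>j\<in>{a..b}. f (j - 1)) = (\<Sum>j\<in>{a-1..b-1}. f j)"
    by (rule sum.reindex_bij_witness[of _ "\<lambda>j. j + 1" "\<lambda>j. j - 1"]) auto
  also have "\<dots> \<le> (\<Sum>j\<in>{a-1..b}. f j)" by (rule sum_mono2) (use f0 in auto)
  also have "(\<Sum>j\<in>{a..b}. f j) \<le> (\<Sum>j\<in>{a-1..b}. f j)" by (rule sum_mono2) (use f0 in auto)
  finally show ?thesis unfolding f_def by simp
qed

lemma sum_phase_norm_forward:
  assumes g: "g \<ge> 0" and "m \<le> n"
  shows "(\<Sum>j\<in>{m..n}. exp (- 2 * g * real_of_int j) * (phase_norm w j)\<^sup>2)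
    \<le> exp (- 2 * g * real_of_int m) * (phase_norm w m)\<^sup>2 + 2 * (\<Sum>j\<in>{m..n}. exp (- 2 * g * real_of_int j) * (cmod (w j))\<^sup>2)"
proof -
  have "{m..n} = insert m {m+1..n}" using \<open>m \<le> n\<close> by auto
  then have "(\<Sum>j\<in>{m..n}. exp (- 2 * g * real_of_int j) * (phase_norm w j)\<^sup>2)
    = exp (- 2 * g * real_of_int m) * (phase_norm w m)\<^sup>2 + (\<Sum>j\<in>{m+1..n}. exp (- 2 * g * real_of_int j) * (phase_norm w j)\<^sup>2)"
    by simp
  then show ?thesis using sum_phase_norm_le[OF g, of w "m+1" n] by simp
qed

lemma sum_phase_norm_backward:
  assumes g: "g \<ge> 0" and "m \<le> n"
  shows "(\<Sum>j\<in>{m..n}. exp (- 2 * g * real_of_int j) * (phase_norm w j)\<^sup>2)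
    \<le> exp (- 2 * g * real_of_int n) * (phase_norm w n)\<^sup>2 + 2 * (\<Sum>j\<in>{m-1..n-1}. exp (- 2 * g * real_of_int j) * (cmod (w j))\<^sup>2)"
proof -
  have "{m..n} = insert n {m..n-1}" using \<open>m \<le> n\<close> by auto
  then have "(\<Sum>j\<in>{m..n}. exp (- 2 * g * real_of_int j) * (phase_norm w j)\<^sup>2)
    = exp (- 2 * g * real_of_int n) * (phase_norm w n)\<^sup>2 + (\<Sum>j\<in>{m..n-1}. exp (- 2 * g * real_of_int j) * (phase_norm w j)\<^sup>2)"
    by simp
  then show ?thesis using sum_phase_norm_le[OF g, of w m "n-1"] by simp
qed

lemma summable_on_finite_diff:
  fixes f :: "'i \<Rightarrow> real"
  assumes "f summable_on A" "finite (B - A)"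
  shows "f summable_on B"
proof -
  have "f summable_on (A \<union> (B - A))" by (rule summable_on_Un_disjoint) (use assms in auto)
  then show ?thesis by (rule summable_on_subset_banach) auto
qed

lemma weighted_ell2_transfer:
  assumes "weighted_ell2 g w A" "\<And>n. n \<in> B \<inter> A \<Longrightarrow> p n = w n" "finite (B - A)"
  shows "weighted_ell2 g p B"
proof -
  have "(\<lambda>n. exp (- 2 * g * real_of_int n) * (cmod (w n))\<^sup>2) summable_on (B \<inter> A)"
    using assms(1) unfolding weighted_ell2_def by (rule summable_on_subset_banach) auto
  then have "(\<lambda>n. exp (- 2 * g * real_of_int n) * (cmod (p n))\<^sup>2) summable_on (B \<inter> A)"
    by (rule summable_on_cong[THEN iffD1, rotated]) (use assms(2) in auto)
  moreover have "B - (B \<inter> A) = B - A" by blast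
  ultimately show ?thesis unfolding weighted_ell2_def using assms(3) by (auto intro: summable_on_finite_diff)
qed

lemma weighted_ell2_Un:
  assumes "weighted_ell2 g w A" "weighted_ell2 g w B"
  shows "weighted_ell2 g w (A \<union> B)"
proof -
  have "weighted_ell2 g w (B - A)" 
  proof (rule weighted_ell2_transfer[OF assms(2) refl])
    have e: "B - A - B = {}" by blast
    show "finite (B - A - B)" unfolding e by (rule finite.emptyI)
  qed
  with assms(1) have "weighted_ell2 g w (A \<union> (B - A))"
    unfolding weighted_ell2_def by (rule summable_on_Un_disjoint) blast
  then show ?thesis by (simp only: Un_Diff_cancel)
qed

lemma weighted_ell2_cmult:
  assumes "weighted_ell2 g w A" shows "weighted_ell2 g (\<lambda>n. c * w n) A"
  using summable_on_cmult_right[OF assms[unfolded weighted_ell2_def], of "(cmod c)\<^sup>2"]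
  unfolding weighted_ell2_def by (simp add: norm_mult power_mult_distrib mult_ac)

lemma green_column_step:
  assumes "green_column V m c w" "n \<noteq> m"
  shows "w (n + 1) = V n * w n - w (n - 1)"
  using assms unfolding green_column_def by (auto simp: algebra_simps dest: spec[of _ n])

text \<open>
  To the left of the source a column solves the homogeneous equation, so it is part of a solution that
  is summable at \<open>-\<infinity>\<close>.
\<close>
lemma green_column_zero_backward:
  assumes w: "weighted_ell2 g w UNIV" "green_column V m c w"
    and nob: "\<And>q. schroedinger_solution V q \<Longrightarrow> weighted_ell2 g q {..0} \<Longrightarrow> q = (\<lambda>_. 0)"
    and "n \<le> m"
  shows "w n = 0"
proof -
  obtain q where q: "schroedinger_solution V q" "q m = w m" "q (m - 1) = w (m - 1)" using solution_exists by blast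
  have eq: "q n = w n" if "n \<le> m" for n
    by (rule solution_agrees_backward[OF q(1) _ q(2,3) that]) (use green_column_step[OF w(2)] in auto)
  have "weighted_ell2 g q {..m}" by (rule weighted_ell2_transfer[OF w(1)]) (use eq in auto)
  then have "weighted_ell2 g q {..0}"
    by (rule weighted_ell2_transfer) (auto intro: finite_subset[of _ "{m..0}"])
  then show ?thesis using nob[OF q(1)] eq[OF \<open>n \<le> m\<close>] by (simp add: fun_eq_iff)
qed

lemma green_column_zero_forward:
  assumes w: "weighted_ell2 g w UNIV" "green_column V m c w"
    and nof: "\<And>p. schroedinger_solution V p \<Longrightarrow> weighted_ell2 g p {0..} \<Longrightarrow> p = (\<lambda>_. 0)"
    and "n \<ge> m"
  shows "w n = 0"
proof -
  obtain p where p: "schroedinger_solution V p" "p (m + 1) = w (m + 1)" "p (m + 1 - 1) = w m" using solution_exists by blast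
  have eq: "p n = w n" if "n \<ge> m" for n
    by (rule solution_agrees_forward[where w=w, OF p(1) _ _ p(2) that]) (use p(3) green_column_step[OF w(2)] in auto)
  have "weighted_ell2 g p {m..}" by (rule weighted_ell2_transfer[OF w(1)]) (use eq in auto)
  then have "weighted_ell2 g p {0..}"
    by (rule weighted_ell2_transfer) (auto intro: finite_subset[of _ "{0..m}"])
  then show ?thesis using nof[OF p(1)] eq[OF \<open>n \<ge> m\<close>] by (simp add: fun_eq_iff)
qed

text \<open>
  Otherwise two neighbouring columns vanish to the right of their sources. To the left their Wronskian
  is constant and nonzero, whereas the weights \<open>exp (- 2 g n) \<ge> 1\<close> for \<open>n \<le> 0\<close> make the columns square
  summable there, so their Wronskian would have to tend to zero.
\<close>
lemma exists_forward_solution: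
  assumes g: "g \<ge> 0"
    and ex: "\<And>m. \<exists>w. weighted_ell2 g w UNIV \<and> green_column V m 1 w"
    and bd: "\<And>m c w F. weighted_ell2 g w UNIV \<Longrightarrow> green_column V m c w \<Longrightarrow> finite F \<Longrightarrow>
       (\<Sum>n\<in>F. exp (- 2 * g * real_of_int n) * (cmod (w n))\<^sup>2) \<le> C\<^sup>2 * (cmod c)\<^sup>2 * exp (- 2 * g * real_of_int m)"
  shows "\<exists>p. schroedinger_solution V p \<and> p \<noteq> (\<lambda>_. 0) \<and> weighted_ell2 g p {0..}"
proof (rule ccontr)
  assume "\<not> ?thesis"
  then have nof: "\<And>p. schroedinger_solution V p \<Longrightarrow> weighted_ell2 g p {0..} \<Longrightarrow> p = (\<lambda>_. 0)" by blast
  obtain a where a: "weighted_ell2 g a UNIV" "green_column V 0 1 a" using ex by blast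
  obtain b where b: "weighted_ell2 g b UNIV" "green_column V 1 1 b" using ex by blast
  have a0: "a n = 0" if "n \<ge> 0" for n by (rule green_column_zero_forward[OF a nof that])
  have b0: "b n = 0" if "n \<ge> 1" for n by (rule green_column_zero_forward[OF b nof that])
  have a1: "a (-1) = -1" using a(2)[unfolded green_column_def, rule_format, of 0] a0[of 0] a0[of 1] by (simp add: minus_equation_iff eq_neg_iff_add_eq_0)
  have b1: "b 0 = -1" using b(2)[unfolded green_column_def, rule_format, of 1] b0[of 1] b0[of 2] by (simp add: minus_equation_iff eq_neg_iff_add_eq_0)
  have W: "wronskian a b n = -1" if "n \<le> 0" for n
    using that
  proof (induction n rule: int_le_induct)
    case base show ?case unfolding wronskian_def using a0[of 0] a1 b1 by simp
  next
    case (step i)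
    have "wronskian a b i = wronskian a b (i - 1)"
    proof -
      have e: "a i = V (i - 1) * a (i - 1) - a (i - 1 - 1)" "b i = V (i - 1) * b (i - 1) - b (i - 1 - 1)"
        using green_column_step[OF a(2), of "i - 1"] green_column_step[OF b(2), of "i - 1"] step by auto
      show ?thesis unfolding wronskian_def e by (simp add: algebra_simps)
    qed
    then show ?case using step by simp
  qed
  define f where "f w n = exp (- 2 * g * real_of_int n) * (cmod (w n))\<^sup>2" for w :: "int \<Rightarrow> complex" and n
  have f0: "f w n \<ge> (cmod (w n))\<^sup>2" if "n \<le> 0" for w n
  proof -
    have "1 \<le> exp (- 2 * g * real_of_int n)" using g that by (simp add: mult_nonneg_nonpos)
    then show ?thesis unfolding f_def by (simp add: mult_le_cancel_right1)
  qed
  \<comment> \<open>the four squares dominate the absolute value of the Wronskian, which is 1\<close>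
  have one: "1 \<le> f a n + f a (n - 1) + f b n + f b (n - 1)" if "n \<le> 0" for n
  proof -
    have "1 = cmod (wronskian a b n)" using W[OF that] by simp
    also have "\<dots> \<le> cmod (a n) * cmod (b (n - 1)) + cmod (a (n - 1)) * cmod (b n)"
      unfolding wronskian_def by (metis norm_mult norm_triangle_ineq4)
    also have "\<dots> \<le> (cmod (a n))\<^sup>2 + (cmod (b (n - 1)))\<^sup>2 + (cmod (a (n - 1)))\<^sup>2 + (cmod (b n))\<^sup>2"
    proof -
      have "x * y \<le> x\<^sup>2 + y\<^sup>2" if "x \<ge> 0" "y \<ge> 0" for x y :: real
        using sum_squares_bound[of x y] mult_nonneg_nonneg[OF that] by linarith
      from add_mono[OF this this] show ?thesis by (simp add: add.assoc)
    qed
    also have "\<dots> \<le> f a n + f b (n - 1) + f a (n - 1) + f b n" by (intro add_mono f0) (use that in auto)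
    finally show ?thesis by simp
  qed
  have shift: "(\<Sum>n\<in>{-M..0}. h (n - 1)) = (\<Sum>n\<in>{-M-1..-1}. h n)" for h :: "int \<Rightarrow> real" and M :: int
    by (rule sum.reindex_bij_witness[of _ "\<lambda>j. j + 1" "\<lambda>j. j - 1"]) auto
  define D where "D = C\<^sup>2 + C\<^sup>2 * exp (- 2 * g)"
  have "real M \<le> 2 * D" for M
  proof -
    have fa: "(\<Sum>n\<in>F. f a n) \<le> C\<^sup>2" and fb: "(\<Sum>n\<in>F. f b n) \<le> C\<^sup>2 * exp (- 2 * g)" if "finite F" for F
      unfolding f_def using bd[OF a that] bd[OF b that] by auto
    have "real M \<le> (\<Sum>n\<in>{- int M..0}. 1)" by simp
    also have "\<dots> \<le> (\<Sum>n\<in>{- int M..0}. f a n + f a (n - 1) + f b n + f b (n - 1))"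
      by (rule sum_mono) (use one in auto)
    also have "\<dots> = (\<Sum>n\<in>{- int M..0}. f a n) + (\<Sum>n\<in>{- int M-1..-1}. f a n) + (\<Sum>n\<in>{- int M..0}. f b n) + (\<Sum>n\<in>{- int M-1..-1}. f b n)"
      by (simp add: sum.distrib shift)
    also have "\<dots> \<le> C\<^sup>2 + C\<^sup>2 + C\<^sup>2 * exp (- 2 * g) + C\<^sup>2 * exp (- 2 * g)"
      by (intro add_mono fa fb) auto
    finally show ?thesis unfolding D_def by simp
  qed
  then show False using reals_Archimedean2[of "2 * D"] not_le by blast
qed

text \<open>
  Without solutions that are summable at \<open>-\<infinity>\<close> the columns vanish to the left of their sources. Every
  solution is then, to the right of any site \<open>k\<close>, a combination of the two columns with sources at \<open>k\<close> and
  \<open>k - 1\<close>, and inherits their summability with uniform constants.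
\<close>
lemma all_solutions_contract:
  assumes g: "g \<ge> 0"
    and ex: "\<And>m. \<exists>w. weighted_ell2 g w UNIV \<and> green_column V m 1 w"
    and bd: "\<And>m c w F. weighted_ell2 g w UNIV \<Longrightarrow> green_column V m c w \<Longrightarrow> finite F \<Longrightarrow>
       (\<Sum>n\<in>F. exp (- 2 * g * real_of_int n) * (cmod (w n))\<^sup>2) \<le> C\<^sup>2 * (cmod c)\<^sup>2 * exp (- 2 * g * real_of_int m)"
    and nob: "\<And>q. schroedinger_solution V q \<Longrightarrow> weighted_ell2 g q {..0} \<Longrightarrow> q = (\<lambda>_. 0)"
  shows "\<exists>N>0. \<forall>u k. schroedinger_solution V u \<longrightarrow> phase_norm u (k + int N) \<le> exp (g * real N) / 2 * phase_norm u k"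
proof -
  obtain G where G: "\<And>m. weighted_ell2 g (G m) UNIV" "\<And>m. green_column V m 1 (G m)" using ex by metis
  have G0: "G m n = 0" if "n \<le> m" for n m by (rule green_column_zero_backward[OF G nob that])
  have G1: "G m (m + 1) = -1" for m
    using G(2)[unfolded green_column_def, rule_format, of m m] G0[of m m] G0[of "m-1" m] by (simp add: minus_equation_iff eq_neg_iff_add_eq_0)
  \<comment> \<open>both sides agree at k and k + 1, because a column vanishes at its source and is - 1 right after it\<close>
  have rep: "u n = - u k * G (k - 1) n + u (k - 1) * G k n" if u: "schroedinger_solution V u" and "n \<ge> k" for u n k
  proof (rule solution_agrees_forward[OF u _ _ _ \<open>n \<ge> k\<close>])
    show "- u k * G (k - 1) (j + 1) + u (k - 1) * G k (j + 1) = V j * (- u k * G (k - 1) j + u (k - 1) * G k j) - (- u k * G (k - 1) (j - 1) + u (k - 1) * G k (j - 1))" if "j > k" for j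
    proof -
      have e: "G (k - 1) (j + 1) = V j * G (k - 1) j - G (k - 1) (j - 1)" "G k (j + 1) = V j * G k j - G k (j - 1)"
        using green_column_step[OF G(2), of j "k-1"] green_column_step[OF G(2), of j k] that by auto
      show ?thesis unfolding e by (simp add: algebra_simps)
    qed
    show "u k = - u k * G (k - 1) k + u (k - 1) * G k k" using G1[of "k-1"] G0[of k k] by simp
    show "u (k + 1) = - u k * G (k - 1) (k + 1) + u (k - 1) * G k (k + 1)"
      using green_column_step[OF G(2), of k "k-1"] G1[of k] G1[of "k-1"] G0[of "k-1" "k-1"] solution_step[OF u, of k] by simp
  qed
  define D where "D = 1 + 4 * (C\<^sup>2 * exp (2 * g) + C\<^sup>2)"
  have D0: "D \<ge> 0" unfolding D_def by simp
  define a where "a u j = exp (- 2 * g * real_of_int j) * (phase_norm u j)\<^sup>2" for u j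
  have sum: "(\<Sum>j\<in>{k..n}. a u j) \<le> D * a u k" if u: "schroedinger_solution V u" and "k \<le> n" for u k n
  proof -
    define f where "f w j = exp (- 2 * g * real_of_int j) * (cmod (w j))\<^sup>2" for w :: "int \<Rightarrow> complex" and j
    have 1: "f u j \<le> 2 * (phase_norm u k)\<^sup>2 * (f (G (k - 1)) j + f (G k) j)" if "j \<in> {k..n}" for j
    proof -
      have "cmod (u j) \<le> cmod (u k) * cmod (G (k - 1) j) + cmod (u (k - 1)) * cmod (G k j)"
        using rep[OF u, of k j] that by (metis atLeastAtMost_iff norm_minus_cancel norm_mult norm_triangle_ineq)
      also have "\<dots> \<le> phase_norm u k * cmod (G (k - 1) j) + phase_norm u k * cmod (G k j)"
        by (intro add_mono mult_right_mono norm_le_phase_norm) auto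
      finally have "cmod (u j) \<le> phase_norm u k * (cmod (G (k - 1) j) + cmod (G k j))" by (simp add: distrib_left)
      then have "(cmod (u j))\<^sup>2 \<le> (phase_norm u k)\<^sup>2 * (cmod (G (k - 1) j) + cmod (G k j))\<^sup>2"
        using power_mono[OF _ norm_ge_zero, of "u j" _ 2] by (metis power_mult_distrib)
      also have "\<dots> \<le> (phase_norm u k)\<^sup>2 * (2 * (cmod (G (k - 1) j))\<^sup>2 + 2 * (cmod (G k j))\<^sup>2)"
      proof (rule mult_left_mono)
        have "(x + y)\<^sup>2 \<le> 2 * x\<^sup>2 + 2 * y\<^sup>2" for x y :: real
          using sum_squares_bound[of x y] by (simp add: power2_sum)
        then show "(cmod (G (k - 1) j) + cmod (G k j))\<^sup>2 \<le> 2 * (cmod (G (k - 1) j))\<^sup>2 + 2 * (cmod (G k j))\<^sup>2" .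
      qed simp
      finally have "exp (- 2 * g * real_of_int j) * (cmod (u j))\<^sup>2 \<le> exp (- 2 * g * real_of_int j) * ((phase_norm u k)\<^sup>2 * (2 * (cmod (G (k - 1) j))\<^sup>2 + 2 * (cmod (G k j))\<^sup>2))"
        by (rule mult_left_mono) simp
      then show ?thesis unfolding f_def by (simp add: algebra_simps)
    qed
    have "(\<Sum>j\<in>{k..n}. f u j) \<le> 2 * (phase_norm u k)\<^sup>2 * ((\<Sum>j\<in>{k..n}. f (G (k - 1)) j) + (\<Sum>j\<in>{k..n}. f (G k) j))"
    proof -
      have "(\<Sum>j\<in>{k..n}. f u j) \<le> (\<Sum>j\<in>{k..n}. 2 * (phase_norm u k)\<^sup>2 * (f (G (k - 1)) j + f (G k) j))"
        by (rule sum_mono[OF 1])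
      then show ?thesis by (simp add: sum_distrib_left[symmetric] sum.distrib)
    qed
    also have "\<dots> \<le> 2 * (phase_norm u k)\<^sup>2 * (C\<^sup>2 * exp (- 2 * g * real_of_int (k - 1)) + C\<^sup>2 * exp (- 2 * g * real_of_int k))"
      using bd[OF G, of "{k..n}" "k-1"] bd[OF G, of "{k..n}" k] unfolding f_def
      by (intro mult_left_mono add_mono) auto
    also have "exp (- 2 * g * real_of_int (k - 1)) = exp (2 * g) * exp (- 2 * g * real_of_int k)"
      by (simp add: exp_add[symmetric] algebra_simps)
    finally have 2: "(\<Sum>j\<in>{k..n}. f u j) \<le> 2 * (C\<^sup>2 * exp (2 * g) + C\<^sup>2) * a u k"
      unfolding a_def by (simp add: algebra_simps)
    show ?thesis using sum_phase_norm_forward[OF g \<open>k \<le> n\<close>, of u] 2 unfolding a_def f_def D_def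
      by (simp add: algebra_simps)
  qed
  obtain N0 where N0: "4 * D\<^sup>2 \<le> real N0" using real_arch_simple by blast
  define N where "N = Suc N0"
  have N: "4 * D\<^sup>2 \<le> real N" using N0 unfolding N_def by simp
  show ?thesis
  proof (intro exI[of _ N] conjI allI impI)
    show "0 < N" unfolding N_def by simp
    fix u k assume u: "schroedinger_solution V u"
    have "a u (k + int N) \<le> a u k / 4"
      by (rule summable_tail_imp_decay[OF _ D0 sum[OF u] N]) (auto simp: a_def)
    then have "exp (- 2 * g * real_of_int (k + int N)) * (phase_norm u (k + int N))\<^sup>2 \<le> exp (- 2 * g * real_of_int k) * (phase_norm u k)\<^sup>2 / 4"
      unfolding a_def by simp
    then have "exp (2 * g * real_of_int (k + int N)) * (exp (- 2 * g * real_of_int (k + int N)) * (phase_norm u (k + int N))\<^sup>2) \<le> exp (2 * g * real_of_int (k + int N)) * (exp (- 2 * g * real_of_int k) * (phase_norm u k)\<^sup>2 / 4)"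
      by (rule mult_left_mono) simp
    moreover have "exp (2 * g * real_of_int (k + int N)) * exp (- 2 * g * real_of_int (k + int N)) = 1"
      "exp (2 * g * real_of_int (k + int N)) * exp (- 2 * g * real_of_int k) = (exp (g * real N))\<^sup>2"
      by (simp_all add: exp_add[symmetric] exp_double[symmetric] algebra_simps)
    ultimately have "(phase_norm u (k + int N))\<^sup>2 \<le> (exp (g * real N))\<^sup>2 * ((phase_norm u k)\<^sup>2 / 4)"
      by (simp only: mult.assoc[symmetric] times_divide_eq_right[symmetric])
    also have "\<dots> = (exp (g * real N) / 2 * phase_norm u k)\<^sup>2" by (simp add: power_mult_distrib power_divide)
    finally show "phase_norm u (k + int N) \<le> exp (g * real N) / 2 * phase_norm u k"
      by (rule power2_le_imp_le) simp
  qed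
qed

section \<open>Exponential dichotomy along one orbit\<close>

lemma dependent_solutions:
  assumes p: "schroedinger_solution V p" and q: "schroedinger_solution V q" "q \<noteq> (\<lambda>_. 0)"
    and W: "wronskian p q 0 = 0"
  obtains c where "p = (\<lambda>n. c * q n)"
proof -
  have ex: "\<exists>c. p 0 = c * q 0 \<and> p (-1) = c * q (-1)"
  proof (cases "q 0 = 0")
    case False
    then show ?thesis using W unfolding wronskian_def by (intro exI[of _ "p 0 / q 0"]) (simp add: field_simps)
  next
    case True
    have "q (-1) \<noteq> 0"
    proof
      assume "q (-1) = 0"
      then have "phase_norm q 0 = 0" using True by (simp add: phase_norm_def)
      then show False using phase_norm_pos[OF q, of 0] by simp
    qed
    then show ?thesis using W True unfolding wronskian_def by (intro exI[of _ "p (-1) / q (-1)"]) (simp add: field_simps)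
  qed
  then obtain c where c: "p 0 = c * q 0" "p (-1) = c * q (-1)" by blast
  have "schroedinger_solution V (\<lambda>n. c * q n)" using solution_lincomb[OF q(1) q(1), of c 0] by simp
  then have "p = (\<lambda>n. c * q n)" using c by (intro solution_unique[OF p, of _ 0]) auto
  then show thesis by (rule that)
qed

lemma wronskian_decomposition:
  assumes p: "schroedinger_solution V p" and q: "schroedinger_solution V q" and u: "schroedinger_solution V u"
    and W: "wronskian p q m \<noteq> 0"
  shows "u = (\<lambda>n. wronskian u q m / wronskian p q m * p n + wronskian p u m / wronskian p q m * q n)"
proof (rule solution_unique[OF u, where k=m])
  show "schroedinger_solution V (\<lambda>n. wronskian u q m / wronskian p q m * p n + wronskian p u m / wronskian p q m * q n)"
    by (rule solution_lincomb[OF p q])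
  have "u m * wronskian p q m = wronskian u q m * p m + wronskian p u m * q m"
    unfolding wronskian_def by (simp add: algebra_simps)
  then show "u m = wronskian u q m / wronskian p q m * p m + wronskian p u m / wronskian p q m * q m"
    using W by (simp add: field_simps)
  have "u (m - 1) * wronskian p q m = wronskian u q m * p (m - 1) + wronskian p u m * q (m - 1)"
    unfolding wronskian_def by (simp add: algebra_simps)
  then show "u (m - 1) = wronskian u q m / wronskian p q m * p (m - 1) + wronskian p u m / wronskian p q m * q (m - 1)"
    using W by (simp add: field_simps)
qed

text \<open>
  At the source the two branches fit together up to a jump, which is the Wronskian.
\<close>
lemma green_column_splice:
  assumes p: "schroedinger_solution V p" and q: "schroedinger_solution V q"
  shows "green_column V m (- wronskian p q m) (\<lambda>n. p (max n m) * q (min n m))"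
  unfolding green_column_def
proof
  fix n
  consider "n < m" | "n = m" | "n > m" by linarith
  then show "- (p (max (n + 1) m) * q (min (n + 1) m)) - p (max (n - 1) m) * q (min (n - 1) m) + V n * (p (max n m) * q (min n m))
     = (if n = m then - wronskian p q m else 0)"
  proof cases
    case 1
    then have mm: "max (n + 1) m = m" "min (n + 1) m = n + 1" "max (n - 1) m = m" "min (n - 1) m = n - 1" "max n m = m" "min n m = n"
      by auto
    show ?thesis unfolding mm solution_step[OF q, of n] using 1 by (simp add: algebra_simps)
  next
    case 2
    have mm: "max (m + 1) m = m + 1" "min (m + 1) m = m" "max (m - 1) m = m" "min (m - 1) m = m - 1" "max m m = m" "min m m = m"
      by auto
    show ?thesis unfolding 2 mm solution_step[OF p, of m] wronskian_def by (simp add: algebra_simps)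
  next
    case 3
    then have mm: "max (n + 1) m = n + 1" "min (n + 1) m = m" "max (n - 1) m = n - 1" "min (n - 1) m = m" "max n m = n" "min n m = m"
      by auto
    show ?thesis unfolding mm solution_step[OF p, of n] using 3 by (simp add: algebra_simps)
  qed
qed

text \<open>
  What is left of a hyperbolic splitting once the decaying solution has been eliminated: the Green
  function decays at least as fast as the solution \<open>q\<close> grows, and no solution grows faster than \<open>q\<close>, all up to the
  constant \<open>K\<close>. In contrast to the norms of the cocycle, the ratios \<open>phase_norm q n / phase_norm q m\<close> are exactly
  multiplicative.
\<close>
definition dominated_green ::
  "(int \<Rightarrow> complex) \<Rightarrow> (int \<Rightarrow> complex) \<Rightarrow> (int \<Rightarrow> int \<Rightarrow> complex) \<Rightarrow> real \<Rightarrow> bool" where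
  "dominated_green V q G K \<longleftrightarrow>
     schroedinger_solution V q \<and> q \<noteq> (\<lambda>_. 0)
   \<and> (\<forall>m. green_column V m 1 (\<lambda>n. G n m)) \<and> (\<forall>n m. G n m = G m n)
   \<and> (\<forall>n m. cmod (G n m) \<le> K * phase_norm q (min n m) / phase_norm q (max n m))
   \<and> (\<forall>m n. m \<le> n \<longrightarrow> phase_norm q m \<le> K * phase_norm q n)
   \<and> (\<forall>u m n. schroedinger_solution V u \<longrightarrow> m \<le> n \<longrightarrow>
        phase_norm u n \<le> K * (phase_norm q n / phase_norm q m) * phase_norm u m)"

text \<open>
  The solutions \<open>p\<close> and \<open>q\<close> are independent, as a common multiple would be a column without source. The
  columns spliced from them are bounded, which has two consequences. First, \<open>phase_norm p k * phase_norm q k\<close> is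
  comparable to the Wronskian \<open>W\<close> at every site, which says that the directions of \<open>p\<close> and \<open>q\<close> stay
  apart. Secondly, the summability of a column to the left of its source bounds the weighted sum of the squares of
  \<open>q\<close> up to \<open>n\<close> by its last term, which forces exponential growth.
\<close>
lemma hyperbolic_splitting:
  assumes g: "g \<ge> 0" and C: "C \<ge> 0"
    and bd: "\<And>m c w F. weighted_ell2 g w UNIV \<Longrightarrow> green_column V m c w \<Longrightarrow> finite F \<Longrightarrow>
       (\<Sum>n\<in>F. exp (- 2 * g * real_of_int n) * (cmod (w n))\<^sup>2) \<le> C\<^sup>2 * (cmod c)\<^sup>2 * exp (- 2 * g * real_of_int m)"
    and p: "schroedinger_solution V p" "p \<noteq> (\<lambda>_. 0)" "weighted_ell2 g p {0..}"
    and q: "schroedinger_solution V q" "q \<noteq> (\<lambda>_. 0)" "weighted_ell2 g q {..0}"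
  shows "\<exists>G K N. N > 0 \<and> dominated_green V q G K
    \<and> (\<forall>n. 2 * exp (g * real N) * phase_norm q n \<le> phase_norm q (n + int N))"
proof -
  define W where "W = wronskian p q 0"
  have Wc: "wronskian p q n = W" for n unfolding W_def by (rule wronskian_const[OF p(1) q(1)])
  have W0: "W \<noteq> 0"
  proof
    assume "W = 0"
    obtain c where c: "p = (\<lambda>n. c * q n)" by (rule dependent_solutions[OF p(1) q(1,2) \<open>W = 0\<close>[unfolded W_def]])
    have "weighted_ell2 g p {..0}" unfolding c by (rule weighted_ell2_cmult[OF q(3)])
    moreover have "{0..} \<union> {..0} = (UNIV :: int set)" by auto
    ultimately have pU: "weighted_ell2 g p UNIV" using weighted_ell2_Un[OF p(3)] by metis
    have "green_column V 0 0 p" unfolding green_column_def using solution_step[OF p(1)] by (simp add: algebra_simps)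
    then have "(\<Sum>n\<in>{k}. exp (- 2 * g * real_of_int n) * (cmod (p n))\<^sup>2) \<le> 0" for k
      using bd[OF pU, of 0 0 "{k}"] by simp
    then have "p k = 0" for k by (simp add: mult_le_0_iff not_le[symmetric])
    then show False using p(2) by auto
  qed
  define P where "P n = phase_norm p n" for n
  define Q where "Q n = phase_norm q n" for n
  have Pp: "P n > 0" and Qp: "Q n > 0" for n unfolding P_def Q_def using phase_norm_pos p q by auto
  have WPQ: "cmod W \<le> P n * Q n" for n using wronskian_le[of p q n] unfolding Wc P_def Q_def .
  define w where "w m n = p (max n m) * q (min n m)" for m n
  have wg: "green_column V m (- W) (w m)" for m using green_column_splice[OF p(1) q(1), of m] unfolding Wc w_def[abs_def] .
  have ww: "weighted_ell2 g (w m) UNIV" for m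
  proof -
    have "weighted_ell2 g (\<lambda>n. q m * p n) {0..}" by (rule weighted_ell2_cmult[OF p(3)])
    then have 1: "weighted_ell2 g (w m) {m..}"
      by (rule weighted_ell2_transfer) (auto simp: w_def max_def min_def intro: finite_subset[of _ "{m..0}"])
    have "weighted_ell2 g (\<lambda>n. p m * q n) {..0}" by (rule weighted_ell2_cmult[OF q(3)])
    then have 2: "weighted_ell2 g (w m) {..m}"
      by (rule weighted_ell2_transfer) (auto simp: w_def max_def min_def intro: finite_subset[of _ "{0..m}"] split: if_splits)
    have "{m..} \<union> {..m} = (UNIV :: int set)" by auto
    with weighted_ell2_Un[OF 1 2] show ?thesis by simp
  qed
  have bw: "(\<Sum>n\<in>F. exp (- 2 * g * real_of_int n) * (cmod (w m n))\<^sup>2) \<le> C\<^sup>2 * (cmod W)\<^sup>2 * exp (- 2 * g * real_of_int m)" if "finite F" for F m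
    using bd[OF ww wg that, of m] by simp
  have ent: "cmod (p j) * cmod (q k) \<le> C * cmod W * exp (g * real_of_int (j - k))" if "k \<le> j" for j k
  proof -
    have "exp (- 2 * g * real_of_int j) * (cmod (w k j))\<^sup>2 \<le> C\<^sup>2 * (cmod W)\<^sup>2 * exp (- 2 * g * real_of_int k)"
      using bw[of "{j}" k] by simp
    then have "exp (2 * g * real_of_int j) * (exp (- 2 * g * real_of_int j) * (cmod (w k j))\<^sup>2) \<le> exp (2 * g * real_of_int j) * (C\<^sup>2 * (cmod W)\<^sup>2 * exp (- 2 * g * real_of_int k))"
      by (rule mult_left_mono) simp
    moreover have "exp (2 * g * real_of_int j) * exp (- 2 * g * real_of_int j) = 1" by (simp add: exp_add[symmetric])
    moreover have "exp (2 * g * real_of_int j) * (C\<^sup>2 * (cmod W)\<^sup>2 * exp (- 2 * g * real_of_int k)) = (C * cmod W * exp (g * real_of_int (j - k)))\<^sup>2"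
    proof -
      have "exp (2 * g * real_of_int j) * exp (- 2 * g * real_of_int k) = (exp (g * real_of_int (j - k)))\<^sup>2"
        by (simp add: exp_add[symmetric] exp_double[symmetric] algebra_simps)
      then show ?thesis by (simp add: power_mult_distrib mult_ac)
    qed
    ultimately have "(cmod (w k j))\<^sup>2 \<le> (C * cmod W * exp (g * real_of_int (j - k)))\<^sup>2" by (simp only: mult.assoc[symmetric] mult_1_left)
    then have "cmod (w k j) \<le> C * cmod W * exp (g * real_of_int (j - k))" by (rule power2_le_imp_le) (use C in simp)
    then show ?thesis unfolding w_def using that by (simp add: max_def min_def norm_mult split: if_splits)
  qed
  \<comment> \<open>bounds, in units of the Wronskian, all four products of the components of p and q at a site\<close>
  define D where "D = C * exp g + C + 1"
  have D1: "D \<ge> 1" unfolding D_def using C by simp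
  have PQ: "P k * Q k \<le> 2 * D * cmod W" for k
  proof -
    have DW: "C * cmod W \<le> D * cmod W" "C * cmod W * exp g + cmod W \<le> D * cmod W"
      unfolding D_def using C by (auto simp: algebra_simps)
    have a: "cmod (p k) * cmod (q k) \<le> D * cmod W" using ent[of k k] DW by simp
    have b: "cmod (p (k - 1)) * cmod (q (k - 1)) \<le> D * cmod W" using ent[of "k-1" "k-1"] DW by simp
    \<comment> \<open>the remaining product differs from this one by the Wronskian\<close>
    have c0: "cmod (p k) * cmod (q (k - 1)) \<le> C * cmod W * exp g" using ent[of "k-1" "k"] by simp
    then have c: "cmod (p k) * cmod (q (k - 1)) \<le> D * cmod W" using DW norm_ge_zero[of W] by linarith
    have "p (k - 1) * q k = p k * q (k - 1) - W" using Wc[of k, symmetric] unfolding wronskian_def by simp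
    then have "cmod (p (k - 1)) * cmod (q k) \<le> cmod (p k) * cmod (q (k - 1)) + cmod W"
      by (metis norm_mult norm_triangle_ineq4)
    then have d: "cmod (p (k - 1)) * cmod (q k) \<le> D * cmod W" using c0 DW by linarith
    have sq: "x\<^sup>2 * y\<^sup>2 \<le> (D * cmod W)\<^sup>2" if "x * y \<le> D * cmod W" "0 \<le> x" "0 \<le> y" for x y :: real
      using power_mono[OF that(1), of 2] that by (simp add: power_mult_distrib)
    have "(P k * Q k)\<^sup>2 = (cmod (p k))\<^sup>2 * (cmod (q k))\<^sup>2 + (cmod (p k))\<^sup>2 * (cmod (q (k - 1)))\<^sup>2
       + (cmod (p (k - 1)))\<^sup>2 * (cmod (q k))\<^sup>2 + (cmod (p (k - 1)))\<^sup>2 * (cmod (q (k - 1)))\<^sup>2"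
      unfolding P_def Q_def power_mult_distrib phase_norm_sq by (simp add: algebra_simps)
    also have "\<dots> \<le> (D * cmod W)\<^sup>2 + (D * cmod W)\<^sup>2 + (D * cmod W)\<^sup>2 + (D * cmod W)\<^sup>2"
      by (intro add_mono sq a b c d norm_ge_zero)
    also have "\<dots> = (2 * D * cmod W)\<^sup>2" by (simp add: power_mult_distrib)
    finally show ?thesis by (rule power2_le_imp_le) (use D1 in simp)
  qed
  define a where "a j = exp (- 2 * g * real_of_int j) * (Q j)\<^sup>2" for j
  \<comment> \<open>the two columns with sources at n and n - 1 together recover the norm of p at n\<close>
  define A where "A = 1 + 2 * C\<^sup>2 * (1 + exp (2 * g))"
  have A1: "A \<ge> 1" unfolding A_def by simp
  have sum: "(\<Sum>j\<in>{m..n}. a j) \<le> A * a n" if "m \<le> n" for m n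
  proof -
    define f where "f j = exp (- 2 * g * real_of_int j) * (cmod (q j))\<^sup>2" for j
    have 1: "(\<Sum>j\<in>{m-1..n-1}. f j) * (cmod (p k))\<^sup>2 \<le> C\<^sup>2 * (cmod W)\<^sup>2 * exp (- 2 * g * real_of_int k)" if "k \<ge> n - 1" for k
    proof -
      have "(\<Sum>j\<in>{m-1..n-1}. f j) * (cmod (p k))\<^sup>2 = (\<Sum>j\<in>{m-1..n-1}. exp (- 2 * g * real_of_int j) * (cmod (w k j))\<^sup>2)"
        unfolding sum_distrib_right
        by (rule sum.cong) (use that in \<open>auto simp: f_def w_def max_def min_def norm_mult power_mult_distrib\<close>)
      then show ?thesis using bw[of "{m-1..n-1}" k] by simp
    qed
    have "(\<Sum>j\<in>{m-1..n-1}. f j) * (P n)\<^sup>2 \<le> C\<^sup>2 * (cmod W)\<^sup>2 * exp (- 2 * g * real_of_int n) + C\<^sup>2 * (cmod W)\<^sup>2 * exp (- 2 * g * real_of_int (n - 1))"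
      unfolding P_def phase_norm_sq distrib_left using 1[of n] 1[of "n-1"] by simp
    also have "exp (- 2 * g * real_of_int (n - 1)) = exp (2 * g) * exp (- 2 * g * real_of_int n)"
      by (simp add: exp_add[symmetric] algebra_simps)
    finally have "(\<Sum>j\<in>{m-1..n-1}. f j) * (P n)\<^sup>2 \<le> C\<^sup>2 * (1 + exp (2 * g)) * exp (- 2 * g * real_of_int n) * (cmod W)\<^sup>2"
      by (simp add: algebra_simps)
    also have "\<dots> \<le> C\<^sup>2 * (1 + exp (2 * g)) * exp (- 2 * g * real_of_int n) * (P n * Q n)\<^sup>2"
      by (intro mult_left_mono power_mono WPQ) (auto intro: add_nonneg_nonneg)
    also have "\<dots> = (C\<^sup>2 * (1 + exp (2 * g)) * a n) * (P n)\<^sup>2" unfolding a_def by (simp add: power_mult_distrib)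
    finally have "(\<Sum>j\<in>{m-1..n-1}. f j) \<le> C\<^sup>2 * (1 + exp (2 * g)) * a n" using Pp[of n] by simp
    then show ?thesis using sum_phase_norm_backward[OF g that, of q] unfolding a_def f_def A_def Q_def
      by (simp add: algebra_simps)
  qed
  obtain N0 where N0: "4 * A\<^sup>2 \<le> real N0" using real_arch_simple by blast
  define N where "N = Suc N0"
  have N: "4 * A\<^sup>2 \<le> real N" using N0 unfolding N_def by simp
  have cancel: "4 * (E * x) \<le> y" if "X * (4 * (Y * x)) \<le> X * (Z * y)" "X * Z = 1" "X * Y = E" for X Y Z E x y :: real
  proof -
    have "4 * ((X * Y) * x) \<le> (X * Z) * y" using that(1) by (simp only: mult_ac)
    then show ?thesis unfolding that(2,3) by simp
  qed
  have grow: "exp (g * real N) * 2 * Q n \<le> Q (n + int N)" for n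
  proof -
    have "a n \<le> a (n + int N) / 4"
      by (rule summable_tail_imp_growth[OF _ _ sum N]) (use A1 in \<open>auto simp: a_def\<close>)
    then have "exp (2 * g * real_of_int (n + int N)) * (4 * (exp (- 2 * g * real_of_int n) * (Q n)\<^sup>2)) \<le> exp (2 * g * real_of_int (n + int N)) * (exp (- 2 * g * real_of_int (n + int N)) * (Q (n + int N))\<^sup>2)"
      unfolding a_def by (intro mult_left_mono) auto
    moreover have "exp (2 * g * real_of_int (n + int N)) * exp (- 2 * g * real_of_int (n + int N)) = 1"
      "exp (2 * g * real_of_int (n + int N)) * exp (- 2 * g * real_of_int n) = (exp (g * real N))\<^sup>2"
      by (simp_all add: exp_add[symmetric] exp_double[symmetric] algebra_simps)
    ultimately have "4 * ((exp (g * real N))\<^sup>2 * (Q n)\<^sup>2) \<le> (Q (n + int N))\<^sup>2"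
      using cancel by blast
    then have "(exp (g * real N) * 2 * Q n)\<^sup>2 \<le> (Q (n + int N))\<^sup>2" by (simp add: power_mult_distrib)
    then show ?thesis by (rule power2_le_imp_le) (use Qp[of "n + int N"] in simp)
  qed
  have mono: "Q m \<le> A * Q n" if "m \<le> n" for m n
  proof -
    have "a m \<le> (\<Sum>j\<in>{m..n}. a j)" by (rule member_le_sum) (use that in \<open>auto simp: a_def\<close>)
    also have "\<dots> \<le> A * a n" by (rule sum[OF that])
    finally have "exp (- 2 * g * real_of_int m) * (Q m)\<^sup>2 \<le> A * exp (- 2 * g * real_of_int n) * (Q n)\<^sup>2" unfolding a_def by simp
    also have "\<dots> \<le> A * exp (- 2 * g * real_of_int m) * (Q n)\<^sup>2"
      by (intro mult_left_mono mult_right_mono) (use A1 g that in \<open>auto simp: mult_left_mono\<close>)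
    finally have "(Q m)\<^sup>2 \<le> A * (Q n)\<^sup>2" by (simp add: mult.left_commute[of A])
    also have "\<dots> \<le> A * A * (Q n)\<^sup>2" by (intro mult_right_mono) (use A1 in auto)
    finally have "(Q m)\<^sup>2 \<le> (A * Q n)\<^sup>2" by (simp add: power_mult_distrib power2_eq_square[of A])
    then show ?thesis by (rule power2_le_imp_le) (use Qp[of n] A1 in simp)
  qed
  define K where "K = 2 * D * (A * A + 1)"
  have AA1: "A * A \<ge> A" "A * A \<ge> 1" using A1 by (simp, metis mult_mono' mult_1 zero_le_one)
  have KD: "K \<ge> 2 * D" unfolding K_def using D1 AA1 by simp
  have KA: "K \<ge> A" 
  proof -
    have "A \<le> 1 * (A * A + 1)" using AA1 by simp
    also have "\<dots> \<le> 2 * D * (A * A + 1)" by (rule mult_right_mono) (use D1 AA1 in auto)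
    finally show ?thesis unfolding K_def .
  qed
  define G where "G n m = - (1 / W) * w m n" for n m
  have h1: "green_column V m 1 (\<lambda>n. G n m)" for m
  proof -
    have "- G (n + 1) m - G (n - 1) m + V n * G n m = - (1 / W) * (- w m (n + 1) - w m (n - 1) + V n * w m n)" for n
      unfolding G_def by (simp add: algebra_simps)
    then show ?thesis using wg[of m] W0 unfolding green_column_def by simp
  qed
  have h2: "G n m = G m n" for n m unfolding G_def w_def by (simp add: max.commute min.commute)
  have h3: "cmod (G n m) \<le> K * Q (min n m) / Q (max n m)" for n m
  proof -
    have "cmod (w m n) \<le> P (max n m) * Q (min n m)"
      unfolding w_def norm_mult P_def Q_def by (intro mult_mono norm_le_phase_norm) auto
    also have "P (max n m) \<le> 2 * D * cmod W / Q (max n m)" using PQ[of "max n m"] Qp[of "max n m"] by (simp add: field_simps)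
    finally have "cmod (w m n) \<le> 2 * D * cmod W / Q (max n m) * Q (min n m)"
      using Qp[of "min n m"] by (simp add: mult_right_mono)
    then have "cmod (G n m) \<le> 2 * D * (Q (min n m) / Q (max n m))"
      unfolding G_def using W0 by (simp add: norm_mult norm_divide field_simps)
    also have "\<dots> \<le> K * (Q (min n m) / Q (max n m))"
      by (rule mult_right_mono[OF KD]) (use Qp[of "min n m"] Qp[of "max n m"] in simp)
    finally show ?thesis by simp
  qed
  have h5: "Q m \<le> K * Q n" if "m \<le> n" for m n
    using mono[OF that] mult_right_mono[OF KA, of "Q n"] Qp[of n] by linarith
  have h6: "phase_norm u n \<le> K * (Q n / Q m) * phase_norm u m" if u: "schroedinger_solution V u" and "m \<le> n" for u m n
  proof -
    \<comment> \<open>coefficients of u in the basis p, q, by Cramer's rule\<close>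
    let ?al = "wronskian u q m / W" and ?be = "wronskian p u m / W"
    have "u = (\<lambda>n. ?al * p n + ?be * q n)"
      using wronskian_decomposition[OF p(1) q(1) u, of m] W0 unfolding Wc by simp
    then have "phase_norm u n \<le> cmod ?al * P n + cmod ?be * Q n"
      unfolding P_def Q_def using phase_norm_triangle[of ?al p ?be q n] by simp
    also have "\<dots> \<le> (phase_norm u m * Q m / cmod W) * P n + (P m * phase_norm u m / cmod W) * Q n"
      unfolding norm_divide using wronskian_le[of u q m] wronskian_le[of p u m] unfolding P_def Q_def
      by (intro add_mono mult_right_mono divide_right_mono) auto
    also have "\<dots> = phase_norm u m * ((Q m * P n + P m * Q n) / cmod W)" by (simp add: field_simps add_divide_distrib)
    also have "\<dots> \<le> phase_norm u m * (K * (Q n / Q m))"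
    proof (rule mult_left_mono)
      have "P n \<le> 2 * D * cmod W / Q n" "P m \<le> 2 * D * cmod W / Q m"
        using PQ[of n] PQ[of m] Qp[of n] Qp[of m] by (auto simp: field_simps)
      then have "Q m * P n + P m * Q n \<le> Q m * (2 * D * cmod W / Q n) + 2 * D * cmod W / Q m * Q n"
        using Qp[of n] Qp[of m] by (intro add_mono mult_left_mono mult_right_mono) auto
      also have "\<dots> = cmod W * (2 * D * (Q m / Q n + Q n / Q m))" by (simp add: field_simps)
      finally have "(Q m * P n + P m * Q n) / cmod W \<le> 2 * D * (Q m / Q n + Q n / Q m)"
        using W0 by (simp add: pos_divide_le_eq mult.commute)
      also have "\<dots> \<le> 2 * D * (A * A * (Q n / Q m) + Q n / Q m)"
      proof -
        have "Q m / Q n \<le> A" using mono[OF \<open>m \<le> n\<close>] Qp[of n] by (simp add: pos_divide_le_eq)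
        also have "A \<le> A * A * (Q n / Q m)"
          using mono[OF \<open>m \<le> n\<close>] Qp[of m] A1 mult_left_mono[OF mono[OF \<open>m \<le> n\<close>], of A] by (simp add: field_simps)
        finally show ?thesis using D1 by (intro mult_left_mono add_right_mono) auto
      qed
      also have "\<dots> = K * (Q n / Q m)" unfolding K_def by (simp add: algebra_simps)
      finally show "(Q m * P n + P m * Q n) / cmod W \<le> K * (Q n / Q m)" .
    qed simp
    finally show ?thesis by (simp add: mult.commute)
  qed
  have h0: "N > 0" unfolding N_def by simp
  show ?thesis
  proof (intro exI conjI)
    show "dominated_green V q G K" unfolding dominated_green_def
      using q(1,2) h1 h2 h3[unfolded Q_def] h5[unfolded Q_def] h6[unfolded Q_def] by blast
    show "\<forall>n. 2 * exp (g * real N) * phase_norm q n \<le> phase_norm q (n + int N)"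
      using grow unfolding Q_def by (simp add: mult_ac)
  qed (rule h0)
qed

text \<open>
  The first alternative is contraction of all solutions relative to \<open>exp (g n)\<close>. The second is a splitting
  in which \<open>q\<close> expands relative to \<open>exp (g n)\<close>.
\<close>
lemma exponential_dichotomy:
  assumes g: "g \<ge> 0" and inv: "ell2_invertible (hn_op V g)"
  shows "(\<exists>N>0. \<forall>u k. schroedinger_solution V u \<longrightarrow> phase_norm u (k + int N) \<le> exp (g * real N) / 2 * phase_norm u k)
  \<or> (\<exists>q G K N. N > 0 \<and> dominated_green V q G K
    \<and> (\<forall>n. 2 * exp (g * real N) * phase_norm q n \<le> phase_norm q (n + int N)))"
proof -
  obtain C where C: "C \<ge> 0" "\<And>m. \<exists>w. weighted_ell2 g w UNIV \<and> green_column V m 1 w"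
    "\<And>m c w F. weighted_ell2 g w UNIV \<Longrightarrow> green_column V m c w \<Longrightarrow> finite F \<Longrightarrow>
       (\<Sum>n\<in>F. exp (- 2 * g * real_of_int n) * (cmod (w n))\<^sup>2) \<le> C\<^sup>2 * (cmod c)\<^sup>2 * exp (- 2 * g * real_of_int m)"
    by (rule invertible_imp_green_columns[OF inv]; rule that; assumption)
  obtain p where p: "schroedinger_solution V p" "p \<noteq> (\<lambda>_. 0)" "weighted_ell2 g p {0..}"
    using exists_forward_solution[OF g C(2,3)] by blast
  show ?thesis
  proof (cases "\<exists>q. schroedinger_solution V q \<and> q \<noteq> (\<lambda>_. 0) \<and> weighted_ell2 g q {..0}")
    case True
    then obtain q where q: "schroedinger_solution V q" "q \<noteq> (\<lambda>_. 0)" "weighted_ell2 g q {..0}" by blast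
    show ?thesis using hyperbolic_splitting[OF g C(1,3) p q] by (intro disjI2) blast
  next
    case False
    then show ?thesis using all_solutions_contract[OF g C(2,3)] by (intro disjI1) blast
  qed
qed

section \<open>The cocycle of a strictly ergodic system\<close>

lemma operator_norm_entry_bound:
  fixes M :: "complex^2^2"
  shows "norm (M *v w) \<le> (\<Sum>i\<in>UNIV. \<Sum>j\<in>UNIV. cmod (M $ i $ j)) * norm w"
proof -
  have "norm (M *v w) \<le> (\<Sum>i\<in>UNIV. norm ((M *v w) $ i))"
    unfolding norm_vec_def by (rule L2_set_le_sum) simp
  also have "\<dots> \<le> (\<Sum>i\<in>UNIV. \<Sum>j\<in>UNIV. cmod (M $ i $ j) * norm w)"
  proof (rule sum_mono)
    fix i
    have "norm ((M *v w) $ i) \<le> (\<Sum>j\<in>UNIV. cmod (M $ i $ j * w $ j))"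
      unfolding matrix_vector_mult_def by (simp add: norm_sum)
    also have "\<dots> \<le> (\<Sum>j\<in>UNIV. cmod (M $ i $ j) * norm w)"
      unfolding norm_mult by (rule sum_mono, rule mult_left_mono[OF Finite_Cartesian_Product.norm_nth_le]) simp
    finally show "norm ((M *v w) $ i) \<le> (\<Sum>j\<in>UNIV. cmod (M $ i $ j) * norm w)" .
  qed
  finally show ?thesis by (simp add: sum_distrib_right)
qed

lemma continuous_on_operator_norm:
  fixes M :: "'a::topological_space \<Rightarrow> complex^2^2"
  assumes "\<And>i j. continuous_on S (\<lambda>x. M x $ i $ j)"
  shows "continuous_on S (\<lambda>x. onorm (\<lambda>w. M x *v w))"
  unfolding continuous_on_def
proof
  fix x assume x: "x \<in> S"
  define D where "D y = (\<Sum>i\<in>UNIV. \<Sum>j\<in>UNIV. cmod (M y $ i $ j - M x $ i $ j))" for y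
  have le: "onorm (\<lambda>w. A *v w) \<le> onorm (\<lambda>w. B *v w) + (\<Sum>i\<in>UNIV. \<Sum>j\<in>UNIV. cmod (A $ i $ j - B $ i $ j))" for A B :: "complex^2^2"
  proof (rule onorm_le)
    fix w :: "complex^2"
    have "A *v w = B *v w + (A - B) *v w" by (simp add: matrix_vector_mult_diff_rdistrib)
    then have "norm (A *v w) \<le> norm (B *v w) + norm ((A - B) *v w)" by (metis norm_triangle_ineq)
    also have "\<dots> \<le> onorm (\<lambda>w. B *v w) * norm w + (\<Sum>i\<in>UNIV. \<Sum>j\<in>UNIV. cmod ((A - B) $ i $ j)) * norm w"
      by (intro add_mono onorm operator_norm_entry_bound) auto
    finally show "norm (A *v w) \<le> (onorm (\<lambda>w. B *v w) + (\<Sum>i\<in>UNIV. \<Sum>j\<in>UNIV. cmod (A $ i $ j - B $ i $ j))) * norm w"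
      by (simp add: distrib_right)
  qed
  have "continuous_on S D"
    unfolding D_def by (intro continuous_on_sum continuous_on_norm continuous_on_diff assms continuous_on_const)
  then have "(D \<longlongrightarrow> D x) (at x within S)" using x by (simp add: continuous_on_def)
  moreover have "D x = 0" unfolding D_def by simp
  ultimately have D: "(D \<longlongrightarrow> 0) (at x within S)" by simp
  have "((\<lambda>y. onorm (\<lambda>w. M y *v w) - onorm (\<lambda>w. M x *v w)) \<longlongrightarrow> 0) (at x within S)"
  proof (rule Lim_null_comparison[OF _ D], intro always_eventually allI)
    fix y
    have "onorm (\<lambda>w. M x *v w) \<le> onorm (\<lambda>w. M y *v w) + D y"
      using le[of "M x" "M y"] unfolding D_def by (simp add: norm_minus_commute)
    moreover have "onorm (\<lambda>w. M y *v w) \<le> onorm (\<lambda>w. M x *v w) + D y"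
      using le[of "M y" "M x"] unfolding D_def by simp
    ultimately show "norm (onorm (\<lambda>w. M y *v w) - onorm (\<lambda>w. M x *v w)) \<le> D y" by simp
  qed
  then show "((\<lambda>y. onorm (\<lambda>w. M y *v w)) \<longlongrightarrow> onorm (\<lambda>w. M x *v w)) (at x within S)"
    by (rule LIM_zero_cancel)
qed

locale ergodic_schroedinger =
  fixes T :: "'a::metric_space \<Rightarrow> 'a" and \<mu> :: "'a measure" and v :: "'a \<Rightarrow> complex" and E :: complex
  assumes cpt: "compact (UNIV :: 'a set)"
    and homeo: "homeomorphism UNIV UNIV T (inv T)"
    and strict: "strictly_ergodic T"
    and inv_mu: "invariant_prob T \<mu>"
    and v_cont: "continuous_on UNIV v"
begin

definition orbit_pot :: "'a \<Rightarrow> int \<Rightarrow> complex" where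
  "orbit_pot x n = v (int_iterate T n x) - E"

definition cocycle_norm :: "nat \<Rightarrow> 'a \<Rightarrow> real" where
  "cocycle_norm n x = onorm (\<lambda>w. schroedinger_cocycle T v E n x *v w)"

lemma T_cont: "continuous_on UNIV T" and Tinv_cont: "continuous_on UNIV (inv T)"
  and T_inv [simp]: "T (inv T x) = x" and inv_T [simp]: "inv T (T x) = x"
  using homeo unfolding homeomorphism_def by auto

lemma int_iterate_0 [simp]: "int_iterate T 0 x = x"
  unfolding int_iterate_def by simp

lemma int_iterate_Suc: "int_iterate T (n + 1) x = T (int_iterate T n x)"
proof (cases "n \<ge> 0")
  case True
  then show ?thesis unfolding int_iterate_def by (simp add: nat_add_distrib)
next
  case False
  then obtain k where k: "n = - int (Suc k)" by (metis int_cases not_le of_nat_0_le_iff)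
  show ?thesis unfolding k int_iterate_def by (cases k) (auto simp: nat_add_distrib nat_diff_distrib)
qed

lemma int_iterate_pred: "int_iterate T (n - 1) x = inv T (int_iterate T n x)"
  using int_iterate_Suc[of "n - 1" x] by simp

lemma int_iterate_add: "int_iterate T n (int_iterate T m x) = int_iterate T (n + m) x"
proof (induction n rule: int_bi_induct[where k=0])
  case (up n)
  then show ?case using int_iterate_Suc[of n "int_iterate T m x"] int_iterate_Suc[of "n + m" x] by (simp add: algebra_simps)
next
  case (down n)
  then show ?case using int_iterate_pred[of n "int_iterate T m x"] int_iterate_pred[of "n + m" x] by (simp add: algebra_simps)
qed simp

lemma funpow_int_iterate: "(T ^^ k) (int_iterate T m x) = int_iterate T (m + int k) x"
  using int_iterate_add[of "int k" m x] unfolding int_iterate_def[of T "int k"] by (simp add: add.commute)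

lemma int_iterate_cont: "continuous_on UNIV (int_iterate T n)"
proof (induction n rule: int_bi_induct[where k=0])
  case base
  then show ?case by (simp add: continuous_on_id)
next
  case (up n)
  show ?case unfolding int_iterate_Suc[abs_def] by (rule continuous_on_compose2[OF T_cont up(2)]) auto
next
  case (down n)
  show ?case unfolding int_iterate_pred[abs_def] by (rule continuous_on_compose2[OF Tinv_cont down(2)]) auto
qed

lemma orbit_pot_shift: "orbit_pot (int_iterate T m x) n = orbit_pot x (n + m)"
  unfolding orbit_pot_def int_iterate_add ..

lemma orbit_pot_cont: "continuous_on UNIV (\<lambda>x. orbit_pot x n)"
  unfolding orbit_pot_def by (intro continuous_intros continuous_on_compose2[OF v_cont int_iterate_cont]) auto

lemma orbit_pot_bounded: obtains B where "B \<ge> 0" "\<And>x n. cmod (orbit_pot x n) \<le> B"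
proof -
  have "bounded (range v)" using compact_imp_bounded[OF compact_continuous_image[OF v_cont cpt]] .
  then obtain b where b: "\<And>x. cmod (v x) \<le> b" unfolding bounded_iff by auto
  have "cmod (orbit_pot x n) \<le> b + cmod E" for x n
    unfolding orbit_pot_def using norm_triangle_ineq4[of "v (int_iterate T n x)" E] b[of "int_iterate T n x"] by linarith
  moreover have "b + cmod E \<ge> 0" using b[of undefined] by (meson add_nonneg_nonneg norm_ge_zero order_trans)
  ultimately show thesis using that by blast
qed

lemma orbit_dense:
  obtains k where "(\<lambda>j::nat. int_iterate T (k j) x) \<longlonglongrightarrow> y"
proof -
  have "y \<in> closure (range (\<lambda>n. int_iterate T n x))" using strict unfolding strictly_ergodic_def minimal_map_def by blast
  then obtain u where u: "\<And>n. u n \<in> range (\<lambda>n. int_iterate T n x)" "u \<longlonglongrightarrow> y"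
    unfolding closure_sequential by blast
  have "\<forall>n. \<exists>k. u n = int_iterate T k x" using u(1) by blast
  then obtain k where "\<And>n. u n = int_iterate T (k n) x" by metis
  then have "u = (\<lambda>n. int_iterate T (k n) x)" by (rule ext)
  then show thesis using u(2) that[of k] by simp
qed

lemma cocycle_solution:
  assumes "schroedinger_solution (orbit_pot x) w"
  shows "schroedinger_cocycle T v E n (int_iterate T m x) *v vector [w m, w (m - 1)]
     = vector [w (m + int n), w (m + int n - 1)]"
proof (induction n)
  case 0
  show ?case by (simp add: matrix_vector_mul_lid)
next
  case (Suc n)
  have "schroedinger_matrix v E ((T ^^ n) (int_iterate T m x)) *v (vector [w (m + int n), w (m + int n - 1)] :: complex^2)
    = vector [w (m + int (Suc n)), w (m + int (Suc n) - 1)]"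
    using solution_step[OF assms, of "m + int n"]
    unfolding funpow_int_iterate schroedinger_matrix_def orbit_pot_def
    by (simp add: vec_eq_iff forall_2 matrix_vector_mult_def sum_2 algebra_simps)
  then show ?case using Suc by (simp add: matrix_vector_mul_assoc[symmetric])
qed

lemma norm_vector_phase: "norm (vector [w n, w (n - 1)] :: complex^2) = phase_norm w n"
  unfolding norm_vec_def L2_set_def phase_norm_def by (simp add: sum_2)

lemma cocycle_bl [simp]: "bounded_linear (\<lambda>w. schroedinger_cocycle T v E n x *v w)"
  by (rule matrix_vector_mul_bounded_linear)

lemma phase_norm_le_cocycle:
  assumes "schroedinger_solution (orbit_pot x) w"
  shows "phase_norm w (m + int n) \<le> cocycle_norm n (int_iterate T m x) * phase_norm w m"
  using onorm[OF cocycle_bl, of n "int_iterate T m x" "vector [w m, w (m - 1)]"]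
  unfolding cocycle_solution[OF assms] norm_vector_phase cocycle_norm_def .

text \<open>
  Every vector is the initial datum at \<open>m\<close> of some solution, so operator norms of the cocycle can be
  estimated through solutions alone.
\<close>
lemma cocycle_norm_leI:
  assumes "\<And>w. schroedinger_solution (orbit_pot x) w \<Longrightarrow> phase_norm w (m + int n) \<le> c * phase_norm w m"
  shows "cocycle_norm n (int_iterate T m x) \<le> c"
  unfolding cocycle_norm_def
proof (rule onorm_le)
  fix z :: "complex^2"
  obtain w where w: "schroedinger_solution (orbit_pot x) w" "w m = z $ 1" "w (m - 1) = z $ 2" by (rule solution_exists)
  have z: "z = vector [w m, w (m - 1)]" by (simp add: vec_eq_iff forall_2 w)
  show "norm (schroedinger_cocycle T v E n (int_iterate T m x) *v z) \<le> c * norm z"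
    unfolding z cocycle_solution[OF w(1)] norm_vector_phase by (rule assms[OF w(1)])
qed

lemma cocycle_norm_mult: "cocycle_norm (m + n) x \<le> cocycle_norm n ((T ^^ m) x) * cocycle_norm m x"
proof -
  have "cocycle_norm (m + n) (int_iterate T 0 x) \<le> cocycle_norm n (int_iterate T (int m) x) * cocycle_norm m (int_iterate T 0 x)"
  proof (rule cocycle_norm_leI)
    fix w assume w: "schroedinger_solution (orbit_pot x) w"
    have "phase_norm w (0 + int (m + n)) \<le> cocycle_norm n (int_iterate T (int m) x) * phase_norm w (int m)"
      using phase_norm_le_cocycle[OF w, of "int m" n] by simp
    also have "\<dots> \<le> cocycle_norm n (int_iterate T (int m) x) * (cocycle_norm m x * phase_norm w 0)"
      using phase_norm_le_cocycle[OF w, of 0 m] unfolding cocycle_norm_def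
      by (intro mult_left_mono onorm_pos_le) auto
    finally show "phase_norm w (0 + int (m + n)) \<le> cocycle_norm n (int_iterate T (int m) x) * cocycle_norm m (int_iterate T 0 x) * phase_norm w 0"
      by (simp add: mult.assoc)
  qed
  then show ?thesis by (simp add: int_iterate_def)
qed

text \<open>
  The Wronskian of the two basis solutions is the determinant of the cocycle, which is one.
\<close>
lemma cocycle_norm_ge_1: "cocycle_norm n x \<ge> 1"
proof -
  obtain a where a: "schroedinger_solution (orbit_pot x) a" "a 0 = 1" "a (0 - 1) = 0" by (rule solution_exists)
  obtain b where b: "schroedinger_solution (orbit_pot x) b" "b 0 = 0" "b (0 - 1) = 1" by (rule solution_exists)
  have "phase_norm a 0 = 1" "phase_norm b 0 = 1" unfolding phase_norm_def using a b by auto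
  then have le: "phase_norm a (int n) \<le> cocycle_norm n x" "phase_norm b (int n) \<le> cocycle_norm n x"
    using phase_norm_le_cocycle[OF a(1), of 0 n] phase_norm_le_cocycle[OF b(1), of 0 n] by auto
  have "wronskian a b (int n) = 1"
    using wronskian_const[OF a(1) b(1), of "int n" 0] a b by (simp add: wronskian_def)
  then have "1 \<le> phase_norm a (int n) * phase_norm b (int n)" using wronskian_le[of a b "int n"] by simp
  also have "\<dots> \<le> cocycle_norm n x * cocycle_norm n x" by (intro mult_mono le order_trans[OF phase_norm_nonneg le(1)]) auto
  finally have "1\<^sup>2 \<le> (cocycle_norm n x)\<^sup>2" by (simp add: power2_eq_square)
  then show ?thesis by (rule power2_le_imp_le) (rule order_trans[OF phase_norm_nonneg le(1)])
qed

lemma cocycle_norm_0 [simp]: "cocycle_norm 0 x = 1"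
proof (rule antisym)
  have "cocycle_norm 0 (int_iterate T 0 x) \<le> 1" by (rule cocycle_norm_leI) simp
  then show "cocycle_norm 0 x \<le> 1" by simp
qed (rule cocycle_norm_ge_1)

lemma cocycle_norm_cont: "continuous_on UNIV (cocycle_norm n)"
proof -
  have "continuous_on UNIV (\<lambda>x. schroedinger_cocycle T v E n x $ i $ j)" for i j
  proof (induction n arbitrary: i j)
    case 0
    then show ?case by (simp add: continuous_on_const)
  next
    case (Suc n)
    have Tn: "continuous_on UNIV (T ^^ n)" using int_iterate_cont[of "int n"] by (simp add: int_iterate_def cong: continuous_on_cong)
    have S: "continuous_on UNIV (\<lambda>x. schroedinger_matrix v E ((T ^^ n) x) $ i $ j)" for i j
    proof -
      have "\<forall>i j. continuous_on UNIV (\<lambda>x. schroedinger_matrix v E ((T ^^ n) x) $ i $ j)"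
        unfolding schroedinger_matrix_def forall_2
        by (auto intro!: continuous_intros continuous_on_compose2[OF v_cont Tn])
      then show ?thesis by blast
    qed
    show ?case unfolding schroedinger_cocycle.simps matrix_matrix_mult_def
      by (simp add: sum_2) (intro continuous_intros S Suc)
  qed
  then show ?thesis unfolding cocycle_norm_def[abs_def] by (rule continuous_on_operator_norm)
qed

text \<open>
  The one-step transfer matrices and their inverses are bounded uniformly over the space.
\<close>
lemma phase_norm_step:
  obtains B where "B \<ge> 1" "\<And>x w n. schroedinger_solution (orbit_pot x) w \<Longrightarrow> phase_norm w (n + 1) \<le> B * phase_norm w n"
    "\<And>x w n. schroedinger_solution (orbit_pot x) w \<Longrightarrow> phase_norm w n \<le> B * phase_norm w (n + 1)"
proof -
  obtain b where b: "b \<ge> 0" "\<And>x n. cmod (orbit_pot x n) \<le> b" using orbit_pot_bounded by blast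
  have l1: "phase_norm w n \<le> cmod (w n) + cmod (w (n - 1))" for w n
    unfolding phase_norm_def by (rule sqrt_sum_squares_le_sum) auto
  show thesis
  proof (rule that[of "b + 2"])
    fix x w n assume w: "schroedinger_solution (orbit_pot x) w"
    have V: "cmod (orbit_pot x n * w n) \<le> b * cmod (w n)" unfolding norm_mult by (rule mult_right_mono[OF b(2)]) simp
    have "cmod (w (n + 1)) \<le> b * cmod (w n) + cmod (w (n - 1))"
      unfolding solution_step[OF w, of n] using V norm_triangle_ineq4[of "orbit_pot x n * w n" "w (n - 1)"] by linarith
    moreover have "b * cmod (w n) \<le> b * phase_norm w n" by (rule mult_left_mono[OF norm_le_phase_norm(1) b(1)])
    ultimately show "phase_norm w (n + 1) \<le> (b + 2) * phase_norm w n"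
      using l1[of w "n + 1"] norm_le_phase_norm[of w n] by (simp add: distrib_right)
    have "cmod (w (n - 1)) \<le> b * cmod (w n) + cmod (w (n + 1))"
      unfolding solution_step_back[OF w, of n] using V norm_triangle_ineq4[of "orbit_pot x n * w n" "w (n + 1)"] by linarith
    moreover have "b * cmod (w n) \<le> b * phase_norm w (n + 1)"
      using mult_left_mono[OF norm_le_phase_norm(2)[of w "n + 1"] b(1)] by simp
    ultimately show "phase_norm w n \<le> (b + 2) * phase_norm w (n + 1)"
      using l1[of w n] norm_le_phase_norm[of w "n + 1"] by (simp add: distrib_right)
  qed (use b in auto)
qed

end

section \<open>The Lyapunov exponent\<close>

text \<open>
  Fekete's lemma, with the limit identified as a lower bound of the quotients.
\<close>
lemma fekete_nonneg:
  fixes a :: "nat \<Rightarrow> real"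
  assumes sub: "\<And>m n. a (m + n) \<le> a m + a n" and nn: "\<And>n. a n \<ge> 0"
  shows "\<exists>L. (\<lambda>n. a n / real n) \<longlonglongrightarrow> L \<and> (\<forall>n\<ge>1. L \<le> a n / real n)"
proof -
  let ?S = "(\<lambda>n. a n / real n) ` {1..}"
  define L where "L = Inf ?S"
  have bdd: "bdd_below ?S" by (rule bdd_belowI2[of _ 0]) (use nn in auto)
  have le: "L \<le> a n / real n" if "n \<ge> 1" for n unfolding L_def using that by (intro cInf_lower bdd) auto
  have mult: "a (q * N) \<le> real q * a N" if "q \<ge> 1" for q N
    using that
  proof (induction q rule: dec_induct)
    case (step q)
    then show ?case using sub[of N "q * N"] by (simp add: algebra_simps)
  qed simp
  have "(\<lambda>n. a n / real n) \<longlonglongrightarrow> L"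
  proof (rule LIMSEQ_I)
    fix e :: real assume e: "e > 0"
    have "Inf ?S < L + e / 2" unfolding L_def using e by simp
    then obtain N where N: "N \<ge> 1" "a N / real N < L + e / 2"
      using cInf_less_iff[OF _ bdd] by auto
    define M where "M = a N + (\<Sum>r<N. a r)"
    have M: "a r \<le> M - a N" if "r < N" for r unfolding M_def using that nn by (auto intro: member_le_sum)
    have M0: "M \<ge> 0" unfolding M_def using nn by (intro add_nonneg_nonneg sum_nonneg) auto
    have up: "a n \<le> real n * (L + e / 2) + M" for n
    proof -
      have "a n \<le> real (n div N) * a N + M"
      proof (cases "n div N \<ge> 1")
        case True
        have "a n \<le> a (n div N * N) + a (n mod N)" using sub[of "n div N * N" "n mod N"] by simp
        then show ?thesis using mult[OF True, of N] M[of "n mod N"] N(1) nn[of N] by simp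
      next
        case False
        then have "n < N" using N(1) by (simp add: div_eq_0_iff not_le less_Suc_eq_le)
        then show ?thesis using M[of n] nn[of N] False by simp
      qed
      moreover have "real (n div N) * a N \<le> real n * (L + e / 2)"
      proof -
        have "a N \<le> real N * (L + e / 2)" using N by (simp add: pos_divide_less_eq mult.commute less_imp_le)
        then have "real (n div N) * a N \<le> real (n div N) * (real N * (L + e / 2))" by (rule mult_left_mono) simp
        also have "\<dots> = real (n div N * N) * (L + e / 2)" by simp
        also have "\<dots> \<le> real n * (L + e / 2)"
        proof (rule mult_right_mono)
          show "real (n div N * N) \<le> real n" by (simp only: of_nat_le_iff div_times_less_eq_dividend)
          have "0 \<le> a N / real N" using nn[of N] by simp
          then show "0 \<le> L + e / 2" using N(2) by linarith
        qed
        finally show ?thesis .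
      qed
      ultimately show ?thesis by linarith
    qed
    obtain n0 where n0: "2 * M / e < real n0" using reals_Archimedean2 by blast
    show "\<exists>no. \<forall>n\<ge>no. norm (a n / real n - L) < e"
    proof (intro exI[of _ "Suc n0"] allI impI)
      fix n assume n: "n \<ge> Suc n0"
      have "2 * M / e < real n" using n0 n by linarith
      then have "M / real n < e / 2" using e n by (simp add: field_simps)
      moreover have "a n / real n \<le> (L + e / 2) + M / real n" using up[of n] n by (simp add: field_simps)
      ultimately have "a n / real n < L + e" by linarith
      then show "norm (a n / real n - L) < e" using le[of n] n by (simp add: abs_less_iff)
    qed
  qed
  then show ?thesis using le by blast
qed

text \<open>
  Averaging over a window of length \<open>N\<close> replaces the choice of a residue class modulo \<open>N\<close>: the window
  sum changes by \<open>h (n + N) - h n\<close> from \<open>n\<close> to \<open>n + 1\<close>. A bound for blocks of length \<open>N\<close> thus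
  becomes a bound by an ordinary Birkhoff sum, to which unique ergodicity applies although \<open>T\<^sup>N\<close> need
  not be uniquely ergodic.
\<close>
lemma telescoping_average_bound:
  fixes h F :: "nat \<Rightarrow> real"
  assumes step: "\<And>n. \<bar>h (Suc n) - h n\<bar> \<le> c" and block: "\<And>n. h (n + N) - h n \<le> F n"
  shows "real N * (h n - h 0) \<le> (\<Sum>k<n. F k) + 2 * c * (real N)\<^sup>2"
proof -
  have lip: "\<bar>h (n + j) - h n\<bar> \<le> real j * c" for n j
  proof (induction j)
    case (Suc j)
    then show ?case using step[of "n + j"] by (simp add: distrib_right)
  qed simp
  have c0: "c \<ge> 0" using step[of 0] by linarith
  have lipN: "\<bar>h (n + j) - h n\<bar> \<le> real N * c" if "j < N" for n j
    using lip[of n j] mult_right_mono[of "real j" "real N" c] that c0 by simp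
  define S where "S n = (\<Sum>j<N. h (n + j))" for n
  have "S (Suc n) - S n = h (n + N) - h n" for n
  proof -
    have "S n + h (n + N) = (\<Sum>j<Suc N. h (n + j))" unfolding S_def by simp
    also have "\<dots> = h n + S (Suc n)" unfolding S_def by (subst sum.lessThan_Suc_shift) simp
    finally show ?thesis by simp
  qed
  then have inc: "S (Suc n) - S n \<le> F n" for n using block by simp
  have tel: "S n - S 0 \<le> (\<Sum>k<n. F k)" for n
  proof (induction n)
    case (Suc n) then show ?case using inc[of n] by simp
  qed simp
  have "\<bar>S n - real N * h n\<bar> \<le> c * (real N)\<^sup>2" for n
  proof -
    have "\<bar>S n - real N * h n\<bar> = \<bar>\<Sum>j<N. h (n + j) - h n\<bar>" unfolding S_def by (simp add: sum_subtractf)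
    also have "\<dots> \<le> (\<Sum>j<N. \<bar>h (n + j) - h n\<bar>)" by (rule sum_abs)
    also have "\<dots> \<le> (\<Sum>j<N. real N * c)" by (rule sum_mono) (use lipN in auto)
    finally show ?thesis by (simp add: power2_eq_square mult_ac)
  qed
  from this[of n] this[of 0] tel[of n] show ?thesis by (simp add: right_diff_distrib)
qed

context ergodic_schroedinger
begin

abbreviation "lyap \<equiv> lyapunov_exponent \<mu> T v E"

lemma cocycle_norm_pos [simp]: "cocycle_norm n x > 0" and cocycle_norm_ne_0 [simp]: "cocycle_norm n x \<noteq> 0"
  using cocycle_norm_ge_1[of n x] by auto

lemma log_cocycle_cont: "continuous_on UNIV (\<lambda>x. ln (cocycle_norm n x))"
  using cocycle_norm_ge_1 by (intro continuous_on_ln cocycle_norm_cont) (metis not_one_le_zero)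

lemma prob_mu: "prob_space \<mu>" and sets_mu: "sets \<mu> = sets borel" and distr_mu: "distr \<mu> borel T = \<mu>"
  using inv_mu unfolding invariant_prob_def by auto

definition log_growth :: "nat \<Rightarrow> real" where
  "log_growth n = integral\<^sup>L \<mu> (\<lambda>x. ln (cocycle_norm n x))"

lemma integral_shift:
  fixes f :: "'a \<Rightarrow> real"
  assumes f: "continuous_on UNIV f"
  shows "integrable \<mu> f" "integral\<^sup>L \<mu> (\<lambda>x. f ((T ^^ k) x)) = integral\<^sup>L \<mu> f"
proof -
  interpret prob_space \<mu> by (rule prob_mu)
  show "integrable \<mu> f"
  proof -
    have "bounded (range f)" using compact_imp_bounded[OF compact_continuous_image[OF f cpt]] .
    then obtain B where "\<And>x. norm (f x) \<le> B" unfolding bounded_iff by auto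
    then show ?thesis using borel_measurable_continuous_onI[OF f] sets_mu
      by (intro integrable_const_bound[of _ B]) (auto cong: measurable_cong_sets)
  qed
  have Tm: "T \<in> measurable \<mu> borel"
    using borel_measurable_continuous_onI[OF T_cont] sets_mu by (simp cong: measurable_cong_sets)
  have Tk: "continuous_on UNIV (T ^^ k)" for k
    using int_iterate_cont[of "int k"] by (simp add: int_iterate_def cong: continuous_on_cong)
  show "integral\<^sup>L \<mu> (\<lambda>x. f ((T ^^ k) x)) = integral\<^sup>L \<mu> f"
  proof (induction k)
    case (Suc k)
    have m: "(\<lambda>x. f ((T ^^ k) x)) \<in> borel_measurable borel"
      by (intro borel_measurable_continuous_onI continuous_on_compose2[OF f Tk]) auto
    have "integral\<^sup>L \<mu> (\<lambda>x. f ((T ^^ k) (T x))) = integral\<^sup>L (distr \<mu> borel T) (\<lambda>x. f ((T ^^ k) x))"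
      by (rule integral_distr[symmetric, OF Tm m])
    then show ?case using Suc by (simp add: distr_mu funpow_swap1)
  qed simp
qed

lemma log_cocycle_integrable: "integrable \<mu> (\<lambda>x. ln (cocycle_norm n x))"
  by (rule integral_shift(1)[OF log_cocycle_cont])

lemma log_growth_nonneg: "log_growth n \<ge> 0"
  unfolding log_growth_def by (rule Bochner_Integration.integral_nonneg) (use cocycle_norm_ge_1 in auto)

lemma log_growth_subadditive: "log_growth (m + n) \<le> log_growth m + log_growth n"
proof -
  have Tm: "continuous_on UNIV (T ^^ m)"
    using int_iterate_cont[of "int m"] by (simp add: int_iterate_def cong: continuous_on_cong)
  have c: "continuous_on UNIV (\<lambda>x. ln (cocycle_norm n ((T ^^ m) x)))"
    by (rule continuous_on_compose2[OF log_cocycle_cont Tm]) auto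
  have "log_growth (m + n) \<le> integral\<^sup>L \<mu> (\<lambda>x. ln (cocycle_norm n ((T ^^ m) x)) + ln (cocycle_norm m x))"
    unfolding log_growth_def
  proof (rule integral_mono)
    show "ln (cocycle_norm (m + n) x) \<le> ln (cocycle_norm n ((T ^^ m) x)) + ln (cocycle_norm m x)" for x
    proof -
      have "ln (cocycle_norm (m + n) x) \<le> ln (cocycle_norm n ((T ^^ m) x) * cocycle_norm m x)"
        using cocycle_norm_mult[of m n x] by (subst ln_le_cancel_iff) auto
      then show ?thesis by (simp add: ln_mult)
    qed
  qed (intro Bochner_Integration.integrable_add log_cocycle_integrable integral_shift(1)[OF c])+
  also have "\<dots> = log_growth n + log_growth m"
    using integral_shift(2)[OF log_cocycle_cont, of n m]
    by (simp add: Bochner_Integration.integral_add log_cocycle_integrable integral_shift(1)[OF c] log_growth_def)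
  finally show ?thesis by simp
qed

lemma lyapunov_limit: "(\<lambda>n. log_growth n / real n) \<longlonglongrightarrow> lyap"
  and lyapunov_le: "n \<ge> 1 \<Longrightarrow> lyap \<le> log_growth n / real n"
proof -
  obtain L where L: "(\<lambda>n. log_growth n / real n) \<longlonglongrightarrow> L" "\<forall>n\<ge>1. L \<le> log_growth n / real n"
    using fekete_nonneg[of log_growth, OF log_growth_subadditive log_growth_nonneg] by blast
  have "(LINT x|\<mu>. 1 / real n * ln (onorm (\<lambda>w. schroedinger_cocycle T v E n x *v w))) = log_growth n / real n" for n
    unfolding log_growth_def cocycle_norm_def by simp
  then have "lyap = L" unfolding lyapunov_exponent_def by (simp only: limI[OF L(1)])
  then show "(\<lambda>n. log_growth n / real n) \<longlonglongrightarrow> lyap" "n \<ge> 1 \<Longrightarrow> lyap \<le> log_growth n / real n"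
    using L by auto
qed

lemma lyapunov_nonneg: "lyap \<ge> 0"
  by (rule LIMSEQ_le_const[OF lyapunov_limit]) (use log_growth_nonneg in auto)

lemma lyapunov_le_uniform:
  assumes "N \<ge> 1" "\<And>x. cocycle_norm N x \<le> c"
  shows "lyap \<le> ln c / real N"
proof -
  interpret prob_space \<mu> by (rule prob_mu)
  have "log_growth N \<le> integral\<^sup>L \<mu> (\<lambda>x. ln c)" unfolding log_growth_def
  proof (rule integral_mono[OF log_cocycle_integrable])
    show "ln (cocycle_norm N x) \<le> ln c" for x
      using assms(2)[of x] cocycle_norm_ge_1[of N x] by (subst ln_le_cancel_iff) auto
  qed simp
  also have "\<dots> = ln c" by (simp add: prob_space)
  finally show ?thesis using lyapunov_le[OF assms(1)] by (meson divide_right_mono of_nat_0_le_iff order_trans)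
qed

lemma lyapunov_ge_uniform:
  assumes c: "c > 0" and "\<And>n x. c * exp (l * real n) \<le> cocycle_norm n x"
  shows "l \<le> lyap"
proof -
  interpret prob_space \<mu> by (rule prob_mu)
  have a: "ln c + l * real n \<le> log_growth n" for n
  proof -
    have "integral\<^sup>L \<mu> (\<lambda>x. ln c + l * real n) \<le> log_growth n" unfolding log_growth_def
    proof (rule integral_mono[OF _ log_cocycle_integrable])
      show "ln c + l * real n \<le> ln (cocycle_norm n x)" for x
      proof -
        have "ln (c * exp (l * real n)) \<le> ln (cocycle_norm n x)"
          using assms(2)[of n x] cocycle_norm_ge_1[of n x] c by (subst ln_le_cancel_iff) auto
        then show ?thesis using c by (simp add: ln_mult)
      qed
    qed simp
    then show ?thesis by (simp add: prob_space)
  qed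
  have "(\<lambda>n. ln c / real n + l) \<longlonglongrightarrow> 0 + l" by (intro tendsto_add lim_const_over_n tendsto_const)
  then have "(\<lambda>n. ln c / real n + l) \<longlonglongrightarrow> l" by simp
  then show ?thesis
  proof (rule LIMSEQ_le[OF _ lyapunov_limit], intro exI[of _ 1] allI impI)
    fix n :: nat assume "n \<ge> 1"
    then have "ln c / real n + l = (ln c + l * real n) / real n" by (simp add: add_divide_distrib)
    also have "\<dots> \<le> log_growth n / real n" by (rule divide_right_mono[OF a]) simp
    finally show "ln c / real n + l \<le> log_growth n / real n" .
  qed
qed

lemma average_eventually_less:
  assumes "continuous_on UNIV f" "integral\<^sup>L \<mu> f < c"
  obtains n0 where "\<And>n x. n \<ge> n0 \<Longrightarrow> (\<Sum>k<n. f ((T ^^ k) x)) < real n * c"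
  using uniquely_ergodic_averages_eventually_less[OF cpt T_cont _ inv_mu assms] strict
  unfolding strictly_ergodic_def by blast

lemma log_step_bound:
  obtains c where "c \<ge> 0"
    "\<And>x w n. schroedinger_solution (orbit_pot x) w \<Longrightarrow> w \<noteq> (\<lambda>_. 0) \<Longrightarrow> \<bar>ln (phase_norm w (n + 1)) - ln (phase_norm w n)\<bar> \<le> c"
    "\<And>x n. \<bar>ln (cocycle_norm (Suc n) x) - ln (cocycle_norm n x)\<bar> \<le> c"
proof -
  obtain B where B: "B \<ge> 1" "\<And>x w n. schroedinger_solution (orbit_pot x) w \<Longrightarrow> phase_norm w (n + 1) \<le> B * phase_norm w n"
    "\<And>x w n. schroedinger_solution (orbit_pot x) w \<Longrightarrow> phase_norm w n \<le> B * phase_norm w (n + 1)"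
    using phase_norm_step by blast
  have l: "\<bar>ln b - ln a\<bar> \<le> ln B" if "a > 0" "b > 0" "b \<le> B * a" "a \<le> B * b" for a b :: real
  proof -
    have "ln b \<le> ln (B * a)" "ln a \<le> ln (B * b)" using that B(1) by (auto simp: ln_le_cancel_iff)
    then show ?thesis using that B(1) by (simp add: ln_mult)
  qed
  show thesis
  proof (rule that[of "ln B"])
    show "0 \<le> ln B" using B(1) by simp
    show "\<bar>ln (phase_norm w (n + 1)) - ln (phase_norm w n)\<bar> \<le> ln B" if "schroedinger_solution (orbit_pot x) w" "w \<noteq> (\<lambda>_. 0)" for x w n
      using phase_norm_pos[OF that] B(2,3)[OF that(1)] by (intro l) auto
    show "\<bar>ln (cocycle_norm (Suc n) x) - ln (cocycle_norm n x)\<bar> \<le> ln B" for x n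
    proof (rule l)
      show "0 < cocycle_norm n x" "0 < cocycle_norm (Suc n) x" using cocycle_norm_ge_1 by (metis less_le_trans zero_less_one)+
      have "cocycle_norm (Suc n) (int_iterate T 0 x) \<le> B * cocycle_norm n x"
      proof (rule cocycle_norm_leI)
        fix w assume w: "schroedinger_solution (orbit_pot x) w"
        have "phase_norm w (int n + 1) \<le> B * (cocycle_norm n x * phase_norm w 0)"
          using B(2)[OF w, of "int n"] phase_norm_le_cocycle[OF w, of 0 n] B(1)
          by (simp add: order_trans[OF _ mult_left_mono])
        then show "phase_norm w (0 + int (Suc n)) \<le> B * cocycle_norm n x * phase_norm w 0" by (simp add: add.commute mult.assoc)
      qed
      then show "cocycle_norm (Suc n) x \<le> B * cocycle_norm n x" by simp
      have "cocycle_norm n (int_iterate T 0 x) \<le> B * cocycle_norm (Suc n) x"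
      proof (rule cocycle_norm_leI)
        fix w assume w: "schroedinger_solution (orbit_pot x) w"
        have "phase_norm w (int n) \<le> B * (cocycle_norm (Suc n) x * phase_norm w 0)"
          using B(3)[OF w, of "int n"] phase_norm_le_cocycle[OF w, of 0 "Suc n"] B(1)
          by (simp add: order_trans[OF _ mult_left_mono] add.commute)
        then show "phase_norm w (0 + int n) \<le> B * cocycle_norm (Suc n) x * phase_norm w 0" by (simp add: mult.assoc)
      qed
      then show "cocycle_norm n x \<le> B * cocycle_norm (Suc n) x" by simp
    qed
  qed
qed

text \<open>
  The upper half of the uniform convergence of a subadditive cocycle: compare \<open>\<parallel>A\<^sub>n\<parallel>\<close> with blocks of
  a length \<open>N\<close> for which the mean of \<open>log \<parallel>A\<^sub>N\<parallel>\<close> is less than \<open>l N\<close>.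
\<close>
lemma cocycle_norm_uniform_upper:
  assumes "lyap < l"
  obtains C where "C > 0" "\<And>n x. cocycle_norm n x \<le> C * exp (l * real n)"
proof -
  have "eventually (\<lambda>n. log_growth n / real n < l) sequentially" using order_tendstoD(2)[OF lyapunov_limit assms] .
  then obtain N1 where N1: "\<And>n. n \<ge> N1 \<Longrightarrow> log_growth n / real n < l"
    unfolding eventually_sequentially by blast
  define N where "N = Suc N1"
  have N: "N \<ge> 1" "log_growth N / real N < l" using N1[of "Suc N1"] unfolding N_def by auto
  then have "integral\<^sup>L \<mu> (\<lambda>x. ln (cocycle_norm N x)) < real N * l" unfolding log_growth_def by (simp add: field_simps)
  from average_eventually_less[OF log_cocycle_cont this]
  obtain n0 where n0: "\<And>n x. n \<ge> n0 \<Longrightarrow> (\<Sum>k<n. ln (cocycle_norm N ((T ^^ k) x))) < real n * (real N * l)"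
    by metis
  obtain c where c: "c \<ge> 0" "\<And>x n. \<bar>ln (cocycle_norm (Suc n) x) - ln (cocycle_norm n x)\<bar> \<le> c"
    by (rule log_step_bound; rule that; assumption)
  have l0: "l \<ge> 0" using lyapunov_nonneg assms by linarith
  define C where "C = exp (2 * c * real N + c * real n0)"
  have "cocycle_norm n x \<le> C * exp (l * real n)" for n x
  proof -
    have "ln (cocycle_norm n x) \<le> 2 * c * real N + c * real n0 + l * real n"
    proof (cases "n \<ge> n0")
      case True
      have "real N * (ln (cocycle_norm n x) - ln (cocycle_norm 0 x)) \<le> (\<Sum>k<n. ln (cocycle_norm N ((T ^^ k) x))) + 2 * c * (real N)\<^sup>2"
      proof (rule telescoping_average_bound)
        show "\<bar>ln (cocycle_norm (Suc n) x) - ln (cocycle_norm n x)\<bar> \<le> c" for n by (rule c(2))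
        fix n
        have "ln (cocycle_norm (n + N) x) \<le> ln (cocycle_norm N ((T ^^ n) x) * cocycle_norm n x)"
          using cocycle_norm_mult[of n N x] by (subst ln_le_cancel_iff) auto
        then show "ln (cocycle_norm (n + N) x) - ln (cocycle_norm n x) \<le> ln (cocycle_norm N ((T ^^ n) x))"
          by (simp add: ln_mult)
      qed
      then have "real N * ln (cocycle_norm n x) \<le> real n * (real N * l) + 2 * c * (real N)\<^sup>2" using n0[OF True, of x] by simp
      also have "\<dots> = real N * (l * real n + 2 * c * real N)" by (simp add: power2_eq_square algebra_simps)
      finally have "ln (cocycle_norm n x) \<le> l * real n + 2 * c * real N" using N(1) by simp
      moreover have "0 \<le> c * real n0" using c(1) by simp
      ultimately show ?thesis by linarith
    next
      case False
      have "ln (cocycle_norm n x) \<le> c * real n"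
      proof (induction n)
        case (Suc n) then show ?case using c(2)[of n x] by (simp add: distrib_left)
      qed simp
      also have "\<dots> \<le> c * real n0" using False c(1) by (intro mult_left_mono) auto
      finally show ?thesis using c(1) l0 by (simp add: add_increasing add_increasing2)
    qed
    then have "exp (ln (cocycle_norm n x)) \<le> exp (2 * c * real N + c * real n0 + l * real n)"
      by (simp only: exp_le_cancel_iff)
    then show ?thesis unfolding C_def by (simp add: exp_add)
  qed
  then show thesis using that[of C] unfolding C_def by simp
qed

text \<open>
  In general the logarithm of the norm of a cocycle has no uniform lower bound in terms of the Lyapunov
  exponent. Here the growth of \<open>q\<close> over a block of length \<open>N\<close> is at least \<open>\<parallel>A\<^sub>N\<parallel> / K\<close> and is
  multiplicative, so that the telescoping bound applies with the opposite sign.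
\<close>
lemma dominated_growth_uniform_lower:
  assumes l: "0 \<le> l" "l < lyap" and q: "dominated_green (orbit_pot x) q G K"
  obtains c where "c > 0" "\<And>m n. m \<le> n \<Longrightarrow> c * exp (l * real_of_int (n - m)) * phase_norm q m \<le> phase_norm q n"
proof -
  have sol: "schroedinger_solution (orbit_pot x) q" "q \<noteq> (\<lambda>_. 0)" using q unfolding dominated_green_def by auto
  have qp: "phase_norm q n > 0" for n by (rule phase_norm_pos[OF sol])
  have qn: "phase_norm q n \<noteq> 0" for n using qp[of n] by simp
  have dom: "phase_norm u n \<le> K * (phase_norm q n / phase_norm q m) * phase_norm u m"
    if "schroedinger_solution (orbit_pot x) u" "m \<le> n" for u m n using q that unfolding dominated_green_def by blast
  have cn: "cocycle_norm n (int_iterate T m x) \<le> K * (phase_norm q (m + int n) / phase_norm q m)" for n m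
    by (rule cocycle_norm_leI) (use dom in auto)
  have K0: "K > 0"
  proof -
    have "1 \<le> K" using cn[of 0 0] qp[of 0] by simp
    then show ?thesis by simp
  qed
  \<comment> \<open>blocks so long that the loss of the factor K per block is absorbed by the gap between l and L\<close>
  obtain N where N: "N \<ge> 1" "ln K < real N * (lyap - l)"
  proof -
    obtain N0 :: nat where "ln K / (lyap - l) < real N0" using reals_Archimedean2 by blast
    then have "ln K < real N0 * (lyap - l)" using l by (simp add: pos_divide_less_eq)
    also have "\<dots> \<le> real (Suc N0) * (lyap - l)" using l by (intro mult_right_mono) auto
    finally show thesis using that[of "Suc N0"] by simp
  qed
  have "integral\<^sup>L \<mu> (\<lambda>y. - ln (cocycle_norm N y)) \<le> - (real N * lyap)"
    using lyapunov_le[OF N(1)] N(1) unfolding log_growth_def by (simp add: field_simps)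
  also have "\<dots> < - (real N * l) - ln K" using N(2) by (simp add: algebra_simps)
  finally obtain n0 where n0: "\<And>n y. n \<ge> n0 \<Longrightarrow> (\<Sum>k<n. - ln (cocycle_norm N ((T ^^ k) y))) < real n * (- (real N * l) - ln K)"
    using average_eventually_less[OF continuous_on_minus[OF log_cocycle_cont]] by blast
  obtain c where c: "c \<ge> 0" "\<And>n. \<bar>ln (phase_norm q (n + 1)) - ln (phase_norm q n)\<bar> \<le> c"
    using log_step_bound sol by metis
  define b where "b = 2 * c * real N + c * real n0 + l * real n0"
  have main: "l * real n - b \<le> ln (phase_norm q (m + int n)) - ln (phase_norm q m)" for m n
  proof (cases "n \<ge> n0")
    case True
    define h where "h n = - ln (phase_norm q (m + int n))" for n
    have "real N * (h n - h 0) \<le> (\<Sum>k<n. - ln (cocycle_norm N ((T ^^ k) (int_iterate T m x))) + ln K) + 2 * c * (real N)\<^sup>2"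
    proof (rule telescoping_average_bound)
      show "\<bar>h (Suc n) - h n\<bar> \<le> c" for n using c(2)[of "m + int n"] unfolding h_def by (simp add: algebra_simps)
      fix n
      have "cocycle_norm N ((T ^^ n) (int_iterate T m x)) \<le> K * (phase_norm q (m + int n + int N) / phase_norm q (m + int n))"
        unfolding funpow_int_iterate by (rule cn)
      moreover have "0 < cocycle_norm N ((T ^^ n) (int_iterate T m x))" using cocycle_norm_ge_1 by (metis less_le_trans zero_less_one)
      ultimately have "ln (cocycle_norm N ((T ^^ n) (int_iterate T m x))) \<le> ln (K * (phase_norm q (m + int n + int N) / phase_norm q (m + int n)))"
        by (simp add: ln_mono)
      also have "\<dots> = ln K + ln (phase_norm q (m + int n + int N)) - ln (phase_norm q (m + int n))"
        using K0 qp by (simp add: ln_mult ln_div qn)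
      finally show "h (n + N) - h n \<le> - ln (cocycle_norm N ((T ^^ n) (int_iterate T m x))) + ln K"
        unfolding h_def by (simp add: algebra_simps)
    qed
    also have "(\<Sum>k<n. - ln (cocycle_norm N ((T ^^ k) (int_iterate T m x))) + ln K) \<le> real n * (- (real N * l) - ln K) + real n * ln K"
      using n0[OF True, of "int_iterate T m x"] unfolding sum.distrib by simp
    finally have "real N * (h n - h 0) \<le> real N * (2 * c * real N - l * real n)"
      by (simp add: algebra_simps power2_eq_square)
    then have "h n - h 0 \<le> 2 * c * real N - l * real n" using N(1) by simp
    moreover have "2 * c * real N \<le> b" unfolding b_def using c(1) l(1) by simp
    ultimately show ?thesis unfolding h_def by simp
  next
    case False
    have "- (c * real n) \<le> ln (phase_norm q (m + int n)) - ln (phase_norm q m)"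
    proof (induction n)
      case (Suc n) then show ?case using c(2)[of "m + int n"] by (simp add: algebra_simps)
    qed simp
    moreover have "c * real n \<le> c * real n0" "l * real n \<le> l * real n0" using False c(1) l(1) by (auto intro!: mult_left_mono)
    moreover have "0 \<le> 2 * c * real N" using c(1) by simp
    ultimately show ?thesis unfolding b_def by linarith
  qed
  show thesis
  proof (rule that[of "exp (- b)"])
    fix m n :: int assume "m \<le> n"
    then obtain k where k: "n = m + int k" using zle_iff_zadd by blast
    have "exp (l * real k - b) \<le> exp (ln (phase_norm q n) - ln (phase_norm q m))" using main[of k m] unfolding k by simp
    also have "\<dots> = phase_norm q n / phase_norm q m" using qp by (simp add: exp_diff)
    finally show "exp (- b) * exp (l * real_of_int (n - m)) * phase_norm q m \<le> phase_norm q n"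
      using qp[of m] unfolding k by (simp add: pos_le_divide_eq exp_diff exp_minus field_simps)
  qed simp
qed

end

section \<open>Green functions and the spectrum\<close>

text \<open>
  Undoing the gauge transformation turns a Green function of the Schroedinger equation into an
  inverse kernel.
\<close>
lemma invertible_by_green:
  assumes d: "d > 0" and V: "\<And>n. cmod (V n) \<le> B"
    and col: "\<And>m. green_column V m 1 (\<lambda>n. G n m)"
    and row: "\<And>n m. - G n (m + 1) - G n (m - 1) + V m * G n m = (if m = n then 1 else 0)"
    and dec: "\<And>n m. exp (- g * real_of_int (n - m)) * cmod (G n m) \<le> K * exp (- d * real_of_int \<bar>n - m\<bar>)"
  shows "ell2_invertible (hn_op V g)"
proof (rule hn_op_invertible_by_kernel[where d=d and B=B and K=K
      and G="\<lambda>n m. of_real (exp (- g * real_of_int n)) * (of_real (exp (g * real_of_int m)) * G n m)"])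
  have ee: "exp (- g * real_of_int n) * exp (g * real_of_int n) = 1" for n by (simp add: exp_add[symmetric])
  have eo: "complex_of_real (exp (- g * real_of_int n)) * of_real (exp (g * real_of_int n)) = 1"
    "complex_of_real (exp (g * real_of_int n)) * of_real (exp (- g * real_of_int n)) = 1" for n
    unfolding of_real_mult[symmetric] ee mult.commute[of "exp (g * real_of_int n)"] by simp_all
  have lin: "- (a * x) - a * y + w * (a * z) = a * (- x - y + w * z)" for a x y w z :: complex
    by (simp add: algebra_simps)
  show "cmod (of_real (exp (- g * real_of_int n)) * (of_real (exp (g * real_of_int m)) * G n m)) \<le> K * exp (- d * real_of_int \<bar>n - m\<bar>)" for n m
  proof -
    have "exp (- g * real_of_int n) * exp (g * real_of_int m) = exp (- g * real_of_int (n - m))"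
      by (simp add: exp_add[symmetric] algebra_simps)
    moreover have "cmod (of_real (exp (- g * real_of_int n)) * (of_real (exp (g * real_of_int m)) * G n m))
      = (exp (- g * real_of_int n) * exp (g * real_of_int m)) * cmod (G n m)" by (simp only: norm_mult norm_of_real abs_exp_cancel mult.assoc)
    ultimately show ?thesis using dec[of n m] by (simp only:)
  qed
  show "hn_op V g (\<lambda>n. of_real (exp (- g * real_of_int n)) * (of_real (exp (g * real_of_int m)) * G n m)) = (\<lambda>n. if n = m then 1 else 0)" for m
  proof
    fix n
    show "hn_op V g (\<lambda>n. of_real (exp (- g * real_of_int n)) * (of_real (exp (g * real_of_int m)) * G n m)) n = (if n = m then 1 else 0)"
      unfolding hn_op_conjugation lin col[unfolded green_column_def, rule_format] using eo[of m] by auto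
  qed
  show "hn_op V (- g) (\<lambda>m. of_real (exp (- g * real_of_int n)) * (of_real (exp (g * real_of_int m)) * G n m)) = (\<lambda>m. if m = n then 1 else 0)" for n
  proof
    fix m
    have e: "(\<lambda>m. of_real (exp (- g * real_of_int n)) * (of_real (exp (g * real_of_int m)) * G n m))
       = (\<lambda>m. of_real (exp (- (- g) * real_of_int m)) * (of_real (exp (- g * real_of_int n)) * G n m))"
      by (auto simp: mult_ac)
    show "hn_op V (- g) (\<lambda>m. of_real (exp (- g * real_of_int n)) * (of_real (exp (g * real_of_int m)) * G n m)) m = (if m = n then 1 else 0)"
      unfolding e hn_op_conjugation lin row using eo[of n] by auto
  qed
qed (use d V in auto)

lemma invertible_by_exponential_green:
  assumes l: "g < l" "0 \<le> g" and V: "\<And>n. cmod (V n) \<le> B"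
    and G: "\<And>m. green_column V m 1 (\<lambda>n. G n m)" and sym: "\<And>n m. G n m = G m n"
    and dec: "\<And>n m. cmod (G n m) \<le> K * exp (- l * real_of_int \<bar>n - m\<bar>)"
  shows "ell2_invertible (hn_op V g)"
proof (rule invertible_by_green[where d="l - g" and K=K and G=G, OF _ V G])
  show "exp (- g * real_of_int (n - m)) * cmod (G n m) \<le> K * exp (- (l - g) * real_of_int \<bar>n - m\<bar>)" for n m
  proof -
    have "exp (- g * real_of_int (n - m)) * cmod (G n m) \<le> exp (g * real_of_int \<bar>n - m\<bar>) * (K * exp (- l * real_of_int \<bar>n - m\<bar>))"
    proof (rule mult_mono[OF _ dec])
      have "- real_of_int (n - m) \<le> real_of_int \<bar>n - m\<bar>" by linarith
      then have "g * (- real_of_int (n - m)) \<le> g * real_of_int \<bar>n - m\<bar>" using l(2) by (rule mult_left_mono)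
      then show "exp (- g * real_of_int (n - m)) \<le> exp (g * real_of_int \<bar>n - m\<bar>)" by (simp only: exp_le_cancel_iff mult_minus_left mult_minus_right)
    qed auto
    also have "\<dots> = K * (exp (g * real_of_int \<bar>n - m\<bar>) * exp (- l * real_of_int \<bar>n - m\<bar>))" by (simp only: mult_ac)
    also have "exp (g * real_of_int \<bar>n - m\<bar>) * exp (- l * real_of_int \<bar>n - m\<bar>) = exp (- (l - g) * real_of_int \<bar>n - m\<bar>)"
      by (simp only: exp_add[symmetric]) (simp add: algebra_simps)
    finally show ?thesis .
  qed
  show "- G n (m + 1) - G n (m - 1) + V m * G n m = (if m = n then 1 else 0)" for n m
    using G[of n] unfolding green_column_def sym[of n] by blast
qed (use l in auto)

text \<open>
  Tychonoff's theorem; the product topology over a countable index set is metrizable, so compactness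
  yields convergent subsequences.
\<close>
lemma bounded_kernels_convergent_subsequence:
  fixes F :: "nat \<Rightarrow> int \<times> int \<Rightarrow> complex"
  assumes "\<And>j z. cmod (F j z) \<le> b z"
  obtains r G where "strict_mono (r :: nat \<Rightarrow> nat)" "\<And>z. (\<lambda>j. F (r j) z) \<longlonglongrightarrow> G z"
proof -
  have "compactin (product_topology (\<lambda>z. euclidean) UNIV) (PiE UNIV (\<lambda>z::int \<times> int. cball (0::complex) (b z)))"
    unfolding compactin_PiE by (auto simp: compactin_euclidean_iff)
  then have c: "compact (PiE UNIV (\<lambda>z::int \<times> int. cball (0::complex) (b z)))"
    unfolding euclidean_product_topology compactin_euclidean_iff .
  have "\<forall>j. F j \<in> PiE UNIV (\<lambda>z::int \<times> int. cball (0::complex) (b z))"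
    using assms by (auto simp: PiE_def Pi_def extensional_def)
  from seq_compactE[OF compact_imp_seq_compact[OF c] this]
  obtain G r where G: "strict_mono (r::nat\<Rightarrow>nat)" "(F \<circ> r) \<longlonglongrightarrow> G" by metis
  have "(\<lambda>j. F (r j) z) \<longlonglongrightarrow> G z" for z
    using continuous_on_tendsto_compose[OF continuous_on_product_coordinates[of z] G(2)] by (simp add: o_def)
  then show thesis using that G(1) by blast
qed

context ergodic_schroedinger
begin

text \<open>
  Translates of \<open>G\<close> are Green functions for the points of the orbit of \<open>x\<close>, which is dense. A limit of translates is a
  Green function at the limit point, with the same decay.
\<close>
lemma exponential_green_transfer:
  assumes G: "\<And>m. green_column (orbit_pot x) m 1 (\<lambda>n. G n m)" and sym: "\<And>n m. G n m = G m n"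
    and dec: "\<And>n m. cmod (G n m) \<le> K * exp (- l * real_of_int \<bar>n - m\<bar>)"
  obtains H :: "int \<Rightarrow> int \<Rightarrow> complex" where "\<And>m. green_column (orbit_pot y) m 1 (\<lambda>n. H n m)" "\<And>n m. H n m = H m n"
    "\<And>n m. cmod (H n m) \<le> K * exp (- l * real_of_int \<bar>n - m\<bar>)"
proof -
  obtain k where k: "(\<lambda>j::nat. int_iterate T (k j) x) \<longlonglongrightarrow> y" by (rule orbit_dense)
  define F where "F j z = G (fst z + k j) (snd z + k j)" for j z
  have "cmod (F j z) \<le> K * exp (- l * real_of_int \<bar>fst z - snd z\<bar>)" for j z
    using dec[of "fst z + k j" "snd z + k j"] unfolding F_def by simp
  from bounded_kernels_convergent_subsequence[of F, OF this]
  obtain r H where r: "strict_mono (r :: nat \<Rightarrow> nat)" and H: "\<And>z. (\<lambda>j. F (r j) z) \<longlonglongrightarrow> H z" by metis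
  have V: "(\<lambda>j. orbit_pot x (n + k (r j))) \<longlonglongrightarrow> orbit_pot y n" for n
  proof -
    have "(\<lambda>j. orbit_pot (int_iterate T (k j) x) n) \<longlonglongrightarrow> orbit_pot y n"
      by (rule continuous_on_tendsto_compose[OF orbit_pot_cont k]) auto
    from LIMSEQ_subseq_LIMSEQ[OF this r] show ?thesis unfolding o_def orbit_pot_shift .
  qed
  have Hn: "(\<lambda>j. G (n + k (r j)) (m + k (r j))) \<longlonglongrightarrow> H (n, m)" for n m using H[of "(n, m)"] unfolding F_def by simp
  show thesis
  proof (rule that[of "\<lambda>n m. H (n, m)"])
    show "green_column (orbit_pot y) m 1 (\<lambda>n. H (n, m))" for m unfolding green_column_def
    proof
      fix n
      have "(\<lambda>j. - G (n + 1 + k (r j)) (m + k (r j)) - G (n - 1 + k (r j)) (m + k (r j)) + orbit_pot x (n + k (r j)) * G (n + k (r j)) (m + k (r j)))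
        \<longlonglongrightarrow> - H (n + 1, m) - H (n - 1, m) + orbit_pot y n * H (n, m)"
        by (intro tendsto_intros Hn V)
      moreover have "- G (n + 1 + k (r j)) (m + k (r j)) - G (n - 1 + k (r j)) (m + k (r j)) + orbit_pot x (n + k (r j)) * G (n + k (r j)) (m + k (r j)) = (if n = m then 1 else 0)" for j
        using G[of "m + k (r j)"] unfolding green_column_def
        by (auto simp: algebra_simps dest: spec[of _ "n + k (r j)"])
      ultimately have "(\<lambda>j::nat. if n = m then 1 else 0) \<longlonglongrightarrow> - H (n + 1, m) - H (n - 1, m) + orbit_pot y n * H (n, m)"
        by simp
      from LIMSEQ_unique[OF this tendsto_const]
      show "- H (n + 1, m) - H (n - 1, m) + orbit_pot y n * H (n, m) = (if n = m then 1 else 0)" .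
    qed
    show "H (n, m) = H (m, n)" for n m
      using LIMSEQ_unique[OF Hn[of n m]] Hn[of m n] sym by simp
    show "cmod (H (n, m)) \<le> K * exp (- l * real_of_int \<bar>n - m\<bar>)" for n m
    proof (rule Lim_norm_ubound[OF _ Hn])
      show "\<forall>\<^sub>F j in sequentially. cmod (G (n + k (r j)) (m + k (r j))) \<le> K * exp (- l * real_of_int \<bar>n - m\<bar>)"
        using dec[of "n + k (r j)" "m + k (r j)" for j] by (intro always_eventually allI) simp
    qed simp
  qed
qed

lemma dominated_green_decay:
  assumes q: "dominated_green V q G K" and c: "c > 0"
    and grow: "\<And>m n. m \<le> n \<Longrightarrow> c * exp (l * real_of_int (n - m)) * phase_norm q m \<le> phase_norm q n"
  shows "cmod (G n m) \<le> K / c * exp (- l * real_of_int \<bar>n - m\<bar>)"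
proof -
  have qp: "phase_norm q n > 0" for n using q phase_norm_pos unfolding dominated_green_def by blast
  have b: "cmod (G n m) \<le> K * phase_norm q (min n m) / phase_norm q (max n m)" using q unfolding dominated_green_def by blast
  have K0: "K \<ge> 0"
  proof -
    have "phase_norm q 0 \<le> K * phase_norm q 0" using q unfolding dominated_green_def by blast
    then have "1 \<le> K" using qp[of 0] by simp
    then show ?thesis by simp
  qed
  have e: "max n m - min n m = \<bar>n - m\<bar>" by linarith
  have "c * exp (l * real_of_int \<bar>n - m\<bar>) * phase_norm q (min n m) \<le> phase_norm q (max n m)"
    using grow[of "min n m" "max n m"] unfolding e by simp
  then have "phase_norm q (min n m) / phase_norm q (max n m) \<le> 1 / c * exp (- l * real_of_int \<bar>n - m\<bar>)"
    using c qp by (simp add: exp_minus field_simps)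
  then have "K * (phase_norm q (min n m) / phase_norm q (max n m)) \<le> K * (1 / c * exp (- l * real_of_int \<bar>n - m\<bar>))"
    by (rule mult_left_mono[OF _ K0])
  then show ?thesis using b by simp
qed

text \<open>
  The Green function used here is causal: its column with source \<open>m\<close> vanishes up to \<open>m\<close> and continues as the
  solution with data \<open>w m = 0\<close>, \<open>w (m + 1) = - 1\<close>. It may grow, but more slowly than \<open>exp (g n)\<close>.
\<close>
lemma invertible_of_lyapunov_less:
  assumes "lyap < g"
  shows "ell2_invertible (hn_op (orbit_pot x) g)"
proof -
  obtain l where l: "lyap < l" "l < g" using dense[OF assms] by blast
  obtain C where C: "C > 0" "\<And>n x. cocycle_norm n x \<le> C * exp (l * real n)"
    using cocycle_norm_uniform_upper[OF l(1)] by blast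
  have "\<exists>w. schroedinger_solution (orbit_pot x) w \<and> w m = 0 \<and> w (m - 1) = 1" for m
    using solution_exists[of "orbit_pot x" m 0 1] by blast
  then obtain w where w: "\<And>m. schroedinger_solution (orbit_pot x) (w m)" "\<And>m. w m m = 0" "\<And>m. w m (m - 1) = 1" by metis
  have w1: "w m (m + 1) = -1" for m using solution_step[OF w(1), of m m] w by simp
  define G where "G n m = (if n \<ge> m then w m n else 0)" for n m
  have col: "green_column (orbit_pot x) m 1 (\<lambda>n. G n m)" for m unfolding green_column_def
  proof
    fix n
    consider "n < m" | "n = m" | "n > m" by linarith
    then show "- G (n + 1) m - G (n - 1) m + orbit_pot x n * G n m = (if n = m then 1 else 0)"
    proof cases
      case 1
      then show ?thesis using w(2)[of m] by (cases "n + 1 = m") (auto simp: G_def)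
    next
      case 2
      then show ?thesis using w(2)[of m] w1[of m] by (simp add: G_def)
    next
      case 3
      then show ?thesis using solution_step[OF w(1)[of m], of n] by (simp add: G_def)
    qed
  qed
  have row: "- G n (m + 1) - G n (m - 1) + orbit_pot x m * G n m = (if m = n then 1 else 0)" for n m
  proof -
    \<comment> \<open>the recursion in the source index; both sides are solutions with the same data at m\<close>
    have rec: "w (m + 1) n = orbit_pot x m * w m n - w (m - 1) n" for n
    proof -
      have "w (m + 1) = (\<lambda>n. orbit_pot x m * w m n + (- 1) * w (m - 1) n)"
      proof (rule solution_unique[where k=m])
        show "schroedinger_solution (orbit_pot x) (w (m + 1))" by (rule w)
        show "schroedinger_solution (orbit_pot x) (\<lambda>n. orbit_pot x m * w m n + (- 1) * w (m - 1) n)" by (rule solution_lincomb[OF w(1) w(1)])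
        show "w (m + 1) m = orbit_pot x m * w m m + - 1 * w (m - 1) m" using w(2)[of m] w(3)[of "m + 1"] w1[of "m - 1"] by simp
        show "w (m + 1) (m - 1) = orbit_pot x m * w m (m - 1) + - 1 * w (m - 1) (m - 1)"
          using w(2)[of "m - 1"] w(3)[of m] solution_step_back[OF w(1)[of "m + 1"], of m] w(2)[of "m + 1"] w(3)[of "m + 1"] by simp
      qed
      then show ?thesis by (simp add: fun_eq_iff)
    qed
    consider "n < m - 1" | "n = m - 1" | "n = m" | "n > m" by linarith
    then show ?thesis
    proof cases
      case 1 then show ?thesis by (simp add: G_def)
    next
      case 2 then show ?thesis using w(2)[of "m - 1"] by (simp add: G_def)
    next
      case 3 then show ?thesis using w(2)[of m] w1[of "m - 1"] by (simp add: G_def)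
    next
      case 4 then show ?thesis using rec[of n] by (simp add: G_def)
    qed
  qed
  have dec: "exp (- g * real_of_int (n - m)) * cmod (G n m) \<le> C * exp (- (g - l) * real_of_int \<bar>n - m\<bar>)" for n m
  proof (cases "n \<ge> m")
    case True
    then obtain k where k: "n = m + int k" using zle_iff_zadd by blast
    have "cmod (w m n) \<le> phase_norm (w m) n" by (rule norm_le_phase_norm)
    also have "\<dots> \<le> cocycle_norm k (int_iterate T m x) * phase_norm (w m) m" unfolding k by (rule phase_norm_le_cocycle[OF w(1)])
    also have "phase_norm (w m) m = 1" using w(2,3)[of m] by (simp add: phase_norm_def)
    also have "cocycle_norm k (int_iterate T m x) * 1 \<le> C * exp (l * real k)" using C(2) by simp
    finally have "exp (- g * real k) * cmod (w m n) \<le> exp (- g * real k) * (C * exp (l * real k))" by (rule mult_left_mono) simp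
    also have "\<dots> = C * (exp (- g * real k) * exp (l * real k))" by (simp only: mult_ac)
    also have "exp (- g * real k) * exp (l * real k) = exp (- (g - l) * real k)"
      by (simp only: exp_add[symmetric]) (simp add: algebra_simps)
    finally show ?thesis using True unfolding G_def k by simp
  next
    case False
    then show ?thesis using C(1) by (simp add: G_def)
  qed
  obtain B where B: "\<And>n. cmod (orbit_pot x n) \<le> B" using orbit_pot_bounded by metis
  show ?thesis by (rule invertible_by_green[where d="g - l" and G=G and K=C, OF _ B col row dec]) (use l in simp)
qed

end

text \<open>
  The factor two per block improves the rate \<open>g\<close> strictly.
\<close>
lemma block_growth_imp_exponential:
  fixes \<rho> :: "int \<Rightarrow> real"
  assumes pos: "\<And>n. \<rho> n > 0" and g: "g \<ge> 0" and N: "N > 0"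
    and block: "\<And>n. 2 * exp (g * real N) * \<rho> n \<le> \<rho> (n + int N)"
    and mono: "\<And>m n. m \<le> n \<Longrightarrow> \<rho> m \<le> K * \<rho> n"
  obtains l c where "l > g" "c > 0" "\<And>m n. m \<le> n \<Longrightarrow> c * exp (l * real_of_int (n - m)) * \<rho> m \<le> \<rho> n"
proof -
  \<comment> \<open>the rate for which one block contributes exactly the factor 2 exp (g N)\<close>
  define l where "l = g + ln 2 / real N"
  have lN: "exp (l * real N) = 2 * exp (g * real N)"
    unfolding l_def using N by (simp add: distrib_right exp_add)
  have l0: "l > g" unfolding l_def using N by simp
  have K1: "K \<ge> 1" using mono[of 0 0] pos[of 0] by simp
  have it: "exp (l * real (a * N)) * \<rho> m \<le> \<rho> (m + int (a * N))" for a m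
  proof (induction a)
    case (Suc a)
    have "exp (l * real (Suc a * N)) * \<rho> m = exp (l * real N) * (exp (l * real (a * N)) * \<rho> m)"
      by (simp add: exp_add[symmetric] algebra_simps)
    also have "\<dots> \<le> exp (l * real N) * \<rho> (m + int (a * N))" by (rule mult_left_mono[OF Suc]) simp
    also have "\<dots> \<le> \<rho> (m + int (a * N) + int N)" unfolding lN by (rule block)
    finally show ?case by (simp add: algebra_simps)
  qed simp
  show thesis
  proof (rule that[OF l0, of "exp (- l * real N) / K"])
    show "exp (- l * real N) / K > 0" using K1 by simp
    fix m n :: int assume "m \<le> n"
    then obtain k where k: "n = m + int k" using zle_iff_zadd by blast
    have kd: "l * real k = l * real (k div N * N) + l * real (k mod N)"
      by (simp only: distrib_left[symmetric] of_nat_add[symmetric] div_mult_mod_eq)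
    have "l * real (k mod N) \<le> l * real N"
      using N l0 g by (intro mult_left_mono) (auto intro: less_imp_le)
    then have "- l * real N + l * real k \<le> l * real (k div N * N)" using kd by simp
    then have "exp (- l * real N) * exp (l * real k) \<le> exp (l * real (k div N * N))"
      by (simp only: exp_add[symmetric] exp_le_cancel_iff)
    then have "exp (- l * real N) * exp (l * real k) * \<rho> m \<le> exp (l * real (k div N * N)) * \<rho> m"
      by (rule mult_right_mono) (rule less_imp_le[OF pos])
    also have "\<dots> \<le> \<rho> (m + int (k div N * N))" by (rule it)
    also have "\<dots> \<le> K * \<rho> n"
    proof (rule mono)
      have "k div N * N \<le> k" by (rule div_times_less_eq_dividend)
      then show "m + int (k div N * N) \<le> n" unfolding k by (simp only: add_le_cancel_left of_nat_le_iff)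
    qed
    finally show "exp (- l * real N) / K * exp (l * real_of_int (n - m)) * \<rho> m \<le> \<rho> n"
      using K1 unfolding k by (simp add: field_simps)
  qed
qed

context ergodic_schroedinger
begin

lemma cocycle_norm_dense_le:
  assumes "\<And>k. cocycle_norm n (int_iterate T k x) \<le> c"
  shows "cocycle_norm n y \<le> c"
proof -
  obtain k where k: "(\<lambda>j::nat. int_iterate T (k j) x) \<longlonglongrightarrow> y" by (rule orbit_dense)
  have "(\<lambda>j. cocycle_norm n (int_iterate T (k j) x)) \<longlonglongrightarrow> cocycle_norm n y"
    by (rule continuous_on_tendsto_compose[OF cocycle_norm_cont k]) auto
  then show ?thesis by (rule LIMSEQ_le_const2) (use assms in auto)
qed

lemma cocycle_norm_dense_ge:
  assumes "\<And>k. c \<le> cocycle_norm n (int_iterate T k x)"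
  shows "c \<le> cocycle_norm n y"
proof -
  obtain k where k: "(\<lambda>j::nat. int_iterate T (k j) x) \<longlonglongrightarrow> y" by (rule orbit_dense)
  have "(\<lambda>j. cocycle_norm n (int_iterate T (k j) x)) \<longlonglongrightarrow> cocycle_norm n y"
    by (rule continuous_on_tendsto_compose[OF cocycle_norm_cont k]) auto
  then show ?thesis by (rule LIMSEQ_le_const) (use assms in auto)
qed

text \<open>
  The contracting alternative would give \<open>L < g\<close>, because contraction along a dense orbit is
  contraction everywhere.
\<close>
lemma invertible_dichotomy:
  assumes g: "g \<ge> 0" and inv: "ell2_invertible (hn_op (orbit_pot x) g)" and L: "g \<le> lyap"
  obtains q G K N where "N > 0" "dominated_green (orbit_pot x) q G K"
    "\<And>n. 2 * exp (g * real N) * phase_norm q n \<le> phase_norm q (n + int N)"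
  using exponential_dichotomy[OF g inv]
proof
  assume "\<exists>N>0. \<forall>u k. schroedinger_solution (orbit_pot x) u \<longrightarrow> phase_norm u (k + int N) \<le> exp (g * real N) / 2 * phase_norm u k"
  then obtain N where N: "N > 0" "\<And>u k. schroedinger_solution (orbit_pot x) u \<Longrightarrow> phase_norm u (k + int N) \<le> exp (g * real N) / 2 * phase_norm u k"
    by blast
  have "cocycle_norm N y \<le> exp (g * real N) / 2" for y
    by (rule cocycle_norm_dense_le[where x=x], rule cocycle_norm_leI, rule N(2))
  then have "lyap \<le> ln (exp (g * real N) / 2) / real N" using N(1) by (intro lyapunov_le_uniform) auto
  also have "\<dots> = g - ln 2 / real N" using N(1) by (simp add: ln_div field_simps)
  also have "\<dots> < g" using N(1) by simp
  finally show thesis using L by simp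
next
  assume "\<exists>q G K N. N > 0 \<and> dominated_green (orbit_pot x) q G K
    \<and> (\<forall>n. 2 * exp (g * real N) * phase_norm q n \<le> phase_norm q (n + int N))"
  then show thesis using that by blast
qed

lemma invertible_of_dominated_green:
  assumes q: "dominated_green (orbit_pot x) q G K" and c: "c > 0"
    and grow: "\<And>m n. m \<le> n \<Longrightarrow> c * exp (l * real_of_int (n - m)) * phase_norm q m \<le> phase_norm q n"
    and g: "0 \<le> g" "g < l"
  shows "ell2_invertible (hn_op (orbit_pot y) g)"
proof -
  have "green_column (orbit_pot x) m 1 (\<lambda>n. G n m)" "G n m = G m n" for n m
    using q unfolding dominated_green_def by blast+
  from exponential_green_transfer[OF this dominated_green_decay[OF q c grow], of y]
  obtain H where H: "\<And>m. green_column (orbit_pot y) m 1 (\<lambda>n. H n m)" "\<And>n m. H n m = H m n"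
    "\<And>n m. cmod (H n m) \<le> K / c * exp (- l * real_of_int \<bar>n - m\<bar>)" by metis
  obtain B where B: "\<And>n. cmod (orbit_pot y n) \<le> B" using orbit_pot_bounded by metis
  show ?thesis by (rule invertible_by_exponential_green[OF g(2,1) B H])
qed

text \<open>
  The rate of growth of \<open>q\<close> exceeds \<open>g\<close> and is a lower bound for the growth of the cocycle on a dense
  orbit. The same rate is the decay rate of the Green function, and it is positive.
\<close>
lemma invertible_imp_lyapunov_greater:
  assumes g: "g \<ge> 0" and inv: "ell2_invertible (hn_op (orbit_pot x) g)" and L: "g \<le> lyap"
  shows "g < lyap" "ell2_invertible (hn_op (orbit_pot y) 0)"
proof -
  obtain q G K N where N: "N > 0" and q: "dominated_green (orbit_pot x) q G K"
    and block: "\<And>n. 2 * exp (g * real N) * phase_norm q n \<le> phase_norm q (n + int N)"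
    using invertible_dichotomy[OF assms] by metis
  have sol: "schroedinger_solution (orbit_pot x) q" "q \<noteq> (\<lambda>_. 0)"
    and mono: "\<And>m n. m \<le> n \<Longrightarrow> phase_norm q m \<le> K * phase_norm q n" using q unfolding dominated_green_def by auto
  have qp: "phase_norm q n > 0" for n by (rule phase_norm_pos[OF sol])
  obtain l c where l: "l > g" and c: "c > 0"
    and grow: "\<And>m n. m \<le> n \<Longrightarrow> c * exp (l * real_of_int (n - m)) * phase_norm q m \<le> phase_norm q n"
    using block_growth_imp_exponential[of "phase_norm q", OF qp g N block mono] by metis
  have "c * exp (l * real n) \<le> cocycle_norm n y" for n y
  proof (rule cocycle_norm_dense_ge[where x=x])
    fix k
    have "c * exp (l * real n) * phase_norm q k \<le> cocycle_norm n (int_iterate T k x) * phase_norm q k"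
      using grow[of k "k + int n"] phase_norm_le_cocycle[OF sol(1), of k n] by simp
    then show "c * exp (l * real n) \<le> cocycle_norm n (int_iterate T k x)" using qp[of k] by simp
  qed
  then have "l \<le> lyap" by (rule lyapunov_ge_uniform[OF c])
  then show "g < lyap" using l by simp
  show "ell2_invertible (hn_op (orbit_pot y) 0)"
    by (rule invertible_of_dominated_green[OF q c grow]) (use l g in auto)
qed

text \<open>
  Invertibility for parameter \<open>0\<close> only provides a splitting with some rate of growth; the uniform lower
  bound raises the rate of growth of \<open>q\<close> above \<open>g\<close>.
\<close>
lemma invertible_of_lyapunov_greater:
  assumes g: "g \<ge> 0" and inv: "ell2_invertible (hn_op (orbit_pot y) 0)" and L: "g < lyap"
  shows "ell2_invertible (hn_op (orbit_pot x) g)"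
proof -
  obtain q G K N where q: "dominated_green (orbit_pot y) q G K"
    using invertible_dichotomy[OF order_refl inv lyapunov_nonneg] by metis
  obtain l where l: "g < l" "l < lyap" using dense[OF L] by blast
  have "0 \<le> l" using g l by simp
  then obtain c where c: "c > 0"
    and grow: "\<And>m n. m \<le> n \<Longrightarrow> c * exp (l * real_of_int (n - m)) * phase_norm q m \<le> phase_norm q n"
    using dominated_growth_uniform_lower[OF _ l(2) q] by metis
  show ?thesis by (rule invertible_of_dominated_green[OF q c grow g l(1)])
qed

theorem invertible_iff:
  assumes "g \<ge> 0"
  shows "ell2_invertible (hn_op (orbit_pot x) g) \<longleftrightarrow>
    lyap < g \<or> (g < lyap \<and> ell2_invertible (hn_op (orbit_pot y) 0))"
proof
  assume inv: "ell2_invertible (hn_op (orbit_pot x) g)"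
  show "lyap < g \<or> (g < lyap \<and> ell2_invertible (hn_op (orbit_pot y) 0))"
  proof (cases "g \<le> lyap")
    case True
    then show ?thesis using invertible_imp_lyapunov_greater[OF assms inv] by blast
  qed simp
next
  assume "lyap < g \<or> (g < lyap \<and> ell2_invertible (hn_op (orbit_pot y) 0))"
  then show "ell2_invertible (hn_op (orbit_pot x) g)"
    using invertible_of_lyapunov_less invertible_of_lyapunov_greater[OF assms] by blast
qed

end

theorem theorem1p1:
  fixes T :: "'a::metric_space \<Rightarrow> 'a"
    and \<mu> :: "'a measure"
    and v :: "'a \<Rightarrow> complex"
    and g :: real
    and x y :: 'a
  assumes "compact (UNIV :: 'a set)"
    and "connected (UNIV :: 'a set)"
    and "homeomorphism UNIV UNIV T (inv T)"
    and "strictly_ergodic T"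
    and "invariant_prob T \<mu>"
    and "continuous_on UNIV v"
    and "g > 0"
  shows "ell2_spectrum (hatano_nelson T v g x) =
      {E. lyapunov_exponent \<mu> T v E = g} \<union>
      (ell2_spectrum (hatano_nelson T v 0 y) \<inter> {E. lyapunov_exponent \<mu> T v E > g})"
proof (rule set_eqI)
  fix E
  interpret ergodic_schroedinger T \<mu> v E
    by (rule ergodic_schroedinger.intro) fact+
  have "E \<notin> ell2_spectrum (hatano_nelson T v g x) \<longleftrightarrow>
      lyap < g \<or> (g < lyap \<and> E \<notin> ell2_spectrum (hatano_nelson T v 0 y))"
    using invertible_iff[of g x y] \<open>g > 0\<close> unfolding not_in_spectrum_iff orbit_pot_def[abs_def] by simp
  then show "E \<in> ell2_spectrum (hatano_nelson T v g x) \<longleftrightarrow>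
      E \<in> {E. lyapunov_exponent \<mu> T v E = g} \<union>
      (ell2_spectrum (hatano_nelson T v 0 y) \<inter> {E. lyapunov_exponent \<mu> T v E > g})"
    by auto
qed

end
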